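(* Let $\mathcal S=\{\mathcal X_\alpha^\delta\in\Pi\mid\alpha\in V,\ \delta\in[0,\infty]\}$ with the subspace topology from the weak topology of $\Pi$. Let $\sim$ be the equivalence relation on $V\times[0,\infty]$ generated by: $(\alpha,\delta)\sim(\beta,\delta')$ if ($\alpha=1$ or $\delta=0$) and ($\beta=1$ or $\delta'=0$). Then the map $$\Psi:(V\times[0,\infty])/\!\sim\ \to\mathcal S,\qquad\Psi([\alpha,\delta])=\mathcal X_\alpha^\delta,$$ is (well defined and) a homeomorphism, where $(V\times[0,\infty])/\!\sim$ carries the quotient topology of the product topology of $V$ (with the $\ell_\infty$-topology) and $[0,\infty]$.
   Context: A pm-space is a triple $X=(X,d_X,m_X)$ with $(X,d_X)$ a complete separable metric space and $m_X$ a Borel probability measure. Two pm-spaces are isomorphic if there is an isometry $\operatorname{supp} m_X\to\operatorname{supp} m_Y$ pushing $m_X$ forward to $m_Y$; $\mathcal X$ is the set of isomorphism classes, and a class is always represented by a space with $\operatorname{supp}m_X=X$. Lipschitz order: $Y\prec X$ iff there is a $1$-Lipschitz map $\phi:X\to Y$ with $\phi_\#m_X=m_Y$. Box distance: a parameter of $X$ is a Borel map $a:[0,1]\to X$ with $a_\#\mathcal L^1=m_X$; $\square(X,Y)$ is the infimum of $\epsilon>0$ such that there are parameters $a$ of $X$, $b$ of $Y$ and a Borel set $I_0\subset[0,1]$ with $\mathcal L^1(I_0)\ge1-\epsilon$ and $|d_X(a(s),a(t))-d_Y(b(s),b(t))|\le\epsilon$ for all $s,t\in I_0$. A pyramid is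 a non-empty, $\square$-closed subset $P\subset\mathcal X$ that is downward-closed for $\prec$ and directed (any $X,Y\in P$ have some $Z\in P$ with $X,Y\prec Z$). $\Pi$ is the set of pyramids. Pyramids $P_n$ converge weakly to $P$ if (1) every $X\in P$ is a $\square$-limit of some $X_n\in P_n$, and (2) $\liminf_n\inf_{Y\in P_n}\square(X,Y)>0$ for every $X\notin P$; this is convergence for a compact metrizable topology on $\Pi$ (the weak topology). $V=\{\alpha=(\alpha_i)_{i\ge1}\in[0,\infty)^{\mathbb N}\mid\sum_i\alpha_i\le1,\ \alpha_i\ge\alpha_{i+1}\ \forall i\}$; $1$ denotes $(1,0,0,\dots)\in V$. For $\alpha\in V$, $\mathcal X_\alpha$ is the set of $X\in\mathcal X$ for which there is a map $f:\mathbb N\to X$ such that $m_X-\sum_{i=1}^\infty\alpha_i\delta_{f(i)}$ is a nonnegative measure. For $\delta\in[0,\infty]$, $\mathcal X_\alpha^\delta=\{X\in\mathcal X_\alpha\mid\operatorname{diam}\operatorname{supp}m_X\le\delta\}$ (so $\mathcal X_\alpha^\infty=\mathcal X_\alpha$); these are pyramids. *)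

theory Defs
  imports "HOL-Probability.Probability"
begin

section \<open>Pm-spaces and their isomorphism classes\<close>

text \<open>
  The carrier of a pm-space is a subset of the fixed type \<open>nat \<Rightarrow> real\<close>, with an arbitrary metric
  unrelated to the usual structure of that type. No isomorphism class is lost: if \<open>(x\<^sub>n)\<close> is a dense
  sequence in a complete separable metric space, then \<open>x \<mapsto> (d x x\<^sub>n)\<^sub>n\<close> is injective.
\<close>

type_synonym pm = "(nat \<Rightarrow> real) metric \<times> (nat \<Rightarrow> real) measure"

abbreviation pm_carrier :: "pm \<Rightarrow> (nat \<Rightarrow> real) set"
  where "pm_carrier X \<equiv> mspace (fst X)"

abbreviation pm_dist :: "pm \<Rightarrow> (nat \<Rightarrow> real) \<Rightarrow> (nat \<Rightarrow> real) \<Rightarrow> real"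
  where "pm_dist X \<equiv> mdist (fst X)"

abbreviation pm_measure :: "pm \<Rightarrow> (nat \<Rightarrow> real) measure"
  where "pm_measure X \<equiv> snd X"

definition borel_of_metric :: "'a metric \<Rightarrow> 'a measure"
  where "borel_of_metric M = sigma (mspace M) {U. openin (mtopology_of M) U}"

definition pm_space :: "pm \<Rightarrow> bool"
  where "pm_space X \<longleftrightarrow>
    mcomplete_of (fst X) \<and> separable_space (mtopology_of (fst X)) \<and>
    sets (pm_measure X) = sets (borel_of_metric (fst X)) \<and> prob_space (pm_measure X)"

definition pm_supp :: "pm \<Rightarrow> (nat \<Rightarrow> real) set"
  where "pm_supp X =
    {x \<in> pm_carrier X. \<forall>U. openin (mtopology_of (fst X)) U \<and> x \<in> U \<longrightarrow> 0 < emeasure (pm_measure X) U}"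

definition pm_iso :: "(pm \<times> pm) set"
  where "pm_iso = {(X, Y). pm_space X \<and> pm_space Y \<and>
    (\<exists>f. f ` pm_supp X = pm_supp Y \<and>
         (\<forall>x\<in>pm_supp X. \<forall>y\<in>pm_supp X. pm_dist Y (f x) (f y) = pm_dist X x y) \<and>
         distr (restrict_space (pm_measure X) (pm_supp X)) (pm_measure Y) f = pm_measure Y)}"

definition pm_classes :: "pm set set"
  where "pm_classes = {X. pm_space X} // pm_iso"

definition pm_rep :: "pm set \<Rightarrow> pm"
  where "pm_rep C = (SOME X. X \<in> C \<and> pm_supp X = pm_carrier X)"

section \<open>Lipschitz order and box distance\<close>

definition lip_le :: "pm set \<Rightarrow> pm set \<Rightarrow> bool"
  where "lip_le D C \<longleftrightarrow> (let X = pm_rep C; Y = pm_rep D in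
    \<exists>\<phi>\<in>pm_carrier X \<rightarrow> pm_carrier Y.
      (\<forall>x\<in>pm_carrier X. \<forall>y\<in>pm_carrier X. pm_dist Y (\<phi> x) (\<phi> y) \<le> pm_dist X x y) \<and>
      distr (pm_measure X) (pm_measure Y) \<phi> = pm_measure Y)"

abbreviation unit_interval_measure :: "real measure"
  where "unit_interval_measure \<equiv> restrict_space lborel {0..1}"

definition pm_parameter :: "pm \<Rightarrow> (real \<Rightarrow> nat \<Rightarrow> real) \<Rightarrow> bool"
  where "pm_parameter X a \<longleftrightarrow>
    a \<in> unit_interval_measure \<rightarrow>\<^sub>M pm_measure X \<and>
    distr unit_interval_measure (pm_measure X) a = pm_measure X"

definition box_dist :: "pm set \<Rightarrow> pm set \<Rightarrow> real"
  where "box_dist C D = (let X = pm_rep C; Y = pm_rep D in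
    Inf {\<epsilon>. \<epsilon> > 0 \<and> (\<exists>a b I\<^sub>0. pm_parameter X a \<and> pm_parameter Y b \<and>
      I\<^sub>0 \<in> sets borel \<and> I\<^sub>0 \<subseteq> {0..1} \<and> measure lborel I\<^sub>0 \<ge> 1 - \<epsilon> \<and>
      (\<forall>s\<in>I\<^sub>0. \<forall>t\<in>I\<^sub>0. \<bar>pm_dist X (a s) (a t) - pm_dist Y (b s) (b t)\<bar> \<le> \<epsilon>))})"

definition box_tendsto :: "(nat \<Rightarrow> pm set) \<Rightarrow> pm set \<Rightarrow> bool"
  where "box_tendsto Cs C \<longleftrightarrow> (\<lambda>n. box_dist (Cs n) C) \<longlonglongrightarrow> 0"

definition box_closed :: "pm set set \<Rightarrow> bool"
  where "box_closed P \<longleftrightarrow>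
    (\<forall>Cs. \<forall>C\<in>pm_classes. (\<forall>n. Cs n \<in> P) \<and> box_tendsto Cs C \<longrightarrow> C \<in> P)"

section \<open>Pyramids and the weak topology\<close>

definition pyramids :: "pm set set set"
  where "pyramids = {P. P \<subseteq> pm_classes \<and> P \<noteq> {} \<and> box_closed P \<and>
    (\<forall>C\<in>P. \<forall>D\<in>pm_classes. lip_le D C \<longrightarrow> D \<in> P) \<and>
    (\<forall>C\<in>P. \<forall>D\<in>P. \<exists>E\<in>P. lip_le C E \<and> lip_le D E)}"

definition weak_tendsto :: "(nat \<Rightarrow> pm set set) \<Rightarrow> pm set set \<Rightarrow> bool"
  where "weak_tendsto Ps P \<longleftrightarrow>
    (\<forall>C\<in>P. \<exists>Cs. (\<forall>n. Cs n \<in> Ps n) \<and> box_tendsto Cs C) \<and>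
    (\<forall>C\<in>pm_classes - P. liminf (\<lambda>n. INF D\<in>Ps n. ereal (box_dist C D)) > 0)"

text \<open>
  A metrizable topology is determined by its convergent sequences: its open sets are exactly the
  sequentially open ones. The weak topology is therefore defined by its sequentially open sets; see
  \<open>weak_topology_unique\<close> below.
\<close>

definition weak_topology :: "pm set set topology"
  where "weak_topology = topology (\<lambda>U. U \<subseteq> pyramids \<and>
    (\<forall>Ps. \<forall>P\<in>U. (\<forall>n. Ps n \<in> pyramids) \<and> weak_tendsto Ps P \<longrightarrow> (\<forall>\<^sub>F n in sequentially. Ps n \<in> U)))"

lemma openin_weak_topology:
  "openin weak_topology U \<longleftrightarrow> U \<subseteq> pyramids \<and>
    (\<forall>Ps. \<forall>P\<in>U. (\<forall>n. Ps n \<in> pyramids) \<and> weak_tendsto Ps P \<longrightarrow> (\<forall>\<^sub>F n in sequentially. Ps n \<in> U))"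
proof -
  let ?O = "\<lambda>U. U \<subseteq> pyramids \<and>
    (\<forall>Ps. \<forall>P\<in>U. (\<forall>n. Ps n \<in> pyramids) \<and> weak_tendsto Ps P \<longrightarrow> (\<forall>\<^sub>F n in sequentially. Ps n \<in> U))"
  have "istopology ?O"
    unfolding istopology_def
  proof (intro conjI allI impI)
    fix S T assume "?O S" "?O T"
    then show "S \<inter> T \<subseteq> pyramids"
      by blast
    show "\<forall>P\<in>S \<inter> T. (\<forall>n. Ps n \<in> pyramids) \<and> weak_tendsto Ps P \<longrightarrow>
            (\<forall>\<^sub>F n in sequentially. Ps n \<in> S \<inter> T)" for Ps
    proof (intro ballI impI)
      fix P assume "P \<in> S \<inter> T" and *: "(\<forall>n. Ps n \<in> pyramids) \<and> weak_tendsto Ps P"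
      then have "\<forall>\<^sub>F n in sequentially. Ps n \<in> S" "\<forall>\<^sub>F n in sequentially. Ps n \<in> T"
        using \<open>?O S\<close> \<open>?O T\<close> by blast+
      then show "\<forall>\<^sub>F n in sequentially. Ps n \<in> S \<inter> T"
        by eventually_elim blast
    qed
  next
    fix K assume K: "\<forall>S\<in>K. ?O S"
    then show "\<Union>K \<subseteq> pyramids"
      by blast
    show "\<forall>P\<in>\<Union>K. (\<forall>n. Ps n \<in> pyramids) \<and> weak_tendsto Ps P \<longrightarrow>
            (\<forall>\<^sub>F n in sequentially. Ps n \<in> \<Union>K)" for Ps
    proof (intro ballI impI)
      fix P assume "P \<in> \<Union>K" and *: "(\<forall>n. Ps n \<in> pyramids) \<and> weak_tendsto Ps P"
      then obtain S where S: "S \<in> K" "P \<in> S"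
        by blast
      with K * have "\<forall>\<^sub>F n in sequentially. Ps n \<in> S"
        by blast
      then show "\<forall>\<^sub>F n in sequentially. Ps n \<in> \<Union>K"
        by (rule eventually_mono) (use S in blast)
    qed
  qed
  then show ?thesis
    by (simp add: weak_topology_def)
qed

lemma topspace_weak_topology [simp]: "topspace weak_topology = pyramids"
proof
  show "topspace weak_topology \<subseteq> pyramids"
    using openin_topspace[of weak_topology] unfolding openin_weak_topology by blast
  have "openin weak_topology pyramids"
    by (simp add: openin_weak_topology)
  then show "pyramids \<subseteq> topspace weak_topology"
    by (rule openin_subset)
qed

lemma weak_topology_unique:
  assumes "metrizable_space T" "topspace T = pyramids"
    and lim: "\<And>Ps P. (\<forall>n. Ps n \<in> pyramids) \<Longrightarrow> P \<in> pyramids \<Longrightarrow>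
            limitin T Ps P sequentially \<longleftrightarrow> weak_tendsto Ps P"
  shows "T = weak_topology"
  unfolding topology_eq
proof (intro allI iffI)
  fix U assume U: "openin T U"
  then have "U \<subseteq> pyramids"
    using assms(2) openin_subset by fastforce
  moreover have "\<forall>\<^sub>F n in sequentially. Ps n \<in> U"
    if "P \<in> U" "\<forall>n. Ps n \<in> pyramids" "weak_tendsto Ps P" for Ps P
    using that lim[of Ps P] \<open>U \<subseteq> pyramids\<close> U by (auto simp: limitin_def)
  ultimately show "openin weak_topology U"
    by (auto simp: openin_weak_topology)
next
  fix U assume U: "openin weak_topology U"
  obtain M d where Md: "Metric_space M d" "T = Metric_space.mtopology M d"
    using assms(1) unfolding metrizable_space_def by blast
  interpret Metric_space M d by fact
  have M: "M = pyramids"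
    using assms(2) Md by simp
  have "closedin mtopology (M - U)"
    unfolding metric_closedin_iff_sequentially_closed
  proof (intro conjI allI impI)
    fix \<sigma> l assume *: "range \<sigma> \<subseteq> M - U \<and> limitin mtopology \<sigma> l sequentially"
    then have l: "l \<in> pyramids"
      using M limitin_mspace by blast
    have "l \<notin> U"
    proof
      assume "l \<in> U"
      have "\<forall>n. \<sigma> n \<in> pyramids"
        using * M by blast
      moreover have "weak_tendsto \<sigma> l"
        using * l lim[of \<sigma> l] calculation Md by blast
      ultimately have "\<forall>\<^sub>F n in sequentially. \<sigma> n \<in> U"
        using U \<open>l \<in> U\<close> by (auto simp: openin_weak_topology)
      then obtain n where "\<sigma> n \<in> U"
        by (auto simp: eventually_sequentially)
      then show False
        using * by blast
    qed
    then show "l \<in> M - U"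
      using l M by blast
  qed blast
  moreover have "U \<subseteq> M"
    using U M by (simp add: openin_weak_topology)
  ultimately show "openin T U"
    using Md by (simp add: openin_closedin_eq)
qed

section \<open>The pyramids with prescribed atoms and diameter\<close>

text \<open>Sequences are indexed from \<open>0\<close> instead of \<open>1\<close>.\<close>

definition V :: "(nat \<Rightarrow> real) set"
  where "V = {\<alpha>. (\<forall>i. 0 \<le> \<alpha> i) \<and> summable \<alpha> \<and> (\<Sum>i. \<alpha> i) \<le> 1 \<and> (\<forall>i. \<alpha> (Suc i) \<le> \<alpha> i)}"

definition one_V :: "nat \<Rightarrow> real"
  where "one_V = (\<lambda>i. if i = 0 then 1 else 0)"

text \<open>\<open>funspace UNIV euclidean_metric\<close> is the space of bounded sequences with the supremum metric.\<close>

definition V_topology :: "(nat \<Rightarrow> real) topology"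
  where "V_topology = subtopology (mtopology_of (funspace UNIV euclidean_metric)) V"

lemma topspace_V_topology [simp]: "topspace V_topology = V"
proof -
  have "bounded (range \<alpha>)" if "\<alpha> \<in> V" for \<alpha>
  proof -
    have "\<alpha> \<longlonglongrightarrow> 0"
      using that by (intro summable_LIMSEQ_zero) (simp add: V_def)
    then show ?thesis
      by (rule convergent_imp_bounded)
  qed
  then have "V \<subseteq> mspace (funspace UNIV (euclidean_metric :: real metric))"
    by (auto simp: Met_TC.fspace_def)
  then show ?thesis
    by (auto simp: V_topology_def)
qed

definition atoms_pyramid :: "(nat \<Rightarrow> real) \<Rightarrow> pm set set"
  where "atoms_pyramid \<alpha> = {C\<in>pm_classes. let X = pm_rep C in
    \<exists>f. (\<forall>i. f i \<in> pm_carrier X) \<and>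
      (\<forall>A\<in>sets (pm_measure X). (\<Sum>i. ennreal (\<alpha> i) * indicator A (f i :: nat \<Rightarrow> real)) \<le> emeasure (pm_measure X) A)}"

definition pm_diam :: "pm \<Rightarrow> ennreal"
  where "pm_diam X = (SUP x\<in>pm_supp X. SUP y\<in>pm_supp X. ennreal (pm_dist X x y))"

definition atoms_diam_pyramid :: "(nat \<Rightarrow> real) \<Rightarrow> ennreal \<Rightarrow> pm set set"
  where "atoms_diam_pyramid \<alpha> \<delta> = {C \<in> atoms_pyramid \<alpha>. pm_diam (pm_rep C) \<le> \<delta>}"

definition S_pyramids :: "pm set set set"
  where "S_pyramids = {P \<in> pyramids. \<exists>\<alpha>\<in>V. \<exists>\<delta>. P = atoms_diam_pyramid \<alpha> \<delta>}"

section \<open>The quotient space\<close>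

definition generated_equiv :: "'a set \<Rightarrow> ('a \<times> 'a) set \<Rightarrow> ('a \<times> 'a) set"
  where "generated_equiv A r = \<Inter>{R. equiv A R \<and> r \<inter> A \<times> A \<subseteq> R}"

definition sim :: "((((nat \<Rightarrow> real) \<times> ennreal) \<times> ((nat \<Rightarrow> real) \<times> ennreal))) set"
  where "sim = generated_equiv (V \<times> UNIV)
    {((\<alpha>, \<delta>), (\<beta>, \<delta>')). (\<alpha> = one_V \<or> \<delta> = 0) \<and> (\<beta> = one_V \<or> \<delta>' = 0)}"

definition quotient_topology :: "'a topology \<Rightarrow> ('a \<times> 'a) set \<Rightarrow> 'a set topology"
  where "quotient_topology T r =
    topology (\<lambda>U. U \<subseteq> topspace T // r \<and> openin T {x \<in> topspace T. r `` {x} \<in> U})"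

lemma openin_quotient_topology:
  "openin (quotient_topology T r) U \<longleftrightarrow>
    U \<subseteq> topspace T // r \<and> openin T {x \<in> topspace T. r `` {x} \<in> U}"
proof -
  let ?O = "\<lambda>U. U \<subseteq> topspace T // r \<and> openin T {x \<in> topspace T. r `` {x} \<in> U}"
  have "istopology ?O"
    unfolding istopology_def
  proof (intro conjI allI impI)
    fix U W assume "?O U" "?O W"
    then show "U \<inter> W \<subseteq> topspace T // r"
      by blast
    have "{x \<in> topspace T. r `` {x} \<in> U \<inter> W} =
        {x \<in> topspace T. r `` {x} \<in> U} \<inter> {x \<in> topspace T. r `` {x} \<in> W}"
      by blast
    then show "openin T {x \<in> topspace T. r `` {x} \<in> U \<inter> W}"
      using \<open>?O U\<close> \<open>?O W\<close> by (simp only: openin_Int)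
  next
    fix K assume K: "\<forall>U\<in>K. ?O U"
    then show "\<Union>K \<subseteq> topspace T // r"
      by blast
    have "{x \<in> topspace T. r `` {x} \<in> \<Union>K} = (\<Union>U\<in>K. {x \<in> topspace T. r `` {x} \<in> U})"
      by blast
    then show "openin T {x \<in> topspace T. r `` {x} \<in> \<Union>K}"
      using K by auto
  qed
  then show ?thesis
    by (simp add: quotient_topology_def)
qed

definition V_quotient :: "((nat \<Rightarrow> real) \<times> ennreal) set topology"
  where "V_quotient = quotient_topology (prod_topology V_topology euclidean) sim"

definition Psi :: "((nat \<Rightarrow> real) \<times> ennreal) set \<Rightarrow> pm set set"
  where "Psi c = the_elem ((\<lambda>(\<alpha>, \<delta>). atoms_diam_pyramid \<alpha> \<delta>) ` c)"

end

(*
  The map (alpha, delta) |-> X_alpha^delta is sequentially continuous for weak convergence. If Y_n in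
  X_{alpha_n}^{delta_n} box-converge to X, the positions of the i-th atoms, read in X through nearly
  optimal parameters, are centres of small balls of mass bounded below; completeness makes them
  subconverge, and a diagonal subsequence yields the atoms alpha of X. Conversely, X in X_alpha^delta has
  a parameter that equals the i-th atom on the i-th of consecutive intervals of lengths alpha_i and is
  almost everywhere continuous on the rest; making it constant on the corresponding intervals for
  alpha_n, and capping the metric at delta_n, gives elements of X_{alpha_n}^{delta_n} close to X.

  Weak limits are unique and V x [0, infinity] is sequentially compact, so continuity already makes the
  map closed, without using the metrizability of the weak topology. For injectivity, spaces with all
  distances equal c recover delta from the admissible c, and alpha from its partial sums, which bound
  those of any beta with X_alpha^delta contained in X_beta^delta'.
*)

theory Submission
  imports Defs "HOL-Library.Diagonal_Subsequence"
begin

section \<open>Consecutive intervals\<close>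

text \<open>The obstacle to continuity is that total mass is not continuous on \<open>V\<close>: the
  sums of \<open>\<alpha> n\<close> may all be 1 while the entrywise limit \<beta> has a smaller
  sum, the difference having been ground into ever smaller atoms. When a limit space is examined,
  only finitely many indices with \<beta> i > 0 are handled at a time; several of them may end at
  one point, so masses are compared on finite sets of positions and not point by point. When a space
  is approximated, diffuse mass must be imitated by many small atoms. Here the bound \<alpha> i
  \<le> 1 / (i + 1) on \<open>V\<close> enters: late intervals are short, and a curve continuous at
  almost every point of the rest moves little when it is frozen on short intervals. An arbitrary
  Borel parameter would not do, hence the parameters built from nested intervals. The same bound
  makes entrywise convergence uniform on \<open>V\<close>, which matches the sup-norm topology. New
  spaces are given as laws of curves on [0,1], because atoms and box distance can be read off a
  curve, whereas the chosen representative of a class is known only up to isometry.\<close>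

definition item :: "real \<Rightarrow> (nat \<Rightarrow> real) \<Rightarrow> nat \<Rightarrow> real set"
  where "item b c i = {b + (\<Sum>j<i. c j) ..< b + (\<Sum>j<Suc i. c j)}"

lemma sum_lessThan_mono:
  fixes c :: "nat \<Rightarrow> real"
  assumes "\<And>i. 0 \<le> c i" "i \<le> j"
  shows "(\<Sum>k<i. c k) \<le> (\<Sum>k<j. c k)"
  using assms by (intro sum_mono2) auto

lemma disjoint_family_item:
  assumes "\<And>i. 0 \<le> c i"
  shows "disjoint_family (item b c)"
proof -
  have "item b c i \<inter> item b c j = {}" if "i < j" for i j
    using sum_lessThan_mono[of c "Suc i" j] that assms by (auto simp: item_def)
  then show ?thesis
    unfolding disjoint_family_on_def by (metis inf_commute linorder_neqE_nat)
qed

text \<open>The partial sums increase to \<open>s\<close>, so every point below \<open>b + s\<close>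
  lies below one of them; the first partial sum above the point ends the interval that contains
  it.\<close>

lemma UN_item:
  assumes nn: "\<And>i. 0 \<le> c i" and "c sums s"
  shows "(\<Union>i. item b c i) = {b..<b + s}"
proof (intro equalityI subsetI)
  fix t assume "t \<in> (\<Union>i. item b c i)"
  then obtain i where "t \<in> item b c i" by blast
  moreover have "(\<Sum>j<Suc i. c j) \<le> s"
    using assms by (metis sum_le_suminf sums_iff finite_lessThan)
  moreover have "0 \<le> (\<Sum>j<i. c j)"
    using nn by (simp add: sum_nonneg)
  ultimately show "t \<in> {b..<b + s}"
    by (auto simp: item_def)
next
  fix t assume t: "t \<in> {b..<b + s}"
  have "(\<lambda>n. \<Sum>j<n. c j) \<longlonglongrightarrow> s"
    using \<open>c sums s\<close> by (simp add: sums_def)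
  then have "\<forall>\<^sub>F n in sequentially. t - b < (\<Sum>j<n. c j)"
    using t by (intro order_tendstoD) auto
  then obtain m where m: "t < b + (\<Sum>j<m. c j)"
    by (metis eventually_sequentially order_refl diff_less_eq add.commute)
  define n where "n = (LEAST n. t < b + (\<Sum>j<n. c j))"
  have n: "t < b + (\<Sum>j<n. c j)"
    unfolding n_def using m by (rule LeastI)
  then obtain i where i: "n = Suc i"
    using t by (cases n) auto
  have "\<not> t < b + (\<Sum>j<i. c j)"
    using i not_less_Least[of i "\<lambda>n. t < b + (\<Sum>j<n. c j)"] by (simp add: n_def)
  then show "t \<in> (\<Union>i. item b c i)"
    using n i by (auto simp: item_def not_less)
qed

lemma item_borel [measurable, simp]: "item b c i \<in> sets borel"
  by (simp add: item_def)

lemma emeasure_item: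
  assumes "0 \<le> c i"
  shows "emeasure lborel (item b c i) = ennreal (c i)"
  using assms by (simp add: item_def)

section \<open>Borel sets of a separable metric space\<close>

lemma space_borel_of_metric [simp]: "space (borel_of_metric m) = mspace m"
  unfolding borel_of_metric_def
  by (rule space_measure_of) (use openin_subset in fastforce)

lemma sets_borel_of_metric:
  "sets (borel_of_metric m) = sigma_sets (mspace m) {U. openin (mtopology_of m) U}"
  unfolding borel_of_metric_def
  by (rule sets_measure_of) (use openin_subset in fastforce)

lemma openin_borel_of_metric: "openin (mtopology_of m) U \<Longrightarrow> U \<in> sets (borel_of_metric m)"
  by (auto simp: sets_borel_of_metric)

lemma closedin_borel_of_metric:
  assumes "closedin (mtopology_of m) C"
  shows "C \<in> sets (borel_of_metric m)"
proof -
  have "mspace m - C \<in> sets (borel_of_metric m)"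
    using assms by (intro openin_borel_of_metric) (auto simp: closedin_def)
  then have "space (borel_of_metric m) - (mspace m - C) \<in> sets (borel_of_metric m)"
    by (rule sets.compl_sets)
  moreover have "space (borel_of_metric m) - (mspace m - C) = C"
    using assms closedin_subset by fastforce
  ultimately show ?thesis by simp
qed

text \<open>Closed sets are preferred as generators because the preimage of a closed set under the
  limit map \<open>point\<close> is a countable intersection of unions of intervals.\<close>

lemma sets_borel_of_metric_closedin:
  "sets (borel_of_metric m) = sigma_sets (mspace m) {C. closedin (mtopology_of m) C}"
proof
  have sub: "{C. closedin (mtopology_of m) C} \<subseteq> Pow (mspace m)"
    using closedin_subset by fastforce
  show "sigma_sets (mspace m) {C. closedin (mtopology_of m) C} \<subseteq> sets (borel_of_metric m)"
    using sets.sigma_sets_subset[of "{C. closedin (mtopology_of m) C}" "borel_of_metric m"]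
      closedin_borel_of_metric by fastforce
  have "U \<in> sigma_sets (mspace m) {C. closedin (mtopology_of m) C}"
    if "openin (mtopology_of m) U" for U
  proof -
    have "closedin (mtopology_of m) (mspace m - U)"
      using that by (metis openin_closedin_eq topspace_mtopology_of)
    then have "mspace m - (mspace m - U) \<in> sigma_sets (mspace m) {C. closedin (mtopology_of m) C}"
      by (intro sigma_sets.Compl sigma_sets.Basic) simp
    moreover have "mspace m - (mspace m - U) = U"
      using that openin_subset by fastforce
    ultimately show ?thesis by simp
  qed
  then show "sets (borel_of_metric m) \<subseteq> sigma_sets (mspace m) {C. closedin (mtopology_of m) C}"
    unfolding sets_borel_of_metric by (intro sigma_sets_mono) auto
qed

lemma mball_borel_of_metric:
  assumes "p \<in> mspace m"
  shows "{x \<in> mspace m. mdist m p x < r} \<in> sets (borel_of_metric m)"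
proof -
  interpret Metric_space "mspace m" "mdist m" by simp
  have "{x \<in> mspace m. mdist m p x < r} = mball p r"
    using assms by auto
  then show ?thesis
    by (metis openin_borel_of_metric openin_mball mtopology_of_def)
qed

lemma measurable_borel_of_metricI:
  assumes "f \<in> space N \<rightarrow> mspace m"
    and "\<And>U. openin (mtopology_of m) U \<Longrightarrow> f -` U \<inter> space N \<in> sets N"
  shows "f \<in> N \<rightarrow>\<^sub>M borel_of_metric m"
  unfolding borel_of_metric_def
  by (rule measurable_measure_of) (use assms openin_subset in fastforce)+

lemma measurable_continuous_map:
  assumes "continuous_map (mtopology_of m) (mtopology_of m') f"
  shows "f \<in> borel_of_metric m \<rightarrow>\<^sub>M borel_of_metric m'"
proof (rule measurable_borel_of_metricI)
  show "f \<in> space (borel_of_metric m) \<rightarrow> mspace m'"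
    using assms by (auto simp: continuous_map_def)
  fix U assume "openin (mtopology_of m') U"
  then have "openin (mtopology_of m) {x \<in> mspace m. f x \<in> U}"
    using openin_continuous_map_preimage[OF assms] by simp
  moreover have "f -` U \<inter> space (borel_of_metric m) = {x \<in> mspace m. f x \<in> U}"
    by auto
  ultimately show "f -` U \<inter> space (borel_of_metric m) \<in> sets (borel_of_metric m)"
    by (simp add: openin_borel_of_metric)
qed

text \<open>Repetitions are allowed, so finite spaces are included; a space with a dense sequence is
  nonempty.\<close>

definition dense_seq :: "'a metric \<Rightarrow> (nat \<Rightarrow> 'a) \<Rightarrow> bool"
  where "dense_seq m p \<longleftrightarrow> range p \<subseteq> mspace m \<and> (\<forall>x\<in>mspace m. \<forall>r>0. \<exists>n. mdist m (p n) x < r)"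

lemma separable_imp_dense_seq:
  assumes "separable_space (mtopology_of m)" "mspace m \<noteq> {}"
  obtains p where "dense_seq m p"
proof -
  interpret Metric_space "mspace m" "mdist m" by simp
  obtain C where C: "countable C" "C \<subseteq> mspace m" "mtopology closure_of C = mspace m"
    using assms(1) unfolding separable_space_def mtopology_of_def
    by (metis topspace_mtopology)
  have "C \<noteq> {}"
    using C assms(2) by auto
  then obtain p :: "nat \<Rightarrow> 'a" where p: "range p = C"
    using C(1) by (metis uncountable_def)
  have "dense_seq m p"
    unfolding dense_seq_def
  proof (intro conjI ballI allI impI)
    show "range p \<subseteq> mspace m" using p C by simp
    fix x and r :: real assume "x \<in> mspace m" "0 < r"
    then have "x \<in> mtopology closure_of C" using C by simp
    then obtain y where "y \<in> C" "y \<in> mball x r"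
      using \<open>0 < r\<close> by (auto simp: metric_closure_of)
    then show "\<exists>n. mdist m (p n) x < r"
      using p commute by (metis in_mball imageE)
  qed
  then show thesis by (rule that)
qed

lemma dense_seq_imp_separable:
  assumes "dense_seq m p"
  shows "separable_space (mtopology_of m)"
proof -
  interpret Metric_space "mspace m" "mdist m" by simp
  have "mtopology closure_of (range p) = mspace m"
  proof (intro equalityI subsetI)
    fix x assume x: "x \<in> mspace m"
    show "x \<in> mtopology closure_of (range p)"
      unfolding metric_closure_of
    proof (intro CollectI conjI allI impI x)
      fix r :: real assume "0 < r"
      then obtain n where "mdist m (p n) x < r"
        using assms x unfolding dense_seq_def by blast
      moreover have "p n \<in> mspace m"
        using assms unfolding dense_seq_def by blast
      ultimately have "p n \<in> mball x r"
        using x by (simp add: commute)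
      then show "\<exists>y\<in>range p. y \<in> mball x r" by blast
    qed
  qed (use closure_of_subset_topspace in fastforce)
  moreover have "range p \<subseteq> mspace m"
    using assms by (auto simp: dense_seq_def)
  ultimately show ?thesis
    unfolding separable_space_def mtopology_of_def
    by (metis topspace_mtopology countable_image countableI_type)
qed

text \<open>An open set is the union of the countably many balls inside it whose centre is some
  \<open>p n\<close> and whose radius is some \<open>1 / (k + 1)\<close>.\<close>

lemma measurable_dense_ballI:
  assumes p: "dense_seq m p" and f: "f \<in> space N \<rightarrow> mspace m"
    and *: "\<And>n r. 0 < r \<Longrightarrow> {t \<in> space N. mdist m (p n) (f t) < r} \<in> sets N"
  shows "f \<in> N \<rightarrow>\<^sub>M borel_of_metric m"
proof (rule measurable_borel_of_metricI[OF f])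
  interpret Metric_space "mspace m" "mdist m" by simp
  fix U assume "openin (mtopology_of m) U"
  then have U: "openin mtopology U" by (simp add: mtopology_of_def)
  define I where "I = {(n, k). mball (p n) (1 / real (Suc k)) \<subseteq> U}"
  have "f -` U \<inter> space N = (\<Union>(n, k)\<in>I. {t \<in> space N. mdist m (p n) (f t) < 1 / real (Suc k)})"
  proof (intro equalityI subsetI)
    fix t assume t: "t \<in> f -` U \<inter> space N"
    then have ft: "f t \<in> mspace m" using f by blast
    obtain r where r: "0 < r" "mball (f t) r \<subseteq> U"
      using U t by (auto simp: openin_mtopology)
    obtain k where k: "1 / real (Suc k) < r / 2"
      using r by (meson half_gt_zero nat_approx_posE)
    obtain n where n: "mdist m (p n) (f t) < 1 / real (Suc k)"
      using p ft unfolding dense_seq_def by (meson of_nat_0_less_iff zero_less_Suc zero_less_divide_1_iff)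
    have pn: "p n \<in> mspace m"
      using p by (auto simp: dense_seq_def)
    have "mball (p n) (1 / real (Suc k)) \<subseteq> mball (f t) r"
    proof
      fix y assume y: "y \<in> mball (p n) (1 / real (Suc k))"
      have "mdist m (f t) y \<le> mdist m (f t) (p n) + mdist m (p n) y"
        using ft pn y by (intro triangle) auto
      then show "y \<in> mball (f t) r"
        using y n k ft commute by (smt (verit) in_mball field_sum_of_halves)
    qed
    then have "(n, k) \<in> I"
      using r by (auto simp: I_def)
    then show "t \<in> (\<Union>(n, k)\<in>I. {t \<in> space N. mdist m (p n) (f t) < 1 / real (Suc k)})"
      using n t by blast
  next
    fix t assume "t \<in> (\<Union>(n, k)\<in>I. {t \<in> space N. mdist m (p n) (f t) < 1 / real (Suc k)})"
    then obtain n k where nk: "(n, k) \<in> I" "t \<in> space N" "mdist m (p n) (f t) < 1 / real (Suc k)"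
      by blast
    then have "f t \<in> mball (p n) (1 / real (Suc k))"
      using f p by (auto simp: dense_seq_def)
    then show "t \<in> f -` U \<inter> space N"
      using nk by (auto simp: I_def)
  qed
  also have "\<dots> \<in> sets N"
    by (intro sets.countable_UN') (auto intro!: *)
  finally show "f -` U \<inter> space N \<in> sets N" .
qed

section \<open>Realizing a finite measure on an interval\<close>

text \<open>Realizes \<nu> as the image of Lebesgue measure on an interval starting at
  \<open>s0\<close>, by a map that is continuous off a countable set. At level \<open>k\<close> a
  point receives as letter the first dense point within \<open>(1/2)^k\<close>. The words of each
  length partition the space into cylinders, and the interval is partitioned in parallel into nested
  intervals \<open>J w\<close> whose lengths are the masses of the cylinders. A time
  \<open>t\<close> then has an address, whose letters converge to \<open>point t\<close>.\<close>

locale nested_intervals =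
  fixes m :: "'a metric" and p :: "nat \<Rightarrow> 'a" and \<nu> :: "'a measure" and s0 :: real
  assumes dense: "dense_seq m p" and complete: "mcomplete_of m"
    and sets_nu: "sets \<nu> = sets (borel_of_metric m)" and finite_nu: "finite_measure \<nu>"
begin

sublocale Metric_space "mspace m" "mdist m" by simp

sublocale finite_measure \<nu> by (rule finite_nu)

lemma space_nu: "space \<nu> = mspace m"
  using sets_eq_imp_space_eq[OF sets_nu] by simp

definition idx :: "nat \<Rightarrow> 'a \<Rightarrow> nat"
  where "idx k x = (LEAST j. mdist m (p j) x < (1/2)^k)"

text \<open>Words are read from right to left: the head of a word is its most recent letter.\<close>

primrec cyl :: "nat list \<Rightarrow> 'a set" where
  "cyl [] = mspace m"
| "cyl (j # w) = {x \<in> cyl w. idx (length w) x = j}"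

primrec start :: "nat list \<Rightarrow> real" where
  "start [] = s0"
| "start (j # w) = start w + (\<Sum>i<j. measure \<nu> (cyl (i # w)))"

definition J :: "nat list \<Rightarrow> real set"
  where "J w = {start w ..< start w + measure \<nu> (cyl w)}"

primrec word :: "real \<Rightarrow> nat \<Rightarrow> nat list" where
  "word t 0 = []"
| "word t (Suc k) = (THE j. t \<in> J (j # word t k)) # word t k"

text \<open>The letter of level \<open>k\<close> is the head of the word of length
  \<open>k + 1\<close>. For \<open>t\<close> outside \<open>J []\<close> the description in
  \<open>word\<close> need not determine a letter, and neither \<open>approx\<close> nor
  \<open>point\<close> means anything.\<close>

definition approx :: "real \<Rightarrow> nat \<Rightarrow> 'a"
  where "approx t k = p (hd (word t (Suc k)))"

definition point :: "real \<Rightarrow> 'a"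
  where "point t = (SOME x. limitin mtopology (approx t) x sequentially)"

lemma p_mspace [simp]: "p n \<in> mspace m"
  using dense by (auto simp: dense_seq_def)

lemma idx_dist:
  assumes "x \<in> mspace m"
  shows "mdist m (p (idx k x)) x < (1/2)^k"
proof -
  have "\<exists>n. mdist m (p n) x < (1/2)^k"
    using dense assms by (simp add: dense_seq_def)
  then show ?thesis
    unfolding idx_def by (rule LeastI_ex)
qed

text \<open>Weakened to the constant of \<open>approx_dist_point\<close>, so that
  \<open>limit_in_closed\<close> serves for points of the space as well as for times.\<close>

lemma idx_dist_le: "x \<in> mspace m \<Longrightarrow> mdist m (p (idx k x)) x \<le> 2 * (1/2)^k"
proof -
  assume "x \<in> mspace m"
  moreover have "(0::real) \<le> (1/2)^k" by simp
  ultimately show ?thesis using idx_dist[of x k] by linarith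
qed

lemma cyl_subset: "cyl w \<subseteq> mspace m"
  by (induction w) auto

lemma idx_sets: "{x \<in> mspace m. idx k x = j} \<in> sets \<nu>"
proof -
  have "idx k x = j \<longleftrightarrow> mdist m (p j) x < (1/2)^k \<and> (\<forall>i<j. \<not> mdist m (p i) x < (1/2)^k)"
    if "x \<in> mspace m" for x
  proof
    assume "idx k x = j"
    then show "mdist m (p j) x < (1/2)^k \<and> (\<forall>i<j. \<not> mdist m (p i) x < (1/2)^k)"
      using idx_dist[OF that, of k] not_less_Least unfolding idx_def by blast
  next
    assume "mdist m (p j) x < (1/2)^k \<and> (\<forall>i<j. \<not> mdist m (p i) x < (1/2)^k)"
    then show "idx k x = j"
      unfolding idx_def by (intro Least_equality) (blast, meson leI)
  qed
  then have "{x \<in> mspace m. idx k x = j} =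
      {x \<in> mspace m. mdist m (p j) x < (1/2)^k} - (\<Union>i<j. {x \<in> mspace m. mdist m (p i) x < (1/2)^k})"
    by blast
  also have "\<dots> \<in> sets \<nu>"
    unfolding sets_nu by (intro sets.Diff sets.finite_UN mball_borel_of_metric) auto
  finally show ?thesis .
qed

lemma cyl_sets: "cyl w \<in> sets \<nu>"
proof (induction w)
  case Nil
  show ?case using sets.top[of \<nu>] by (simp add: space_nu)
next
  case (Cons j w)
  have "cyl (j # w) = cyl w \<inter> {x \<in> mspace m. idx (length w) x = j}"
    using cyl_subset by auto
  moreover have "cyl w \<inter> {x \<in> mspace m. idx (length w) x = j} \<in> sets \<nu>"
    using Cons idx_sets by (rule sets.Int)
  ultimately show ?case by (simp only:)
qed

lemma cyl_sums: "(\<lambda>j. measure \<nu> (cyl (j # w))) sums measure \<nu> (cyl w)"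
proof -
  have "(\<lambda>j. measure \<nu> (cyl (j # w))) sums measure \<nu> (\<Union>j. cyl (j # w))"
    by (rule finite_measure_UNION)
      (use cyl_sets in \<open>blast intro: disjointI\<close>, simp add: disjoint_family_on_def disjoint_iff)
  moreover have "(\<Union>j. cyl (j # w)) = cyl w" by (simp add: set_eq_iff)
  ultimately show ?thesis by (simp only:)
qed

lemma J_Cons: "J (j # w) = item (start w) (\<lambda>i. measure \<nu> (cyl (i # w))) j"
  by (simp add: J_def item_def add.assoc)

text \<open>The children of an interval are laid end to end from its left endpoint, and their
  lengths add up to its length by \<open>cyl_sums\<close>.\<close>

lemma UN_J: "(\<Union>j. J (j # w)) = J w"
  unfolding J_Cons by (subst UN_item[OF _ cyl_sums]) (simp_all add: J_def)

lemma disjoint_J: "disjoint_family (\<lambda>j. J (j # w))"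
  unfolding J_Cons by (rule disjoint_family_item) simp

lemma J_ex1: "t \<in> J w \<Longrightarrow> \<exists>!j. t \<in> J (j # w)"
  using UN_J[of w] disjoint_J[of w] unfolding disjoint_family_on_def by blast

lemma J_subset: "J (j # w) \<subseteq> J w"
  using UN_J[of w] by blast

lemma J_subset_Nil: "J w \<subseteq> J []"
  by (induction w) (use J_subset in blast)+

lemma length_word [simp]: "length (word t k) = k"
  by (induction k) auto

lemma in_J_word: "t \<in> J [] \<Longrightarrow> t \<in> J (word t k)"
proof (induction k)
  case (Suc k)
  then show ?case using theI'[OF J_ex1, of t "word t k"] by simp
qed simp

lemma word_unique: "t \<in> J w \<Longrightarrow> word t (length w) = w"
proof (induction w)
  case (Cons j w)
  then have "t \<in> J w" using J_subset by blast
  then show ?case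
    using Cons the1_equality[OF J_ex1, of t w j] by simp
qed simp

text \<open>A half-open interval with an element has positive length, so the corresponding cylinder
  has positive mass. This supplies a point of the space that is compatible with all letters read
  from \<open>t\<close> so far.\<close>

lemma cyl_word_nonempty:
  assumes "t \<in> J []"
  obtains x where "x \<in> cyl (word t k)"
proof -
  have "0 < measure \<nu> (cyl (word t k))"
    using in_J_word[OF assms, of k] by (auto simp: J_def)
  then have "cyl (word t k) \<noteq> {}" by auto
  then show thesis using that by blast
qed

lemma approx_dist_cyl:
  assumes "x \<in> cyl (word t n)" "k < n"
  shows "mdist m (approx t k) x < (1/2)^k"
  using assms
proof (induction n)
  case (Suc n)
  then have x: "x \<in> cyl (word t n)" "idx n x = hd (word t (Suc n))" by auto
  show ?case
  proof (cases "k = n")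
    case True
    then show ?thesis
      using x idx_dist[of x n] cyl_subset unfolding approx_def by (metis subsetD)
  qed (use Suc x in simp)
qed simp

lemma approx_mspace [simp]: "approx t k \<in> mspace m"
  by (simp add: approx_def)

text \<open>A point in the cylinder of the longer word is close to both approximations, within
  \<open>(1/2)^k\<close> and \<open>(1/2)^l\<close>.\<close>

lemma approx_dist:
  assumes "t \<in> J []" "k \<le> l"
  shows "mdist m (approx t k) (approx t l) < 2 * (1/2)^k"
proof -
  obtain x where x: "x \<in> cyl (word t (Suc l))"
    using cyl_word_nonempty[OF assms(1)] .
  then have "x \<in> mspace m" using cyl_subset by blast
  then have "mdist m (approx t k) (approx t l) \<le> mdist m (approx t k) x + mdist m (approx t l) x"
    using triangle[of "approx t k" x "approx t l"] commute by simp
  also have "\<dots> < (1/2)^k + (1/2)^l"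
    using approx_dist_cyl[OF x] assms(2) by (simp add: add_strict_mono)
  also have "(1/2)^l \<le> (1/2::real)^k"
    using assms(2) by (simp add: power_decreasing)
  finally show ?thesis by simp
qed

section \<open>The limit map and its points of continuity\<close>

lemma limitin_point:
  assumes "t \<in> J []"
  shows "limitin mtopology (approx t) (point t) sequentially"
proof -
  have "MCauchy (approx t)"
    unfolding MCauchy_def
  proof (intro conjI allI impI)
    fix e :: real assume "0 < e"
    then obtain k where k: "(1/2)^k < e / 2"
      using real_arch_pow_inv[of "e/2" "1/2"] by auto
    have "mdist m (approx t n) (approx t n') < e" if "k \<le> n" "k \<le> n'" for n n'
    proof -
      have *: "mdist m (approx t i) (approx t i') < e" if "k \<le> i" "i \<le> i'" for i i'
      proof -
        have "(1/2)^i \<le> (1/2::real)^k"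
          using that by (simp add: power_decreasing)
        then show ?thesis
          using approx_dist[OF assms that(2)] k by linarith
      qed
      show ?thesis
      proof (cases "n \<le> n'")
        case False
        then show ?thesis
          using *[OF that(2), of n] commute[of "approx t n" "approx t n'"] by linarith
      qed (use * that in blast)
    qed
    then show "\<exists>N. \<forall>n n'. N \<le> n \<longrightarrow> N \<le> n' \<longrightarrow> mdist m (approx t n) (approx t n') < e" by blast
  qed auto
  then have "\<exists>x. limitin mtopology (approx t) x sequentially"
    using complete unfolding mcomplete_of_def mcomplete_def by blast
  then show ?thesis unfolding point_def by (rule someI_ex)
qed

lemma point_mspace: "t \<in> J [] \<Longrightarrow> point t \<in> mspace m"
  using limitin_point limitin_mspace by blast

lemma approx_dist_point:
  assumes "t \<in> J []"
  shows "mdist m (approx t k) (point t) \<le> 2 * (1/2)^k"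
proof (rule field_le_epsilon)
  fix e :: real assume "0 < e"
  then have "\<forall>\<^sub>F n in sequentially. approx t n \<in> mspace m \<and> mdist m (approx t n) (point t) < e"
    using limitin_point[OF assms] by (simp add: limitin_metric)
  then have "\<forall>\<^sub>F n in sequentially. k \<le> n \<and> mdist m (approx t n) (point t) < e"
    using eventually_ge_at_top[of k] by eventually_elim simp
  then obtain n where n: "k \<le> n" "mdist m (approx t n) (point t) < e"
    using eventually_happens'[OF sequentially_bot] by blast
  have "mdist m (approx t k) (point t) \<le> mdist m (approx t k) (approx t n) + mdist m (approx t n) (point t)"
    using point_mspace[OF assms] by (intro triangle) auto
  then show "mdist m (approx t k) (point t) \<le> 2 * (1/2)^k + e"
    using n approx_dist[OF assms n(1)] by simp
qed

text \<open>A time that is no left endpoint is interior to its interval at every level. All times in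
  the interval of level \<open>k + 1\<close> share their first \<open>k + 1\<close> letters, hence
  \<open>approx\<close> at \<open>k\<close>, and each image is within \<open>2 * (1/2)^k\<close> of
  it; this explains \<open>e / 4\<close>.\<close>

lemma point_continuous:
  assumes t: "t \<in> J []" "\<And>w. t \<noteq> start w" and "0 < e"
  shows "\<exists>\<eta>>0. \<forall>s. \<bar>s - t\<bar> < \<eta> \<longrightarrow> mdist m (point s) (point t) < e"
proof -
  obtain k where k: "(1/2)^k < e / 4"
    using real_arch_pow_inv[of "e/4" "1/2"] \<open>0 < e\<close> by auto
  define w where "w = word t (Suc k)"
  \<comment> \<open>The distance from \<open>t\<close> to the nearer endpoint of \<open>J w\<close>;
    only the left endpoint could make it vanish, since \<open>J w\<close> is open on the
    right.\<close>
  define \<eta> where "\<eta> = min (t - start w) (start w + measure \<nu> (cyl w) - t)"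
  have "t \<in> J w" unfolding w_def by (rule in_J_word[OF t(1)])
  then have "0 < \<eta>" using t(2)[of w] by (auto simp: \<eta>_def J_def less_le)
  moreover have "mdist m (point s) (point t) < e" if "\<bar>s - t\<bar> < \<eta>" for s
  proof -
    have sw: "s \<in> J w" using that by (auto simp: \<eta>_def J_def)
    then have s: "s \<in> J []" using J_subset_Nil by blast
    have "length w = Suc k" unfolding w_def by (rule length_word)
    then have "word s (Suc k) = w"
      using word_unique[OF sw] by metis
    then have "approx s k = approx t k" by (metis approx_def w_def)
    then have "mdist m (approx t k) (point s) \<le> 2 * (1/2)^k"
      using approx_dist_point[OF s, of k] by simp
    moreover have "mdist m (point s) (point t) \<le> mdist m (point s) (approx t k) + mdist m (approx t k) (point t)"
      by (rule triangle[OF point_mspace[OF s] approx_mspace point_mspace[OF t(1)]])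
    moreover have "mdist m (point s) (approx t k) = mdist m (approx t k) (point s)"
      by (rule commute)
    ultimately have "mdist m (point s) (point t) \<le> 4 * (1/2)^k"
      using approx_dist_point[OF t(1), of k] by linarith
    then show ?thesis using k by simp
  qed
  ultimately show ?thesis by blast
qed

section \<open>The law of the limit map\<close>

lemma emeasure_UN_J:
  assumes "\<And>w. w \<in> G \<Longrightarrow> length w = k"
  shows "emeasure lborel (\<Union>w\<in>G. J w) = emeasure \<nu> (\<Union>w\<in>G. cyl w)"
proof -
  \<comment> \<open>Equal length matters: the intervals of a word and of its extension are nested,
    not disjoint.\<close>
  have dJ: "disjoint_family_on J G"
    unfolding disjoint_family_on_def using assms word_unique by (metis disjoint_iff)
  have dc: "w = w'" if "x \<in> cyl w" "x \<in> cyl w'" "length w = length w'" for w w' x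
    using that
  proof (induction w arbitrary: w')
    case (Cons j w)
    then show ?case by (cases w') auto
  qed simp
  have dC: "disjoint_family_on cyl G"
    unfolding disjoint_family_on_def using assms dc by (metis disjoint_iff)
  have eq: "emeasure lborel (J w) = emeasure \<nu> (cyl w)" for w
    by (simp add: J_def emeasure_eq_measure)
  have "emeasure lborel (\<Union>w\<in>G. J w) = (\<integral>\<^sup>+w. emeasure lborel (J w) \<partial>count_space G)"
    by (rule emeasure_UN_countable) (auto simp: dJ, simp add: J_def)
  also have "\<dots> = (\<integral>\<^sup>+w. emeasure \<nu> (cyl w) \<partial>count_space G)"
    by (simp add: eq)
  also have "\<dots> = emeasure \<nu> (\<Union>w\<in>G. cyl w)"
    by (rule emeasure_UN_countable[symmetric]) (auto simp: dC cyl_sets)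
  finally show ?thesis .
qed

text \<open>
  The words all of whose letters name a point of the dense sequence near the closed set \<open>C\<close>: their
  intervals decrease to the preimage of \<open>C\<close> under \<^const>\<open>point\<close>, and their cylinders decrease to \<open>C\<close>.
\<close>

primrec near :: "'a set \<Rightarrow> nat list \<Rightarrow> bool" where
  "near C [] = True"
| "near C (j # w) \<longleftrightarrow> near C w \<and> (\<exists>c\<in>C. mdist m (p j) c \<le> 2 * (1/2)^length w)"

lemma near_word: "near C (word t n) \<longleftrightarrow> (\<forall>k<n. \<exists>c\<in>C. mdist m (approx t k) c \<le> 2 * (1/2)^k)"
  by (induction n) (auto simp: approx_def less_Suc_eq)

text \<open>The address of a point of the space, as \<open>word\<close> is the address of a
  time.\<close>

primrec iword :: "'a \<Rightarrow> nat \<Rightarrow> nat list" where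
  "iword x 0 = []"
| "iword x (Suc k) = idx k x # iword x k"

lemma length_iword [simp]: "length (iword x k) = k"
  by (induction k) auto

lemma in_cyl_iword: "x \<in> mspace m \<Longrightarrow> x \<in> cyl (iword x k)"
  by (induction k) auto

lemma iword_unique: "x \<in> cyl w \<Longrightarrow> iword x (length w) = w"
  by (induction w) auto

lemma near_iword: "near C (iword x n) \<longleftrightarrow> (\<forall>k<n. \<exists>c\<in>C. mdist m (p (idx k x)) c \<le> 2 * (1/2)^k)"
  by (induction n) (auto simp: less_Suc_eq)

lemma limit_in_closed:
  assumes C: "closedin mtopology C" and x: "x \<in> mspace m"
    and y: "\<And>k. y k \<in> mspace m" "\<And>k. mdist m (y k) x \<le> 2 * (1/2)^k"
    and c: "\<And>k. \<exists>c\<in>C. mdist m (y k) c \<le> 2 * (1/2)^k"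
  shows "x \<in> C"
proof -
  have "x \<in> mtopology closure_of C"
    unfolding metric_closure_of
  proof (intro CollectI conjI allI impI x)
    fix r :: real assume "0 < r"
    then obtain k where k: "(1/2)^k < r / 4"
      using real_arch_pow_inv[of "r/4" "1/2"] by auto
    obtain c where c: "c \<in> C" "mdist m (y k) c \<le> 2 * (1/2)^k" using c by blast
    have cM: "c \<in> mspace m" using c C closedin_subset by fastforce
    have "mdist m x c \<le> mdist m x (y k) + mdist m (y k) c"
      by (rule triangle[OF x y(1) cM])
    then have "mdist m x c < r"
      using c y(2)[of k] commute[of x "y k"] k by linarith
    then have "c \<in> mball x r" using x cM by simp
    then show "\<exists>c\<in>C. c \<in> mball x r" using c by blast
  qed
  then show ?thesis using C closure_of_closedin by blast
qed

lemma vimage_point: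
  assumes C: "closedin mtopology C"
  shows "{t \<in> J []. point t \<in> C} = (\<Inter>n. \<Union>w\<in>{w. length w = n \<and> near C w}. J w)"
proof (intro equalityI subsetI)
  fix t assume t: "t \<in> {t \<in> J []. point t \<in> C}"
  have "near C (word t n)" for n
    unfolding near_word using t approx_dist_point by blast
  moreover have "t \<in> J (word t n)" for n
    using t in_J_word by blast
  ultimately show "t \<in> (\<Inter>n. \<Union>w\<in>{w. length w = n \<and> near C w}. J w)"
    using length_word by blast
next
  fix t assume t: "t \<in> (\<Inter>n. \<Union>w\<in>{w. length w = n \<and> near C w}. J w)"
  have t0: "t \<in> J []" using t J_subset_Nil by blast
  have "near C (word t n)" for n
  proof -
    obtain w where "length w = n" "near C w" "t \<in> J w" using t by blast
    then show ?thesis using word_unique by metis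
  qed
  then have "\<exists>c\<in>C. mdist m (approx t k) c \<le> 2 * (1/2)^k" for k
    using near_word[of C t "Suc k"] lessI by blast
  then have "point t \<in> C"
    by (rule limit_in_closed[OF C point_mspace[OF t0] approx_mspace approx_dist_point[OF t0]])
  then show "t \<in> {t \<in> J []. point t \<in> C}" using t0 by simp
qed

lemma closed_eq_Inter_cyl:
  assumes C: "closedin mtopology C"
  shows "C = (\<Inter>n. \<Union>w\<in>{w. length w = n \<and> near C w}. cyl w)"
proof (intro equalityI subsetI)
  fix x assume x: "x \<in> C"
  then have x': "x \<in> mspace m" using C closedin_subset by fastforce
  have "mdist m (p (idx k x)) x \<le> 2 * (1/2)^k" for k
    by (rule idx_dist_le[OF x'])
  then have "near C (iword x n)" for n
    unfolding near_iword using x by blast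
  then have "iword x n \<in> {w. length w = n \<and> near C w}" for n
    by simp
  then show "x \<in> (\<Inter>n. \<Union>w\<in>{w. length w = n \<and> near C w}. cyl w)"
    using in_cyl_iword[OF x'] by blast
next
  fix x assume x: "x \<in> (\<Inter>n. \<Union>w\<in>{w. length w = n \<and> near C w}. cyl w)"
  have x': "x \<in> mspace m" using x cyl_subset by blast
  have "near C (iword x n)" for n
  proof -
    obtain w where "length w = n" "near C w" "x \<in> cyl w" using x by blast
    then show ?thesis using iword_unique by metis
  qed
  then have near: "\<exists>c\<in>C. mdist m (p (idx k x)) c \<le> 2 * (1/2)^k" for k
    using near_iword[of C x "Suc k"] lessI by blast
  have "mdist m (p (idx k x)) x \<le> 2 * (1/2)^k" for k
    by (rule idx_dist_le[OF x'])
  then show "x \<in> C"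
    by (rule limit_in_closed[OF C x' p_mspace _ near])
qed

lemma UN_J_borel: "(\<Union>w\<in>G. J w) \<in> sets borel"
  by (intro sets.countable_UN') (auto simp: J_def)

lemma vimage_point_closed_sets:
  assumes "closedin mtopology C"
  shows "{t \<in> J []. point t \<in> C} \<in> sets borel"
  unfolding vimage_point[OF assms] by (intro sets.countable_INT'' UN_J_borel) auto

text \<open>At every level the near words have intervals and cylinders of the same total measure.
  Both unions decrease, so continuity from above carries the equality to the preimage of
  \<open>C\<close> and to \<open>C\<close>.\<close>

lemma emeasure_vimage_point:
  assumes C: "closedin mtopology C"
  shows "emeasure lborel {t \<in> J []. point t \<in> C} = emeasure \<nu> C"
proof -
  define G where "G n = {w. length w = n \<and> near C w}" for n
  have G_Suc: "\<exists>j w. v = j # w \<and> w \<in> G n" if "v \<in> G (Suc n)" for v n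
    using that by (cases v) (auto simp: G_def)
  have "(\<Union>w\<in>G (Suc n). J w) \<subseteq> (\<Union>w\<in>G n. J w)" for n
    using G_Suc[of _ n] J_subset by blast
  moreover have "(\<Union>w\<in>G (Suc n). cyl w) \<subseteq> (\<Union>w\<in>G n. cyl w)" for n
  proof -
    have "cyl v \<subseteq> (\<Union>w\<in>G n. cyl w)" if v: "v \<in> G (Suc n)" for v
    proof -
      obtain j w where "v = j # w" "w \<in> G n" using G_Suc[OF v] by blast
      then show ?thesis by auto
    qed
    then show ?thesis by (rule UN_least)
  qed
  ultimately have dec: "decseq (\<lambda>n. \<Union>w\<in>G n. J w)" "decseq (\<lambda>n. \<Union>w\<in>G n. cyl w)"
    by (simp_all add: decseq_Suc_iff)
  have J_sub: "(\<Union>w\<in>G n. J w) \<subseteq> J []" for n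
    by (rule UN_least) (rule J_subset_Nil)
  \<comment> \<open>Continuity from above requires finite measure, and Lebesgue measure on the whole
    line is infinite.\<close>
  have "emeasure lborel (\<Union>w\<in>G n. J w) \<le> emeasure lborel (J [])" for n
    by (rule emeasure_mono[OF J_sub]) (simp add: J_def)
  moreover have "emeasure lborel (J []) < \<infinity>"
    by (simp add: J_def)
  ultimately have fin: "emeasure lborel (\<Union>w\<in>G n. J w) \<noteq> \<infinity>" for n
    by (metis leD)
  have "(\<lambda>n. emeasure lborel (\<Union>w\<in>G n. J w)) \<longlonglongrightarrow> emeasure lborel (\<Inter>n. \<Union>w\<in>G n. J w)"
    by (rule Lim_emeasure_decseq) (use UN_J_borel dec fin in auto)
  moreover have "(\<lambda>n. emeasure \<nu> (\<Union>w\<in>G n. cyl w)) \<longlonglongrightarrow> emeasure \<nu> (\<Inter>n. \<Union>w\<in>G n. cyl w)"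
    by (rule Lim_emeasure_decseq) (use dec cyl_sets in auto)
  moreover have "emeasure lborel (\<Union>w\<in>G n. J w) = emeasure \<nu> (\<Union>w\<in>G n. cyl w)" for n
    by (rule emeasure_UN_J) (simp add: G_def)
  ultimately have "emeasure lborel (\<Inter>n. \<Union>w\<in>G n. J w) = emeasure \<nu> (\<Inter>n. \<Union>w\<in>G n. cyl w)"
    by (simp add: LIMSEQ_unique)
  then show ?thesis
    using vimage_point[OF C] closed_eq_Inter_cyl[OF C] by (simp add: G_def)
qed

lemma measurable_point: "point \<in> restrict_space lborel (J []) \<rightarrow>\<^sub>M \<nu>"
proof -
  have sets_eq: "sets \<nu> = sigma_sets (mspace m) {C. closedin mtopology C}"
    unfolding sets_nu sets_borel_of_metric_closedin mtopology_of_def ..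
  show ?thesis
  proof (rule measurable_sigma_sets[OF sets_eq])
    show "{C. closedin mtopology C} \<subseteq> Pow (mspace m)"
      using closedin_subset by fastforce
    show "point \<in> space (restrict_space lborel (J [])) \<rightarrow> mspace m"
      using point_mspace by (auto simp: space_restrict_space)
    fix C assume "C \<in> {C. closedin mtopology C}"
    then have "{t \<in> J []. point t \<in> C} \<in> sets borel"
      using vimage_point_closed_sets by simp
    moreover have "point -` C \<inter> space (restrict_space lborel (J [])) = {t \<in> J []. point t \<in> C}"
      by (auto simp: space_restrict_space)
    ultimately show "point -` C \<inter> space (restrict_space lborel (J [])) \<in> sets (restrict_space lborel (J []))"
      by (auto simp: sets_restrict_space_iff J_def)
  qed
qed

text \<open>Closed sets form an intersection-stable generator containing the whole space, so
  agreement on them is enough.\<close>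

lemma distr_point: "distr (restrict_space lborel (J [])) \<nu> point = \<nu>"
proof (rule measure_eqI_generator_eq[where E = "{C. closedin mtopology C}" and A = "\<lambda>_. mspace m" and \<Omega> = "mspace m"])
  show "Int_stable {C. closedin mtopology C}"
    by (auto simp: Int_stable_def)
  show "{C. closedin mtopology C} \<subseteq> Pow (mspace m)"
    using closedin_subset by fastforce
  have sets_eq: "sets \<nu> = sigma_sets (mspace m) {C. closedin mtopology C}"
    unfolding sets_nu sets_borel_of_metric_closedin mtopology_of_def ..
  then show "sets \<nu> = sigma_sets (mspace m) {C. closedin mtopology C}"
    "sets (distr (restrict_space lborel (J [])) \<nu> point) = sigma_sets (mspace m) {C. closedin mtopology C}"
    by auto
  have eq: "emeasure (distr (restrict_space lborel (J [])) \<nu> point) C = emeasure \<nu> C"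
    if C: "closedin mtopology C" for C
  proof -
    have "C \<in> sets \<nu>" using C sets_eq by auto
    then have "emeasure (distr (restrict_space lborel (J [])) \<nu> point) C =
        emeasure (restrict_space lborel (J [])) {t \<in> J []. point t \<in> C}"
      by (subst emeasure_distr[OF measurable_point])
        (auto simp: space_restrict_space intro!: arg_cong2[where f=emeasure])
    also have "\<dots> = emeasure lborel {t \<in> J []. point t \<in> C}"
      by (rule emeasure_restrict_space) (auto simp: J_def)
    finally show ?thesis using emeasure_vimage_point[OF C] by simp
  qed
  then show "\<And>C. C \<in> {C. closedin mtopology C} \<Longrightarrow>
      emeasure (distr (restrict_space lborel (J [])) \<nu> point) C = emeasure \<nu> C"
    by simp
  show "range (\<lambda>_. mspace m) \<subseteq> {C. closedin mtopology C}" by auto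
  show "emeasure (distr (restrict_space lborel (J [])) \<nu> point) (mspace m) \<noteq> \<infinity>"
    using eq[of "mspace m"] by simp
qed simp

end

section \<open>Parameters\<close>

lemma space_unit_interval [simp]: "space unit_interval_measure = {0..1}"
  by (simp add: space_restrict_space)

lemma sets_unit_interval_iff: "A \<in> sets unit_interval_measure \<longleftrightarrow> A \<subseteq> {0..1} \<and> A \<in> sets borel"
  by (auto simp: sets_restrict_space_iff)

lemma emeasure_unit_interval: "A \<subseteq> {0..1} \<Longrightarrow> emeasure unit_interval_measure A = emeasure lborel A"
  by (rule emeasure_restrict_space) auto

lemma measure_unit_interval: "A \<subseteq> {0..1} \<Longrightarrow> measure unit_interval_measure A = measure lborel A"
  by (simp add: emeasure_unit_interval measure_def)

lemma prob_space_unit_interval: "prob_space unit_interval_measure"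
  by standard (simp add: emeasure_unit_interval)

interpretation unit_interval: prob_space unit_interval_measure
  by (rule prob_space_unit_interval)

section \<open>Elements of \<open>V\<close> as partitions of an initial interval\<close>

lemma V_D:
  assumes "\<alpha> \<in> V"
  shows "0 \<le> \<alpha> i" "summable \<alpha>" "suminf \<alpha> \<le> 1" "\<alpha> (Suc i) \<le> \<alpha> i"
  using assms by (auto simp: V_def)

lemma V_antimono:
  assumes "\<alpha> \<in> V" "i \<le> j"
  shows "\<alpha> j \<le> \<alpha> i"
  using lift_Suc_antimono_le[of \<alpha> i j] V_D(4)[OF assms(1)] assms(2) by blast

lemma V_sum_le:
  assumes "\<alpha> \<in> V"
  shows "(\<Sum>i<n. \<alpha> i) \<le> suminf \<alpha>" "(\<Sum>i<n. \<alpha> i) \<le> 1" "0 \<le> (\<Sum>i<n. \<alpha> i)" "0 \<le> suminf \<alpha>"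
proof -
  show "(\<Sum>i<n. \<alpha> i) \<le> suminf \<alpha>"
    by (rule sum_le_suminf) (use V_D[OF assms] in auto)
  then show "(\<Sum>i<n. \<alpha> i) \<le> 1"
    using V_D(3)[OF assms] by linarith
  show "0 \<le> (\<Sum>i<n. \<alpha> i)" "0 \<le> suminf \<alpha>"
    using V_D(1,2)[OF assms] by (simp_all add: sum_nonneg suminf_nonneg)
qed

lemma UN_item_V:
  assumes "\<alpha> \<in> V"
  shows "(\<Union>i. item 0 \<alpha> i) = {0..<suminf \<alpha>}"
proof -
  have "\<alpha> sums suminf \<alpha>" by (rule summable_sums[OF V_D(2)[OF assms]])
  then show ?thesis
    using UN_item[of \<alpha> "suminf \<alpha>" 0] V_D(1)[OF assms] by simp
qed

lemma item_V_unique: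
  assumes "\<alpha> \<in> V" "t \<in> item 0 \<alpha> i" "t \<in> item 0 \<alpha> j"
  shows "i = j"
  using disjoint_family_item[of \<alpha> 0] V_D(1)[OF assms(1)] assms(2,3)
  unfolding disjoint_family_on_def by blast

lemma item_V_subset:
  assumes "\<alpha> \<in> V"
  shows "item 0 \<alpha> i \<subseteq> {0..<suminf \<alpha>}" "item 0 \<alpha> i \<subseteq> {0..1}"
proof -
  have "item 0 \<alpha> i \<subseteq> (\<Union>i. item 0 \<alpha> i)" by blast
  then show "item 0 \<alpha> i \<subseteq> {0..<suminf \<alpha>}"
    by (simp only: UN_item_V[OF assms])
  also have "\<dots> \<subseteq> {0..1}" using V_D(3)[OF assms] by auto
  finally show "item 0 \<alpha> i \<subseteq> {0..1}" .
qed

text \<open>Nonnegativity of the difference measure, stated as an inequality between measures.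
  Several indices may share a position, and then their masses add up there.\<close>

definition has_atoms :: "'a measure \<Rightarrow> (nat \<Rightarrow> real) \<Rightarrow> (nat \<Rightarrow> 'a) \<Rightarrow> bool"
  where "has_atoms \<mu> \<alpha> f \<longleftrightarrow>
    (\<forall>A\<in>sets \<mu>. (\<Sum>i. ennreal (\<alpha> i) * indicator A (f i)) \<le> emeasure \<mu> A)"

text \<open>Removing the prescribed atoms from \<mu> leaves a measure of mass
  \<open>1 - suminf \<alpha>\<close>. The atoms are produced by constant pieces on the items, which
  fill \<open>[0, suminf \<alpha>)\<close>, and the remainder by nested intervals on
  \<open>[suminf \<alpha>, 1)\<close>. The remainder may itself contain atoms.\<close>

lemma item_parameter:
  fixes m :: "'a metric"
  assumes m: "mcomplete_of m" "separable_space (mtopology_of m)"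
    and \<mu>: "sets \<mu> = sets (borel_of_metric m)" "prob_space \<mu>"
    and \<alpha>: "\<alpha> \<in> V" and f: "\<And>i. f i \<in> mspace m" and atoms: "has_atoms \<mu> \<alpha> f"
  obtains a N where "a \<in> unit_interval_measure \<rightarrow>\<^sub>M \<mu>" "distr unit_interval_measure \<mu> a = \<mu>"
    "\<And>i t. t \<in> item 0 \<alpha> i \<Longrightarrow> a t = f i" "countable N"
    "\<And>t e. t \<in> {0..1} - N \<Longrightarrow> suminf \<alpha> < t \<Longrightarrow> 0 < e \<Longrightarrow>
      \<exists>\<eta>>0. \<forall>s\<in>{0..1}. \<bar>s - t\<bar> < \<eta> \<longrightarrow> mdist m (a s) (a t) < e"
proof -
  interpret \<mu>: prob_space \<mu> by fact
  have space_\<mu>: "space \<mu> = mspace m"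
    using sets_eq_imp_space_eq[OF \<mu>(1)] by simp
  define T where "T = suminf \<alpha>"
  have T: "0 \<le> T" "T \<le> 1"
    using V_sum_le(4)[OF \<alpha>] V_D(3)[OF \<alpha>] by (auto simp: T_def)
  \<comment> \<open>The measure formed by the atoms, as the image under \<open>f\<close> of the
    weights \<alpha> on the naturals; as a measure it can be subtracted from \<mu>.\<close>
  define \<kappa> where "\<kappa> = distr (density (count_space UNIV) (\<lambda>i. ennreal (\<alpha> i))) \<mu> f"
  have fm: "f \<in> density (count_space UNIV) (\<lambda>i. ennreal (\<alpha> i)) \<rightarrow>\<^sub>M \<mu>"
    using f by (simp add: space_\<mu>)
  have \<kappa>: "emeasure \<kappa> A = (\<Sum>i. ennreal (\<alpha> i) * indicator A (f i))" if "A \<in> sets \<mu>" for A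
  proof -
    have "emeasure \<kappa> A = emeasure (density (count_space UNIV) (\<lambda>i. ennreal (\<alpha> i))) (f -` A)"
      unfolding \<kappa>_def by (subst emeasure_distr[OF fm that]) simp
    also have "\<dots> = (\<integral>\<^sup>+i. ennreal (\<alpha> i) * indicator (f -` A) i \<partial>count_space UNIV)"
      by (rule emeasure_density) auto
    also have "\<dots> = (\<Sum>i. ennreal (\<alpha> i) * indicator A (f i))"
      by (simp add: nn_integral_count_space_nat indicator_def)
    finally show ?thesis .
  qed
  have \<kappa>_le: "emeasure \<kappa> A \<le> emeasure \<mu> A" if "A \<in> sets \<mu>" for A
    using atoms that \<kappa>[OF that] by (simp add: has_atoms_def)
  have sets_\<kappa>: "sets \<kappa> = sets \<mu>" by (simp add: \<kappa>_def)
  have fin_\<kappa>: "finite_measure \<kappa>"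
  proof
    have "emeasure \<kappa> (space \<mu>) \<le> emeasure \<mu> (space \<mu>)"
      by (rule \<kappa>_le) simp
    then have "emeasure \<kappa> (space \<mu>) \<le> 1"
      by (simp add: \<mu>.emeasure_space_1)
    then show "emeasure \<kappa> (space \<kappa>) \<noteq> \<infinity>"
      by (auto simp: \<kappa>_def top_unique)
  qed
  define \<nu> where "\<nu> = diff_measure \<mu> \<kappa>"
  have \<nu>: "emeasure \<nu> A = emeasure \<mu> A - emeasure \<kappa> A" if "A \<in> sets \<mu>" for A
    unfolding \<nu>_def
    by (rule emeasure_diff_measure) (use that sets_\<kappa> fin_\<kappa> \<mu>.finite_measure_axioms \<kappa>_le in auto)
  have sets_\<nu>: "sets \<nu> = sets (borel_of_metric m)" and space_\<nu>: "space \<nu> = mspace m"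
    by (simp_all add: \<nu>_def \<mu>(1) space_\<mu>)
  have "emeasure \<kappa> (mspace m) = ennreal T"
  proof -
    have "emeasure \<kappa> (mspace m) = (\<Sum>i. ennreal (\<alpha> i))"
      using \<kappa>[of "mspace m"] f space_\<mu> sets.top[of \<mu>] by simp
    also have "\<dots> = ennreal T"
      unfolding T_def by (rule suminf_ennreal2) (use V_D[OF \<alpha>] in auto)
    finally show ?thesis .
  qed
  then have tot: "emeasure \<nu> (mspace m) = ennreal (1 - T)"
    using \<nu>[of "mspace m"] \<mu>.emeasure_space_1 space_\<mu> sets.top[of \<mu>] ennreal_minus[OF T(1), of 1]
    by simp
  have fin_\<nu>: "finite_measure \<nu>"
    by standard (simp add: space_\<nu> tot)
  obtain x0 where x0: "x0 \<in> mspace m" using f by blast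
  then obtain p where p: "dense_seq m p"
    using separable_imp_dense_seq[OF m(2)] by blast
  interpret nested_intervals m p \<nu> T
    by (rule nested_intervals.intro[OF p m(1) sets_\<nu> fin_\<nu>])
  have J: "J [] = {T..<1}"
    using T tot by (simp add: J_def measure_def)
  have item_T: "(\<Union>i. item 0 \<alpha> i) = {0..<T}"
    using UN_item_V[OF \<alpha>] by (simp add: T_def)
  \<comment> \<open>The endpoint 1 belongs to none of the half-open intervals and gets an arbitrary
    value, which does not affect the law.\<close>
  define a where "a t = (if t < T then f (THE i. t \<in> item 0 \<alpha> i) else if t < 1 then point t else x0)" for t
  have a_item: "a t = f i" if "t \<in> item 0 \<alpha> i" for i t
  proof -
    have "t < T" using that item_T by fastforce
    moreover have "(THE i. t \<in> item 0 \<alpha> i) = i"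
      using that item_V_unique[OF \<alpha>] by blast
    ultimately show ?thesis by (simp add: a_def)
  qed
  have a_point: "a t = point t" if "t \<in> J []" for t
    using that by (auto simp: a_def J)
  have a_one: "a 1 = x0" using T by (simp add: a_def)
  have unit_split: "{0..1} = (\<Union>i. item 0 \<alpha> i) \<union> J [] \<union> {1}"
    unfolding item_T J using T by auto
  have a_space: "a \<in> {0..1} \<rightarrow> mspace m"
  proof
    fix t :: real assume "t \<in> {0..1}"
    then consider i where "t \<in> item 0 \<alpha> i" | "t \<in> J []" | "t = 1"
      unfolding unit_split by blast
    then show "a t \<in> mspace m"
      by cases (use a_item f a_point point_mspace a_one x0 in auto)
  qed
  define B where "B A i = (if f i \<in> A then item 0 \<alpha> i else {})" for A i
  have vim: "a -` A \<inter> {0..1} = (\<Union>i. B A i) \<union> {t \<in> J []. point t \<in> A} \<union> (if x0 \<in> A then {1} else {})" for A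
  proof (intro set_eqI iffI)
    fix t assume t: "t \<in> a -` A \<inter> {0..1}"
    then consider i where "t \<in> item 0 \<alpha> i" | "t \<in> J []" | "t = 1"
      unfolding unit_split by blast
    then show "t \<in> (\<Union>i. B A i) \<union> {t \<in> J []. point t \<in> A} \<union> (if x0 \<in> A then {1} else {})"
    proof cases
      case 1
      then have "t \<in> B A i" using a_item t by (simp add: B_def)
      then show ?thesis by blast
    next
      case 2
      then show ?thesis using a_point t by simp
    next
      case 3
      then show ?thesis using a_one t by simp
    qed
  next
    fix t assume t: "t \<in> (\<Union>i. B A i) \<union> {t \<in> J []. point t \<in> A} \<union> (if x0 \<in> A then {1} else {})"
    then consider i where "t \<in> item 0 \<alpha> i" "f i \<in> A" | "t \<in> J []" "point t \<in> A" | "t = 1" "x0 \<in> A"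
      by (auto simp: B_def split: if_splits)
    then have "a t \<in> A"
      by cases (use a_item a_point a_one in auto)
    moreover have "t \<in> {0..1}"
      using t unfolding unit_split by (auto simp: B_def split: if_splits)
    ultimately show "t \<in> a -` A \<inter> {0..1}" by blast
  qed
  have point_sets: "{t \<in> J []. point t \<in> A} \<in> sets borel"
    and point_law: "emeasure lborel {t \<in> J []. point t \<in> A} = emeasure \<nu> A" if "A \<in> sets \<mu>" for A
  proof -
    have A: "A \<in> sets \<nu>" using that by (simp add: \<nu>_def)
    have eq: "point -` A \<inter> space (restrict_space lborel (J [])) = {t \<in> J []. point t \<in> A}"
      by (auto simp: space_restrict_space)
    have "{t \<in> J []. point t \<in> A} \<in> sets (restrict_space lborel (J []))"
      using measurable_sets[OF measurable_point A] eq by simp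
    then show "{t \<in> J []. point t \<in> A} \<in> sets borel"
      by (subst (asm) sets_restrict_space_iff) (auto simp: J)
    have "emeasure \<nu> A = emeasure (restrict_space lborel (J [])) {t \<in> J []. point t \<in> A}"
      using emeasure_distr[OF measurable_point A] by (simp only: distr_point eq)
    also have "\<dots> = emeasure lborel {t \<in> J []. point t \<in> A}"
      by (rule emeasure_restrict_space) (auto simp: J)
    finally show "emeasure lborel {t \<in> J []. point t \<in> A} = emeasure \<nu> A" by simp
  qed
  have B_sets: "range (B A) \<subseteq> sets lborel" for A
    by (auto simp: B_def)
  have B_disj: "disjoint_family (B A)" for A
    using disjoint_family_item[of \<alpha> 0] V_D(1)[OF \<alpha>]
    unfolding disjoint_family_on_def by (auto simp: B_def)
  have B_law: "emeasure lborel (\<Union>i. B A i) = emeasure \<kappa> A" if "A \<in> sets \<mu>" for A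
  proof -
    have "emeasure lborel (\<Union>i. B A i) = (\<Sum>i. emeasure lborel (B A i))"
      by (rule suminf_emeasure[symmetric, OF B_sets B_disj])
    also have "\<dots> = (\<Sum>i. ennreal (\<alpha> i) * indicator A (f i))"
      by (intro suminf_cong) (auto simp: B_def emeasure_item V_D(1)[OF \<alpha>])
    finally show ?thesis using \<kappa>[OF that] by simp
  qed
  have vim_sets: "a -` A \<inter> {0..1} \<in> sets borel" if "A \<in> sets \<mu>" for A
    unfolding vim using point_sets[OF that] B_sets[of A] by (intro sets.Un sets.countable_UN) auto
  have meas: "a \<in> unit_interval_measure \<rightarrow>\<^sub>M \<mu>"
  proof (rule measurableI)
    show "a t \<in> space \<mu>" if "t \<in> space unit_interval_measure" for t
      using that a_space by (auto simp: space_\<mu>)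
    show "a -` A \<inter> space unit_interval_measure \<in> sets unit_interval_measure" if "A \<in> sets \<mu>" for A
      using vim_sets[OF that] unfolding sets_unit_interval_iff space_unit_interval by blast
  qed
  have law: "distr unit_interval_measure \<mu> a = \<mu>"
  proof (rule measure_eqI)
    fix A assume "A \<in> sets (distr unit_interval_measure \<mu> a)"
    then have A: "A \<in> sets \<mu>" by simp
    define P where "P = {t \<in> J []. point t \<in> A}"
    define O1 where "O1 = (if x0 \<in> A then {1::real} else {})"
    define Q where "Q = (\<Union>i. B A i)"
    have sub: "Q \<subseteq> {0..<T}" "P \<subseteq> {T..<1}" "O1 \<subseteq> {1}"
      unfolding item_T[symmetric] by (auto simp: Q_def B_def P_def O1_def J)
    have "Q \<inter> P \<subseteq> {0..<T} \<inter> {T..<1}" "(Q \<union> P) \<inter> O1 \<subseteq> ({0..<T} \<union> {T..<1}) \<inter> {1}"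
      by (intro Int_mono Un_mono sub)+
    moreover have "{0..<T} \<inter> {T..<1} = {}" "({0..<T} \<union> {T..<1}) \<inter> {1} = {}"
      using T by auto
    ultimately have disj: "Q \<inter> P = {}" "(Q \<union> P) \<inter> O1 = {}"
      by simp_all
    have sQ: "Q \<in> sets lborel"
      unfolding Q_def using B_sets[of A] by (intro sets.countable_UN) auto
    have sP: "P \<in> sets lborel" using point_sets[OF A] by (simp add: P_def)
    have sO: "O1 \<in> sets lborel" "emeasure lborel O1 = 0" by (simp_all add: O1_def)
    have "emeasure (distr unit_interval_measure \<mu> a) A = emeasure unit_interval_measure (a -` A \<inter> {0..1})"
      using emeasure_distr[OF meas A] by simp
    also have "\<dots> = emeasure lborel (a -` A \<inter> {0..1})"
      by (rule emeasure_unit_interval) simp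
    also have "a -` A \<inter> {0..1} = Q \<union> P \<union> O1"
      unfolding Q_def P_def O1_def by (rule vim)
    also have "emeasure lborel (Q \<union> P \<union> O1) = emeasure lborel (Q \<union> P) + emeasure lborel O1"
      by (rule plus_emeasure[symmetric]) (use sQ sP sO disj in auto)
    also have "emeasure lborel O1 = 0" by (rule sO)
    also have "emeasure lborel (Q \<union> P) = emeasure lborel Q + emeasure lborel P"
      by (rule plus_emeasure[symmetric]) (use sQ sP disj in auto)
    also have "\<dots> + 0 = emeasure \<kappa> A + (emeasure \<mu> A - emeasure \<kappa> A)"
      by (simp add: B_law[OF A] point_law[OF A] \<nu>[OF A] P_def Q_def)
    also have "\<dots> = emeasure \<mu> A"
      using \<kappa>_le[OF A] by (rule add_diff_inverse_ennreal)
    finally show "emeasure (distr unit_interval_measure \<mu> a) A = emeasure \<mu> A" by simp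
  qed simp
  \<comment> \<open>Left endpoints of nested intervals are not covered by
    \<open>point_continuous\<close>, and at 1 the value was chosen arbitrarily.\<close>
  define N where "N = insert 1 (range start)"
  have cont: "\<exists>\<eta>>0. \<forall>s\<in>{0..1}. \<bar>s - t\<bar> < \<eta> \<longrightarrow> mdist m (a s) (a t) < e"
    if t: "t \<in> {0..1} - N" "suminf \<alpha> < t" and "0 < e" for t e
  proof -
    have t1: "T < t" "t < 1"
      using t by (auto simp: T_def N_def less_le)
    then have tJ: "t \<in> J []" by (simp add: J)
    have "t \<noteq> start w" for w using t by (auto simp: N_def)
    then obtain \<eta> where \<eta>: "\<eta> > 0" "\<And>s. \<bar>s - t\<bar> < \<eta> \<Longrightarrow> mdist m (point s) (point t) < e"
      using point_continuous[OF tJ _ \<open>0 < e\<close>] by blast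
    \<comment> \<open>Shrinking the radius keeps \<open>s\<close> inside \<open>[T, 1)\<close>,
      where \<open>a\<close> is \<open>point\<close>.\<close>
    have "mdist m (a s) (a t) < e" if "\<bar>s - t\<bar> < min \<eta> (min (t - T) (1 - t))" for s
    proof -
      have "s \<in> J []" using that by (auto simp: J)
      then show ?thesis using \<eta>(2)[of s] that a_point[of s] a_point[OF tJ] by simp
    qed
    moreover have "0 < min \<eta> (min (t - T) (1 - t))" using \<eta> t1 by simp
    ultimately show ?thesis by blast
  qed
  have "countable N" by (simp add: N_def)
  then show thesis
    using that[of a N] meas law a_item cont by blast
qed

section \<open>Parameters of pm-spaces\<close>

lemma pm_space_D:
  assumes "pm_space X"
  shows "mcomplete_of (fst X)" "separable_space (mtopology_of (fst X))"
    "sets (pm_measure X) = sets (borel_of_metric (fst X))" "prob_space (pm_measure X)"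
  using assms by (auto simp: pm_space_def)

lemma pm_space_space:
  assumes "pm_space X"
  shows "space (pm_measure X) = pm_carrier X"
  using sets_eq_imp_space_eq[OF pm_space_D(3)[OF assms]] space_borel_of_metric by metis

lemma pm_space_nonempty:
  assumes "pm_space X"
  shows "pm_carrier X \<noteq> {}"
  using pm_space_space[OF assms] prob_space.not_empty[OF pm_space_D(4)[OF assms]] by metis

text \<open>The case of \<open>item_parameter\<close> in which all prescribed masses are
  zero.\<close>

lemma pm_parameter_exists:
  assumes "pm_space X"
  obtains a where "pm_parameter X a"
proof -
  obtain x0 where x0: "x0 \<in> pm_carrier X" using pm_space_nonempty[OF assms] by blast
  have "(\<lambda>_. 0) \<in> V" by (simp add: V_def)
  moreover have "has_atoms (pm_measure X) (\<lambda>_. 0) (\<lambda>_. x0)" by (simp add: has_atoms_def)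
  ultimately show thesis
    using item_parameter[OF pm_space_D[OF assms], of "\<lambda>_. 0" "\<lambda>_. x0"] x0 that unfolding pm_parameter_def by metis
qed

section \<open>Supports and representatives\<close>

text \<open>The given sequence may avoid \<open>S\<close> altogether. Instead, one point of
  \<open>S\<close> is picked from each ball with centre \<open>p n\<close> and radius
  \<open>1 / (k + 1)\<close> that meets \<open>S\<close>; balls missing \<open>S\<close> contribute
  the fixed point \<open>s0\<close>.\<close>

lemma dense_seq_submetric:
  assumes p: "dense_seq m p" and S: "S \<subseteq> mspace m" "S \<noteq> {}"
  obtains q where "dense_seq (submetric m S) q"
proof -
  interpret Metric_space "mspace m" "mdist m" by simp
  obtain s0 where s0: "s0 \<in> S" using S by blast
  define near where "near n k y \<longleftrightarrow> y \<in> S \<and> mdist m (p n) y < 1 / real (Suc k)" for n k y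
  define c where "c n k = (if \<exists>y. near n k y then SOME y. near n k y else s0)" for n k
  define q where "q = (\<lambda>(n, k). c n k) \<circ> prod_decode"
  have c: "near n k (c n k)" if "near n k y" for n k y
    using that someI[of "near n k" y] by (auto simp: c_def)
  have cS: "c n k \<in> S" for n k
  proof (cases "\<exists>y. near n k y")
    case True
    then show ?thesis using c by (auto simp: near_def)
  qed (simp add: c_def s0)
  have "dense_seq (submetric m S) q"
    unfolding dense_seq_def mspace_submetric mdist_submetric
  proof (intro conjI ballI allI impI)
    show "range q \<subseteq> S \<inter> mspace m"
      using cS S by (auto simp: q_def split_def)
    fix x and r :: real assume x: "x \<in> S \<inter> mspace m" and r: "0 < r"
    obtain k where k: "1 / real (Suc k) < r / 2"
      using r by (meson half_gt_zero nat_approx_posE)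
    have "\<exists>n. mdist m (p n) x < 1 / real (Suc k)"
      using p x by (simp add: dense_seq_def)
    then obtain n where n: "mdist m (p n) x < 1 / real (Suc k)" by blast
    then have "near n k x" using x by (simp add: near_def)
    then have "near n k (c n k)" by (rule c)
    then have "mdist m (p n) (c n k) < 1 / real (Suc k)" by (simp add: near_def)
    moreover have "mdist m (c n k) x \<le> mdist m (c n k) (p n) + mdist m (p n) x"
    proof (rule triangle)
      show "c n k \<in> mspace m" using cS S by blast
      show "p n \<in> mspace m" using p by (auto simp: dense_seq_def)
      show "x \<in> mspace m" using x by simp
    qed
    moreover have "mdist m (c n k) (p n) = mdist m (p n) (c n k)" by (rule commute)
    ultimately have "mdist m (c n k) x < r" using n k by linarith
    then have "mdist m (q (prod_encode (n, k))) x < r" by (simp add: q_def)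
    then show "\<exists>n. mdist m (q n) x < r" by blast
  qed
  then show thesis by (rule that)
qed

lemma pm_supp_subset: "pm_supp X \<subseteq> pm_carrier X"
  by (auto simp: pm_supp_def)

text \<open>By separability every point with a null neighbourhood lies in a null ball from a
  countable family, so the complement of the support is a countable union of null open
  balls.\<close>

lemma pm_supp_compl:
  assumes X: "pm_space X"
  shows "openin (mtopology_of (fst X)) (pm_carrier X - pm_supp X)"
    and "pm_carrier X - pm_supp X \<in> null_sets (pm_measure X)"
proof -
  interpret Metric_space "pm_carrier X" "pm_dist X" by simp
  obtain p where p: "dense_seq (fst X) p"
    using separable_imp_dense_seq[OF pm_space_D(2)[OF X] pm_space_nonempty[OF X]] by blast
  have pM: "p n \<in> pm_carrier X" for n using p by (auto simp: dense_seq_def)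
  define B where "B = (\<lambda>(n, k). mball (p n) (1 / real (Suc k)))"
  have B_open: "openin (mtopology_of (fst X)) (B i)" for i
    by (cases i) (simp add: B_def mtopology_of_def)
  then have B_sets: "B i \<in> sets (pm_measure X)" for i
    using openin_borel_of_metric pm_space_D(3)[OF X] by blast
  define I where "I = {i. B i \<in> null_sets (pm_measure X)}"
  have eq: "pm_carrier X - pm_supp X = (\<Union>i\<in>I. B i)"
  proof (intro equalityI subsetI)
    fix x assume "x \<in> pm_carrier X - pm_supp X"
    then obtain U where x: "x \<in> pm_carrier X" and U: "openin (mtopology_of (fst X)) U" "x \<in> U"
      "emeasure (pm_measure X) U = 0"
      by (auto simp: pm_supp_def zero_less_iff_neq_zero)
    then obtain r where r: "0 < r" "mball x r \<subseteq> U"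
      by (auto simp: openin_mtopology mtopology_of_def)
    obtain k where k: "1 / real (Suc k) < r / 2"
      using r by (meson half_gt_zero nat_approx_posE)
    have "\<exists>n. pm_dist X (p n) x < 1 / real (Suc k)"
      using p x by (simp add: dense_seq_def)
    then obtain n where n: "pm_dist X (p n) x < 1 / real (Suc k)" by blast
    have xB: "x \<in> B (n, k)" using n x pM by (simp add: B_def)
    have "B (n, k) \<subseteq> mball x r"
    proof
      fix y assume y: "y \<in> B (n, k)"
      then have y': "y \<in> pm_carrier X" "pm_dist X (p n) y < 1 / real (Suc k)" by (auto simp: B_def)
      have "pm_dist X x y \<le> pm_dist X x (p n) + pm_dist X (p n) y"
        by (rule triangle[OF x pM y'(1)])
      moreover have "pm_dist X x (p n) = pm_dist X (p n) x" by (rule commute)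
      ultimately have "pm_dist X x y < r" using y' n k by linarith
      then show "y \<in> mball x r" using x y' by simp
    qed
    then have "B (n, k) \<subseteq> U" using r by blast
    moreover have "U \<in> sets (pm_measure X)"
      using openin_borel_of_metric[OF U(1)] pm_space_D(3)[OF X] by blast
    ultimately have "emeasure (pm_measure X) (B (n, k)) = 0"
      using emeasure_mono[of "B (n, k)" U "pm_measure X"] U(3) by simp
    then have "(n, k) \<in> I" using B_sets by (auto simp: I_def null_sets_def)
    then show "x \<in> (\<Union>i\<in>I. B i)" using xB by blast
  next
    fix x assume "x \<in> (\<Union>i\<in>I. B i)"
    then obtain i where i: "i \<in> I" "x \<in> B i" by blast
    then have "emeasure (pm_measure X) (B i) = 0" by (auto simp: I_def)
    then have "x \<notin> pm_supp X" using B_open[of i] i by (auto simp: pm_supp_def)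
    moreover have "x \<in> pm_carrier X" using i by (cases i) (simp add: B_def)
    ultimately show "x \<in> pm_carrier X - pm_supp X" by blast
  qed
  show "openin (mtopology_of (fst X)) (pm_carrier X - pm_supp X)"
    unfolding eq using B_open by (intro openin_Union) blast
  have "countable I" by simp
  then show "pm_carrier X - pm_supp X \<in> null_sets (pm_measure X)"
    unfolding eq by (intro null_sets_UN') (auto simp: I_def)
qed

lemma pm_supp_closedin:
  assumes X: "pm_space X"
  shows "closedin (mtopology_of (fst X)) (pm_supp X)"
  using pm_supp_compl(1)[OF X] pm_supp_subset[of X] by (simp add: closedin_def)

lemma pm_supp_sets:
  assumes X: "pm_space X"
  shows "pm_supp X \<in> sets (pm_measure X)"
  using closedin_borel_of_metric[OF pm_supp_closedin[OF X]] pm_space_D(3)[OF X] by simp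

lemma emeasure_pm_supp:
  assumes X: "pm_space X" and A: "A \<in> sets (pm_measure X)"
  shows "emeasure (pm_measure X) (pm_supp X \<inter> A) = emeasure (pm_measure X) A"
proof -
  have "A \<subseteq> pm_carrier X"
    using sets.sets_into_space[OF A] pm_space_space[OF X] by simp
  then have "pm_supp X \<inter> A = A - (pm_carrier X - pm_supp X)" by blast
  then show ?thesis
    using emeasure_Diff_null_set[OF pm_supp_compl(2)[OF X] A] by simp
qed

lemma pm_supp_nonempty:
  assumes X: "pm_space X"
  shows "pm_supp X \<noteq> {}"
proof
  assume "pm_supp X = {}"
  then have "emeasure (pm_measure X) (space (pm_measure X)) = 0"
    using emeasure_pm_supp[OF X sets.top] by simp
  then show False
    using prob_space.emeasure_space_1[OF pm_space_D(4)[OF X]] by simp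
qed

text \<open>The traces of the open sets are the open sets of the subspace, and taking traces
  commutes with generating a sigma-algebra.\<close>

lemma sets_restrict_borel_of_metric:
  assumes S: "S \<in> sets (borel_of_metric m)"
  shows "sets (restrict_space (borel_of_metric m) S) = sets (borel_of_metric (submetric m S))"
proof -
  have sub: "S \<subseteq> mspace m" using sets.sets_into_space[OF S] by simp
  have "(\<inter>) S ` {U. openin (mtopology_of m) U} = {U. openin (mtopology_of (submetric m S)) U}"
    by (auto simp: mtopology_of_submetric openin_subtopology_alt)
  moreover have "S \<inter> mspace m = S" using sub by blast
  ultimately show ?thesis
    using sigma_sets_Int[of S "mspace m" "{U. openin (mtopology_of m) U}"] S sub
    by (simp add: sets_restrict_space sets_borel_of_metric)
qed

text \<open>Metric and measure are restricted to the support, which is closed and hence complete,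
  and the identity is the isometry. This is what makes the choice in \<open>pm_rep\<close>
  succeed.\<close>

lemma pm_iso_full_support_exists:
  assumes X: "pm_space X"
  shows "\<exists>Y. (X, Y) \<in> pm_iso \<and> pm_supp Y = pm_carrier Y"
proof -
  define S where "S = pm_supp X"
  have S_sets: "S \<in> sets (pm_measure X)" "S \<in> sets (borel_of_metric (fst X))"
    using pm_supp_sets[OF X] pm_space_D(3)[OF X] by (auto simp: S_def)
  have SM: "S \<subseteq> pm_carrier X" "S \<inter> pm_carrier X = S" using pm_supp_subset[of X] by (auto simp: S_def)
  define Y where "Y = (submetric (fst X) S, restrict_space (pm_measure X) S)"
  have carr: "pm_carrier Y = S" using SM by (simp add: Y_def)
  have sp: "space (pm_measure Y) = S"
    using SM by (simp add: Y_def space_restrict_space pm_space_space[OF X] Int_commute)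
  have emY: "emeasure (pm_measure Y) A = emeasure (pm_measure X) A" if "A \<subseteq> S" for A
    using that S_sets by (simp add: Y_def emeasure_restrict_space)
  interpret Submetric "pm_carrier X" "pm_dist X" S
    using SM by (intro Submetric.intro) (auto intro!: Submetric_axioms.intro)
  have "closedin mtopology S"
    using pm_supp_closedin[OF X] by (simp add: S_def mtopology_of_def)
  moreover have "mcomplete"
    using pm_space_D(1)[OF X] by (simp add: mcomplete_of_def)
  ultimately have "sub.mcomplete" by (rule closedin_mcomplete_imp_mcomplete)
  then have 1: "mcomplete_of (fst Y)"
    using SM by (simp add: mcomplete_of_def Y_def)
  obtain p where p: "dense_seq (fst X) p"
    using separable_imp_dense_seq[OF pm_space_D(2)[OF X] pm_space_nonempty[OF X]] by blast
  obtain q where "dense_seq (fst Y) q"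
    using dense_seq_submetric[OF p SM(1)] pm_supp_nonempty[OF X] by (auto simp: Y_def S_def)
  then have 2: "separable_space (mtopology_of (fst Y))" by (rule dense_seq_imp_separable)
  have 3: "sets (pm_measure Y) = sets (borel_of_metric (fst Y))"
    using sets_restrict_borel_of_metric[OF S_sets(2)] sets_restrict_space_cong[OF pm_space_D(3)[OF X], of S]
    by (simp add: Y_def)
  have 4: "prob_space (pm_measure Y)"
  proof
    have "emeasure (pm_measure X) S = 1"
      using emeasure_pm_supp[OF X sets.top] prob_space.emeasure_space_1[OF pm_space_D(4)[OF X]]
        sets.Int_space_eq2[OF S_sets(1)] by (simp add: S_def Int_commute)
    then show "emeasure (pm_measure Y) (space (pm_measure Y)) = 1"
      by (simp add: sp emY)
  qed
  have Y: "pm_space Y" using 1 2 3 4 by (simp add: pm_space_def)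
  \<comment> \<open>An open set of the subspace is the trace of an open set \<open>W\<close> of the
    whole space, and it has the mass of \<open>W\<close> because the complement of the support is
    null.\<close>
  have "x \<in> pm_supp Y" if x: "x \<in> S" for x
    unfolding pm_supp_def
  proof (intro CollectI conjI allI impI)
    show "x \<in> pm_carrier Y" using x carr by simp
    fix U assume U: "openin (mtopology_of (fst Y)) U \<and> x \<in> U"
    then obtain W where W: "openin (mtopology_of (fst X)) W" "U = W \<inter> S"
      by (auto simp: Y_def mtopology_of_submetric openin_subtopology)
    have Ws: "W \<in> sets (pm_measure X)"
      using openin_borel_of_metric[OF W(1)] pm_space_D(3)[OF X] by blast
    have "emeasure (pm_measure Y) U = emeasure (pm_measure X) (S \<inter> W)"
      using emY[of U] W by (simp add: Int_commute)
    also have "\<dots> = emeasure (pm_measure X) W"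
      unfolding S_def by (rule emeasure_pm_supp[OF X Ws])
    also have "\<dots> > 0"
      using x U W by (auto simp: S_def pm_supp_def)
    finally show "0 < emeasure (pm_measure Y) U" .
  qed
  then have full: "pm_supp Y = pm_carrier Y" "pm_supp Y = S"
    using pm_supp_subset[of Y] carr by auto
  have "distr (restrict_space (pm_measure X) (pm_supp X)) (pm_measure Y) (\<lambda>x. x) = pm_measure Y"
    by (simp add: Y_def S_def distr_id)
  then have "(X, Y) \<in> pm_iso"
    unfolding pm_iso_def using X Y full
    by (intro CollectI case_prodI conjI exI[of _ "\<lambda>x. x"]) (simp_all add: S_def Y_def)
  then show ?thesis using full by blast
qed

lemma pm_rep_iso:
  assumes "pm_space X"
  shows "(X, pm_rep (pm_iso `` {X})) \<in> pm_iso"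
    and "pm_supp (pm_rep (pm_iso `` {X})) = pm_carrier (pm_rep (pm_iso `` {X}))"
proof -
  have "\<exists>Y. Y \<in> pm_iso `` {X} \<and> pm_supp Y = pm_carrier Y"
    using pm_iso_full_support_exists[OF assms] by blast
  then have "pm_rep (pm_iso `` {X}) \<in> pm_iso `` {X} \<and>
      pm_supp (pm_rep (pm_iso `` {X})) = pm_carrier (pm_rep (pm_iso `` {X}))"
    unfolding pm_rep_def by (rule someI_ex)
  then show "(X, pm_rep (pm_iso `` {X})) \<in> pm_iso"
    and "pm_supp (pm_rep (pm_iso `` {X})) = pm_carrier (pm_rep (pm_iso `` {X}))" by auto
qed

lemma pm_class_in_classes: "pm_space X \<Longrightarrow> pm_iso `` {X} \<in> pm_classes"
  unfolding pm_classes_def by (rule quotientI) simp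

lemma pm_rep_classes:
  assumes "C \<in> pm_classes"
  shows "pm_space (pm_rep C)" "pm_supp (pm_rep C) = pm_carrier (pm_rep C)"
proof -
  obtain X where X: "pm_space X" "C = pm_iso `` {X}"
    using assms by (auto simp: pm_classes_def quotient_def)
  show "pm_space (pm_rep C)" "pm_supp (pm_rep C) = pm_carrier (pm_rep C)"
    using pm_rep_iso[OF X(1)] X(2) by (auto simp: pm_iso_def)
qed

section \<open>Laws of curves and their representatives\<close>

definition mk_pm :: "(nat \<Rightarrow> real) metric \<Rightarrow> (real \<Rightarrow> nat \<Rightarrow> real) \<Rightarrow> pm"
  where "mk_pm m g = (m, distr unit_interval_measure (borel_of_metric m) g)"

lemma pm_space_mk_pm:
  assumes "mcomplete_of m" "separable_space (mtopology_of m)"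
    and "g \<in> unit_interval_measure \<rightarrow>\<^sub>M borel_of_metric m"
  shows "pm_space (mk_pm m g)"
  using assms unit_interval.prob_space_distr[OF assms(3)] by (simp add: pm_space_def mk_pm_def)

lemma emeasure_parameter:
  assumes "pm_parameter X a" "A \<in> sets (pm_measure X)"
  shows "emeasure (pm_measure X) A = emeasure lborel (a -` A \<inter> {0..1})"
    and "a -` A \<inter> {0..1} \<in> sets borel"
proof -
  have a: "a \<in> unit_interval_measure \<rightarrow>\<^sub>M pm_measure X" "distr unit_interval_measure (pm_measure X) a = pm_measure X"
    using assms(1) by (auto simp: pm_parameter_def)
  have "emeasure (pm_measure X) A = emeasure unit_interval_measure (a -` A \<inter> {0..1})"
    using emeasure_distr[OF a(1) assms(2)] unfolding a(2) by simp
  also have "\<dots> = emeasure lborel (a -` A \<inter> {0..1})"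
    by (rule emeasure_unit_interval) simp
  finally show "emeasure (pm_measure X) A = emeasure lborel (a -` A \<inter> {0..1})" .
  have "a -` A \<inter> space unit_interval_measure \<in> sets unit_interval_measure"
    by (rule measurable_sets[OF a(1) assms(2)])
  then show "a -` A \<inter> {0..1} \<in> sets borel"
    by (simp only: sets_unit_interval_iff space_unit_interval)
qed

lemma pm_parameter_mk_pm:
  assumes "g \<in> unit_interval_measure \<rightarrow>\<^sub>M borel_of_metric m"
  shows "pm_parameter (mk_pm m g) g"
proof -
  have "g \<in> unit_interval_measure \<rightarrow>\<^sub>M pm_measure (mk_pm m g)"
    using assms by (simp add: mk_pm_def)
  moreover have "distr unit_interval_measure (distr unit_interval_measure (borel_of_metric m) g) g =
      distr unit_interval_measure (borel_of_metric m) g"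
    by (rule distr_cong) auto
  ultimately show ?thesis by (simp add: pm_parameter_def mk_pm_def)
qed

lemma null_sets_compl_full:
  fixes J :: "real set"
  assumes "J \<subseteq> {0..1}" "J \<in> sets borel" "emeasure lborel J = 1"
  shows "{0..1} - J \<in> null_sets lborel"
proof -
  have "emeasure lborel ({0..1} - J) = emeasure lborel {0..1::real} - emeasure lborel J"
    by (rule emeasure_Diff) (use assms in auto)
  then show ?thesis using assms by (simp add: null_sets_def)
qed

text \<open>
  The class of the law of a curve \<open>g\<close> in a metric space: its representative is a copy \<open>h ` S\<close> of the
  support \<open>S\<close> of that law, with parameter \<open>h \<circ> g\<close> up to a null set.
\<close>

definition curve_rep ::
  "(nat \<Rightarrow> real) metric \<Rightarrow> (real \<Rightarrow> nat \<Rightarrow> real) \<Rightarrow> pm set \<Rightarrow> (nat \<Rightarrow> real) set \<Rightarrow>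
   ((nat \<Rightarrow> real) \<Rightarrow> nat \<Rightarrow> real) \<Rightarrow> (real \<Rightarrow> nat \<Rightarrow> real) \<Rightarrow> bool"
  where "curve_rep m g C S h g' \<longleftrightarrow> C \<in> pm_classes \<and> S \<subseteq> mspace m \<and> h ` S = pm_carrier (pm_rep C) \<and>
    (\<forall>x\<in>S. \<forall>y\<in>S. pm_dist (pm_rep C) (h x) (h y) = mdist m x y) \<and> S \<in> sets (borel_of_metric m) \<and>
    emeasure lborel (g -` S \<inter> {0..1}) = 1 \<and> g -` S \<inter> {0..1} \<in> sets borel \<and>
    pm_parameter (pm_rep C) g' \<and> (\<forall>t\<in>{0..1}. g t \<in> S \<longrightarrow> g' t = h (g t))"

text \<open>\<open>pm_iso\<close> supplies a bare isometry \<open>h\<close> of the support of the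
  law. Being 1-Lipschitz it is Borel on the support, and its composition with \<open>g\<close> is a
  parameter of the representative once it has been redefined where \<open>g\<close> leaves the
  support.\<close>

lemma curve_rep_exists:
  fixes m :: "(nat \<Rightarrow> real) metric"
  assumes m: "mcomplete_of m" "separable_space (mtopology_of m)"
    and g: "g \<in> unit_interval_measure \<rightarrow>\<^sub>M borel_of_metric m"
  obtains C S h g' where "curve_rep m g C S h g'"
proof -
  define X where "X = mk_pm m g"
  have X: "pm_space X" unfolding X_def by (rule pm_space_mk_pm[OF m g])
  have param: "pm_parameter X g" unfolding X_def by (rule pm_parameter_mk_pm[OF g])
  have fstX: "fst X = m" by (simp add: X_def mk_pm_def)
  define C where "C = pm_iso `` {X}"
  define R where "R = pm_rep C"
  have C: "C \<in> pm_classes" unfolding C_def by (rule pm_class_in_classes[OF X])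
  define S where "S = pm_supp X"
  have R: "pm_space R" "pm_supp R = pm_carrier R"
    using pm_rep_classes[OF C] by (auto simp: R_def)
  have "(X, R) \<in> pm_iso" using pm_rep_iso[OF X] by (simp add: R_def C_def)
  then obtain h where h: "h ` S = pm_carrier R"
    "\<And>x y. x \<in> S \<Longrightarrow> y \<in> S \<Longrightarrow> pm_dist R (h x) (h y) = mdist m x y"
    "distr (restrict_space (pm_measure X) S) (pm_measure R) h = pm_measure R"
    using R(2) by (auto simp: pm_iso_def S_def fstX)
  have S_sub: "S \<subseteq> mspace m" using pm_supp_subset[of X] by (simp add: S_def fstX)
  have S_sets: "S \<in> sets (pm_measure X)" using pm_supp_sets[OF X] by (simp add: S_def)
  have "emeasure (pm_measure X) S = 1"
    using emeasure_pm_supp[OF X sets.top] prob_space.emeasure_space_1[OF pm_space_D(4)[OF X]]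
      sets.Int_space_eq2[OF S_sets] by (simp add: S_def)
  then have gS: "emeasure lborel (g -` S \<inter> {0..1}) = 1" "g -` S \<inter> {0..1} \<in> sets borel"
    using emeasure_parameter[OF param S_sets] by auto
  have h_meas: "h \<in> restrict_space (pm_measure X) S \<rightarrow>\<^sub>M borel_of_metric (fst R)"
  proof -
    have "continuous_map (mtopology_of (submetric m S)) (mtopology_of (fst R)) h"
    proof -
      have "Lipschitz_continuous_map (submetric m S) (fst R) h"
        unfolding Lipschitz_continuous_map_def
        using h(1,2) S_sub by (intro conjI exI[of _ 1]) auto
      then show ?thesis by (rule Lipschitz_continuous_imp_continuous_map)
    qed
    then have "h \<in> borel_of_metric (submetric m S) \<rightarrow>\<^sub>M borel_of_metric (fst R)"
      by (rule measurable_continuous_map)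
    moreover have "sets (restrict_space (pm_measure X) S) = sets (borel_of_metric (submetric m S))"
    proof -
      have "sets (pm_measure X) = sets (borel_of_metric m)"
        using pm_space_D(3)[OF X] by (simp add: fstX)
      then show ?thesis
        using sets_restrict_borel_of_metric[of S m] sets_restrict_space_cong[of "pm_measure X" "borel_of_metric m" S] S_sets
        by simp
    qed
    ultimately show ?thesis by (simp cong: measurable_cong_sets)
  qed
  obtain r0 where r0: "r0 \<in> pm_carrier R" using pm_space_nonempty[OF R(1)] by blast
  \<comment> \<open>The value \<open>r0\<close> is taken only on a null set of times.\<close>
  define g' where "g' t = (if g t \<in> S then h (g t) else r0)" for t
  have hS: "h -` A \<inter> S \<in> sets (pm_measure X)"
    "emeasure (pm_measure R) A = emeasure (pm_measure X) (h -` A \<inter> S)" if A: "A \<in> sets (pm_measure R)" for A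
  proof -
    have A': "A \<in> sets (borel_of_metric (fst R))" using A pm_space_D(3)[OF R(1)] by simp
    have sp: "space (restrict_space (pm_measure X) S) = S"
      using S_sets by (simp add: space_restrict_space2)
    have hm': "h \<in> restrict_space (pm_measure X) S \<rightarrow>\<^sub>M pm_measure R"
      using h_meas pm_space_D(3)[OF R(1)] by (simp cong: measurable_cong_sets)
    have "h -` A \<inter> S \<in> sets (restrict_space (pm_measure X) S)"
      using measurable_sets[OF h_meas A'] sp by simp
    then show "h -` A \<inter> S \<in> sets (pm_measure X)"
      using S_sets by (subst (asm) sets_restrict_space_iff) auto
    have "emeasure (pm_measure R) A = emeasure (restrict_space (pm_measure X) S) (h -` A \<inter> S)"
      using emeasure_distr[OF hm' A] unfolding h(3) sp .
    also have "\<dots> = emeasure (pm_measure X) (h -` A \<inter> S)"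
      using S_sets by (intro emeasure_restrict_space) auto
    finally show "emeasure (pm_measure R) A = emeasure (pm_measure X) (h -` A \<inter> S)" .
  qed
  have g'_vim: "g' -` A \<inter> {0..1} =
      (g -` (h -` A \<inter> S) \<inter> {0..1}) \<union> (if r0 \<in> A then {0..1} - (g -` S \<inter> {0..1}) else {})" for A
    by (auto simp: g'_def split: if_splits)
  have g'_sets: "g' -` A \<inter> {0..1} \<in> sets borel" if "A \<in> sets (pm_measure R)" for A
    unfolding g'_vim using emeasure_parameter(2)[OF param hS(1)[OF that]] gS(2) by auto
  have g'_carr: "g' t \<in> pm_carrier R" for t
    using h(1) r0 by (auto simp: g'_def)
  have g'_meas: "g' \<in> unit_interval_measure \<rightarrow>\<^sub>M pm_measure R"
  proof (rule measurableI)
    show "g' t \<in> space (pm_measure R)" for t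
      using g'_carr pm_space_space[OF R(1)] by simp
    show "g' -` A \<inter> space unit_interval_measure \<in> sets unit_interval_measure" if "A \<in> sets (pm_measure R)" for A
      using g'_sets[OF that] by (simp only: sets_unit_interval_iff space_unit_interval) blast
  qed
  note null = null_sets_compl_full[OF Int_lower2 gS(2,1)]
  have "distr unit_interval_measure (pm_measure R) g' = pm_measure R"
  proof (rule measure_eqI)
    fix A assume "A \<in> sets (distr unit_interval_measure (pm_measure R) g')"
    then have A: "A \<in> sets (pm_measure R)" by simp
    have "emeasure (distr unit_interval_measure (pm_measure R) g') A = emeasure unit_interval_measure (g' -` A \<inter> {0..1})"
      using emeasure_distr[OF g'_meas A] by simp
    also have "\<dots> = emeasure lborel (g' -` A \<inter> {0..1})"
      by (rule emeasure_unit_interval) simp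
    also have "\<dots> = emeasure lborel (g -` (h -` A \<inter> S) \<inter> {0..1})"
      unfolding g'_vim
      by (rule emeasure_Un_null_set) (use null emeasure_parameter(2)[OF param hS(1)[OF A]] in auto)
    also have "\<dots> = emeasure (pm_measure X) (h -` A \<inter> S)"
      using emeasure_parameter(1)[OF param hS(1)[OF A]] by simp
    finally show "emeasure (distr unit_interval_measure (pm_measure R) g') A = emeasure (pm_measure R) A"
      using hS(2)[OF A] by simp
  qed simp
  then have "pm_parameter R g'" using g'_meas by (simp add: pm_parameter_def)
  moreover have "S \<in> sets (borel_of_metric m)"
    using S_sets pm_space_D(3)[OF X] by (simp add: fstX)
  ultimately have "curve_rep m g C S h g'"
    unfolding curve_rep_def R_def[symmetric] using C S_sub h(1,2) gS by (auto simp: g'_def)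
  then show thesis by (rule that)
qed

section \<open>Box distance and pyramids in terms of parameters\<close>

lemma measure_parameter:
  assumes "pm_parameter X a" "A \<in> sets (pm_measure X)"
  shows "measure (pm_measure X) A = unit_interval.prob (a -` A \<inter> {0..1})"
    and "a -` A \<inter> {0..1} \<in> unit_interval.events"
  using emeasure_parameter[OF assms] emeasure_unit_interval[of "a -` A \<inter> {0..1}"]
  by (simp_all add: measure_def sets_unit_interval_iff)

lemma unit_interval_prob_Int_ge:
  assumes "A \<in> unit_interval.events" "B \<in> unit_interval.events"
  shows "unit_interval.prob A + unit_interval.prob B - 1 \<le> unit_interval.prob (A \<inter> B)"
proof -
  have "unit_interval.prob (A \<union> B) = unit_interval.prob A + unit_interval.prob B - unit_interval.prob (A \<inter> B)"
    by (rule measure_Un3) (use assms unit_interval.fmeasurable_eq_sets in auto)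
  then show ?thesis
    using unit_interval.prob_le_1[of "A \<union> B"] by linarith
qed

text \<open>The condition on a single \<epsilon> inside \<open>box_dist\<close>, separated from the
  infimum because it is monotone in \<epsilon> and symmetric in the two spaces.\<close>

definition box_rel :: "pm \<Rightarrow> pm \<Rightarrow> real \<Rightarrow> bool"
  where "box_rel X Y \<epsilon> \<longleftrightarrow> (\<exists>a b I. pm_parameter X a \<and> pm_parameter Y b \<and>
      I \<in> unit_interval.events \<and> 1 - \<epsilon> \<le> unit_interval.prob I \<and>
      (\<forall>s\<in>I. \<forall>t\<in>I. \<bar>pm_dist X (a s) (a t) - pm_dist Y (b s) (b t)\<bar> \<le> \<epsilon>))"

lemma box_dist_eq: "box_dist C D = Inf {\<epsilon>. 0 < \<epsilon> \<and> box_rel (pm_rep C) (pm_rep D) \<epsilon>}"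
proof -
  have *: "I \<in> unit_interval.events \<and> 1 - \<epsilon> \<le> unit_interval.prob I \<and> Q \<longleftrightarrow>
      I \<in> sets borel \<and> I \<subseteq> {0..1} \<and> 1 - \<epsilon> \<le> measure lborel I \<and> Q" for I \<epsilon> Q
    using measure_unit_interval[of I] by (auto simp: sets_unit_interval_iff)
  show ?thesis unfolding box_dist_def box_rel_def Let_def * ..
qed

lemma box_rel_commute: "box_rel X Y \<epsilon> \<Longrightarrow> box_rel Y X \<epsilon>"
proof -
  assume "box_rel X Y \<epsilon>"
  then obtain a b I where *: "pm_parameter X a" "pm_parameter Y b" "I \<in> unit_interval.events"
    "1 - \<epsilon> \<le> unit_interval.prob I"
    "\<forall>s\<in>I. \<forall>t\<in>I. \<bar>pm_dist X (a s) (a t) - pm_dist Y (b s) (b t)\<bar> \<le> \<epsilon>"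
    unfolding box_rel_def by blast
  have "\<forall>s\<in>I. \<forall>t\<in>I. \<bar>pm_dist Y (b s) (b t) - pm_dist X (a s) (a t)\<bar> \<le> \<epsilon>"
    using *(5) by (simp only: abs_minus_commute)
  then show "box_rel Y X \<epsilon>"
    unfolding box_rel_def using *(1-4) by blast
qed

lemma box_dist_commute: "box_dist C D = box_dist D C"
proof -
  have "box_rel (pm_rep C) (pm_rep D) \<epsilon> \<longleftrightarrow> box_rel (pm_rep D) (pm_rep C) \<epsilon>" for \<epsilon>
    using box_rel_commute by blast
  then show ?thesis by (simp add: box_dist_eq)
qed

lemma box_rel_mono: "box_rel X Y \<epsilon> \<Longrightarrow> \<epsilon> \<le> \<epsilon>' \<Longrightarrow> box_rel X Y \<epsilon>'"
proof -
  assume "box_rel X Y \<epsilon>" and le: "\<epsilon> \<le> \<epsilon>'"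
  then obtain a b I where *: "pm_parameter X a" "pm_parameter Y b" "I \<in> unit_interval.events"
    "1 - \<epsilon> \<le> unit_interval.prob I"
    "\<forall>s\<in>I. \<forall>t\<in>I. \<bar>pm_dist X (a s) (a t) - pm_dist Y (b s) (b t)\<bar> \<le> \<epsilon>"
    unfolding box_rel_def by blast
  have "1 - \<epsilon>' \<le> unit_interval.prob I" using *(4) le by linarith
  moreover have "\<forall>s\<in>I. \<forall>t\<in>I. \<bar>pm_dist X (a s) (a t) - pm_dist Y (b s) (b t)\<bar> \<le> \<epsilon>'"
    using *(5) le by force
  ultimately show "box_rel X Y \<epsilon>'"
    unfolding box_rel_def using *(1-3) by blast
qed

lemma box_dist_le:
  assumes "0 < \<epsilon>" "box_rel (pm_rep C) (pm_rep D) \<epsilon>"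
  shows "box_dist C D \<le> \<epsilon>"
  unfolding box_dist_eq using assms by (intro cInf_lower bdd_belowI[of _ 0]) auto

text \<open>For \<epsilon> = 1 the empty set of times is admissible. Hence the infimum in
  \<open>box_dist\<close> is over a nonempty set and can be nearly attained.\<close>

lemma box_rel_one:
  assumes "pm_space X" "pm_space Y"
  shows "box_rel X Y 1"
proof -
  obtain a b where "pm_parameter X a" "pm_parameter Y b"
    using pm_parameter_exists assms by metis
  then show ?thesis
    unfolding box_rel_def by (intro exI[of _ a] exI[of _ b] exI[of _ "{}"]) auto
qed

lemma box_rel_set_nonempty:
  assumes "C \<in> pm_classes" "D \<in> pm_classes"
  shows "{\<epsilon>. 0 < \<epsilon> \<and> box_rel (pm_rep C) (pm_rep D) \<epsilon>} \<noteq> {}"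
proof -
  have "box_rel (pm_rep C) (pm_rep D) 1"
    by (rule box_rel_one[OF pm_rep_classes(1)[OF assms(1)] pm_rep_classes(1)[OF assms(2)]])
  then have "1 \<in> {\<epsilon>. 0 < \<epsilon> \<and> box_rel (pm_rep C) (pm_rep D) \<epsilon>}" by simp
  then show ?thesis by blast
qed

lemma box_dist_nonneg:
  assumes "C \<in> pm_classes" "D \<in> pm_classes"
  shows "0 \<le> box_dist C D"
  unfolding box_dist_eq by (rule cInf_greatest[OF box_rel_set_nonempty[OF assms]]) simp

lemma box_rel_if_box_dist_less:
  assumes "C \<in> pm_classes" "D \<in> pm_classes" "box_dist C D < \<epsilon>"
  shows "box_rel (pm_rep C) (pm_rep D) \<epsilon>"
proof -
  obtain e where "e \<in> {\<epsilon>. 0 < \<epsilon> \<and> box_rel (pm_rep C) (pm_rep D) \<epsilon>}" "e < \<epsilon>"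
    using cInf_lessD[OF box_rel_set_nonempty[OF assms(1,2)] assms(3)[unfolded box_dist_eq]] by (rule bexE)
  then show ?thesis using box_rel_mono[of _ _ e \<epsilon>] by simp
qed

section \<open>Atoms and diameter in terms of representatives and parameters\<close>

lemma atoms_pyramid_iff:
  "C \<in> atoms_pyramid \<alpha> \<longleftrightarrow> C \<in> pm_classes \<and>
    (\<exists>f. (\<forall>i. f i \<in> pm_carrier (pm_rep C)) \<and> has_atoms (pm_measure (pm_rep C)) \<alpha> f)"
  by (simp add: atoms_pyramid_def has_atoms_def Let_def)

text \<open>The representative of a class has full support, so the diameter of the support is a
  condition on all pairs of points.\<close>

lemma atoms_diam_pyramid_iff:
  "C \<in> atoms_diam_pyramid \<alpha> \<delta> \<longleftrightarrow> C \<in> atoms_pyramid \<alpha> \<and>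
    (\<forall>x\<in>pm_carrier (pm_rep C). \<forall>y\<in>pm_carrier (pm_rep C). ennreal (pm_dist (pm_rep C) x y) \<le> \<delta>)"
proof (cases "C \<in> pm_classes")
  case True
  then show ?thesis
    using pm_rep_classes(2)[OF True] by (simp add: atoms_diam_pyramid_def pm_diam_def SUP_le_iff)
qed (simp add: atoms_diam_pyramid_def atoms_pyramid_iff)

lemma pm_parameter_carrier:
  assumes "pm_space R" "pm_parameter R a" "t \<in> {0..1}"
  shows "a t \<in> pm_carrier R"
proof -
  have "a \<in> unit_interval_measure \<rightarrow>\<^sub>M pm_measure R" using assms(2) by (simp add: pm_parameter_def)
  then have "a t \<in> space (pm_measure R)" by (rule measurable_space) (use assms in simp)
  then show ?thesis using pm_space_space[OF assms(1)] by simp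
qed

text \<open>A converse to \<open>item_parameter\<close>. The preimage of \<open>A\<close> contains,
  up to a null set, every item whose constant value lies in \<open>A\<close>, and these items are
  disjoint with lengths \<open>\<alpha> i\<close>. The full set \<open>J\<close> accommodates
  parameters that are constant on items only almost everywhere.\<close>

lemma has_atoms_of_parameter:
  assumes R: "pm_space R" "pm_parameter R a" and \<alpha>: "\<alpha> \<in> V"
    and J: "J \<subseteq> {0..1}" "J \<in> sets borel" "emeasure lborel J = 1"
    and const: "\<And>i s t. s \<in> item 0 \<alpha> i \<inter> J \<Longrightarrow> t \<in> item 0 \<alpha> i \<inter> J \<Longrightarrow> a s = a t"
  obtains f where "\<And>i. f i \<in> pm_carrier R" "has_atoms (pm_measure R) \<alpha> f"
proof -
  obtain x0 where x0: "x0 \<in> pm_carrier R" using pm_space_nonempty[OF R(1)] by blast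
  note a_carr = pm_parameter_carrier[OF R]
  \<comment> \<open>An item that misses the full set \<open>J\<close> has length
    \<open>\<alpha> i = 0\<close>, so any position serves.\<close>
  define f where "f i = (if item 0 \<alpha> i \<inter> J = {} then x0 else a (SOME t. t \<in> item 0 \<alpha> i \<inter> J))" for i
  have some: "(SOME t. t \<in> item 0 \<alpha> i \<inter> J) \<in> item 0 \<alpha> i \<inter> J" if "item 0 \<alpha> i \<inter> J \<noteq> {}" for i
    by (rule someI_ex) (use that in blast)
  have f: "a t = f i" if "t \<in> item 0 \<alpha> i \<inter> J" for i t
  proof -
    have ne: "item 0 \<alpha> i \<inter> J \<noteq> {}" using that by blast
    show ?thesis using const[OF that some[OF ne]] ne by (simp only: f_def if_False)
  qed
  have f_carr: "f i \<in> pm_carrier R" for i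
  proof (cases "item 0 \<alpha> i \<inter> J = {}")
    case False
    then have "(SOME t. t \<in> item 0 \<alpha> i \<inter> J) \<in> {0..1}" using some[OF False] J(1) by blast
    then show ?thesis using a_carr False by (simp add: f_def)
  qed (simp add: f_def x0)
  note null = null_sets_compl_full[OF J]
  have em: "emeasure lborel (item 0 \<alpha> i \<inter> J) = ennreal (\<alpha> i)" for i
  proof -
    have "item 0 \<alpha> i \<inter> J = item 0 \<alpha> i - ({0..1} - J)"
      using item_V_subset(2)[OF \<alpha>, of i] by blast
    then have "emeasure lborel (item 0 \<alpha> i \<inter> J) = emeasure lborel (item 0 \<alpha> i)"
      using emeasure_Diff_null_set[OF null, of "item 0 \<alpha> i"] by simp
    then show ?thesis by (simp add: emeasure_item V_D(1)[OF \<alpha>])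
  qed
  have "has_atoms (pm_measure R) \<alpha> f"
    unfolding has_atoms_def
  proof
    fix A assume A: "A \<in> sets (pm_measure R)"
    define B where "B i = (if f i \<in> A then item 0 \<alpha> i \<inter> J else {})" for i
    have B_sets: "range B \<subseteq> sets lborel" using J(2) by (auto simp: B_def)
    have "B i \<inter> B j = {}" if "i \<noteq> j" for i j
    proof -
      have "B i \<subseteq> item 0 \<alpha> i" "B j \<subseteq> item 0 \<alpha> j" by (auto simp: B_def)
      then show ?thesis using item_V_unique[OF \<alpha>] that by blast
    qed
    then have B_disj: "disjoint_family B" by (simp add: disjoint_family_on_def)
    have "(\<Sum>i. ennreal (\<alpha> i) * indicator A (f i)) = (\<Sum>i. emeasure lborel (B i))"
      by (intro suminf_cong) (simp add: B_def em indicator_def)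
    also have "\<dots> = emeasure lborel (\<Union>i. B i)"
      by (rule suminf_emeasure[OF B_sets B_disj])
    also have "\<dots> \<le> emeasure lborel (a -` A \<inter> {0..1})"
    proof (rule emeasure_mono)
      show "(\<Union>i. B i) \<subseteq> a -` A \<inter> {0..1}"
      proof
        fix t assume "t \<in> (\<Union>i. B i)"
        then obtain i where "t \<in> item 0 \<alpha> i \<inter> J" "f i \<in> A" by (auto simp: B_def split: if_splits)
        then show "t \<in> a -` A \<inter> {0..1}" using f J(1) by auto
      qed
      show "a -` A \<inter> {0..1} \<in> sets lborel" using emeasure_parameter(2)[OF R(2) A] by simp
    qed
    also have "\<dots> = emeasure (pm_measure R) A"
      using emeasure_parameter(1)[OF R(2) A] by simp
    finally show "(\<Sum>i. ennreal (\<alpha> i) * indicator A (f i)) \<le> emeasure (pm_measure R) A" .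
  qed
  then show thesis using that f_carr by blast
qed

section \<open>Closedness\<close>

text \<open>
  Pairwise \<open>e\<close>-separated points carrying disjoint sets of mass at least \<open>c\<close> are at most \<open>1/c\<close> many.
\<close>

lemma convergent_subsequence_of_heavy_balls:
  fixes m :: "'a metric"
  assumes m: "mcomplete_of m" and \<mu>: "sets \<mu> = sets (borel_of_metric m)" "prob_space \<mu>"
    and x: "\<And>n. x n \<in> mspace m" and e: "e \<longlonglongrightarrow> 0" and c: "0 < c"
    and heavy: "\<forall>\<^sub>F n in sequentially. c \<le> measure \<mu> {y \<in> mspace m. mdist m (x n) y \<le> e n}"
  obtains r l where "strict_mono (r :: nat \<Rightarrow> nat)"
    "limitin (mtopology_of m) (x \<circ> r) l sequentially"
proof -
  interpret Metric_space "mspace m" "mdist m" by simp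
  interpret \<mu>: prob_space \<mu> by fact
  have ball_sets: "{y \<in> mspace m. mdist m (x n) y \<le> r} \<in> sets \<mu>" for n r
  proof -
    have "{y \<in> mspace m. mdist m (x n) y \<le> r} = mcball (x n) r" using x by auto
    then show ?thesis
      using closedin_borel_of_metric[of m "mcball (x n) r"] \<mu>(1) by (simp add: mtopology_of_def)
  qed
  have "mtotally_bounded (range x)"
    unfolding mtotally_bounded_def
  proof (intro allI impI)
    fix \<epsilon> :: real assume \<epsilon>: "0 < \<epsilon>"
    \<comment> \<open>Balls of radius below \<epsilon> / 3 about \<epsilon>-separated centres are
      disjoint.\<close>
    have "\<forall>\<^sub>F n in sequentially. e n < \<epsilon> / 3" using e \<epsilon> by (intro order_tendstoD) auto
    then have "\<forall>\<^sub>F n in sequentially. e n < \<epsilon> / 3 \<and> c \<le> measure \<mu> {y \<in> mspace m. mdist m (x n) y \<le> e n}"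
      using heavy by eventually_elim simp
    then obtain N where N: "\<And>n. N \<le> n \<Longrightarrow> e n < \<epsilon> / 3"
      "\<And>n. N \<le> n \<Longrightarrow> c \<le> measure \<mu> {y \<in> mspace m. mdist m (x n) y \<le> e n}"
      by (auto simp: eventually_sequentially)
    define P where "P F \<longleftrightarrow> finite F \<and> F \<subseteq> {N..} \<and> (\<forall>i\<in>F. \<forall>j\<in>F. i \<noteq> j \<longrightarrow> \<epsilon> \<le> mdist m (x i) (x j))" for F
    have bound: "card F \<le> nat \<lceil>1 / c\<rceil>" if "P F" for F
    proof -
      let ?B = "\<lambda>n. {y \<in> mspace m. mdist m (x n) y \<le> e n}"
      have "disjoint_family_on ?B F"
        unfolding disjoint_family_on_def
      proof (intro ballI impI)
        fix i j assume ij: "i \<in> F" "j \<in> F" "i \<noteq> j"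
        have "False" if y: "y \<in> mspace m" "mdist m (x i) y \<le> e i" "mdist m (x j) y \<le> e j" for y
        proof -
          have "mdist m (x i) (x j) \<le> mdist m (x i) y + mdist m y (x j)"
            by (rule triangle[OF x y(1) x])
          moreover have "mdist m y (x j) = mdist m (x j) y" by (rule commute)
          moreover have "\<epsilon> \<le> mdist m (x i) (x j)" "N \<le> i" "N \<le> j" using ij \<open>P F\<close> by (auto simp: P_def)
          ultimately show False using y N(1)[of i] N(1)[of j] \<epsilon> by linarith
        qed
        then show "?B i \<inter> ?B j = {}" by blast
      qed
      then have "measure \<mu> (\<Union>i\<in>F. ?B i) = (\<Sum>i\<in>F. measure \<mu> (?B i))"
        using \<open>P F\<close> ball_sets by (intro \<mu>.finite_measure_finite_Union) (auto simp: P_def)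
      moreover have "(\<Sum>i\<in>F. c) \<le> (\<Sum>i\<in>F. measure \<mu> (?B i))"
        using \<open>P F\<close> N(2) by (intro sum_mono) (auto simp: P_def)
      moreover have "measure \<mu> (\<Union>i\<in>F. ?B i) \<le> 1" by (rule \<mu>.prob_le_1)
      ultimately have "real (card F) * c \<le> 1" by simp
      then have "real (card F) \<le> 1 / c" using c by (simp add: field_simps)
      then show ?thesis by linarith
    qed
    \<comment> \<open>A separated family of greatest cardinality is a net for all indices from
      \<open>N\<close> on, since otherwise it could be enlarged. The finitely many earlier points
      are added as further centres.\<close>
    have "P {}" by (simp add: P_def)
    moreover have "\<forall>G. P G \<longrightarrow> card G < Suc (nat \<lceil>1 / c\<rceil>)"
      using bound le_imp_less_Suc by blast
    ultimately have "\<exists>F. P F \<and> (\<forall>G. P G \<longrightarrow> card G \<le> card F)"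
      by (rule ex_has_greatest_nat)
    then obtain F where F: "P F" "\<And>G. P G \<Longrightarrow> card G \<le> card F" by blast
    have cover: "\<exists>k\<in>F. mdist m (x k) (x n) < \<epsilon>" if "N \<le> n" for n
    proof (rule ccontr)
      assume *: "\<not> ?thesis"
      then have "n \<notin> F" using x \<epsilon> by auto
      have far: "\<epsilon> \<le> mdist m (x k) (x n)" "\<epsilon> \<le> mdist m (x n) (x k)" if "k \<in> F" for k
      proof -
        show "\<epsilon> \<le> mdist m (x k) (x n)" using * that by (meson not_less)
        then show "\<epsilon> \<le> mdist m (x n) (x k)" by (simp only: commute[of "x n" "x k"])
      qed
      have "P (insert n F)"
        unfolding P_def
      proof (intro conjI ballI impI)
        show "finite (insert n F)" "insert n F \<subseteq> {N..}" using F(1) that by (auto simp: P_def)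
        fix i j assume ij: "i \<in> insert n F" "j \<in> insert n F" "i \<noteq> j"
        then consider "i = n" "j \<in> F" | "i \<in> F" "j = n" | "i \<in> F" "j \<in> F" by blast
        then show "\<epsilon> \<le> mdist m (x i) (x j)"
        proof cases
          case 3
          then show ?thesis using F(1) ij(3) by (simp add: P_def)
        qed (use far in simp_all)
      qed
      then have "card (insert n F) \<le> card F" by (rule F(2))
      then show False using \<open>n \<notin> F\<close> F(1) by (simp add: P_def)
    qed
    have "range x \<subseteq> (\<Union>z\<in>x ` (F \<union> {..<N}). mball z \<epsilon>)"
    proof
      fix y assume "y \<in> range x"
      then obtain n where n: "y = x n" by blast
      show "y \<in> (\<Union>z\<in>x ` (F \<union> {..<N}). mball z \<epsilon>)"
      proof (cases "N \<le> n")
        case True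
        then obtain k where "k \<in> F" "mdist m (x k) (x n) < \<epsilon>" using cover by blast
        then have "k \<in> F" "x n \<in> mball (x k) \<epsilon>" using x by simp_all
        then show ?thesis using n by blast
      next
        case False
        then have "n \<in> {..<N}" "x n \<in> mball (x n) \<epsilon>" using x \<epsilon> by simp_all
        then show ?thesis using n by blast
      qed
    qed
    moreover have "finite (x ` (F \<union> {..<N}))" using F(1) by (simp add: P_def)
    ultimately show "\<exists>K. finite K \<and> K \<subseteq> range x \<and> range x \<subseteq> (\<Union>z\<in>K. mball z \<epsilon>)"
      by (intro exI[of _ "x ` (F \<union> {..<N})"]) auto
  qed
  then obtain r where r: "strict_mono (r :: nat \<Rightarrow> nat)" "MCauchy (x \<circ> r)"
    unfolding mtotally_bounded_sequentially by blast
  then obtain l where "limitin mtopology (x \<circ> r) l sequentially"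
    using m unfolding mcomplete_of_def mcomplete_def by blast
  then show thesis using that[OF r(1)] by (simp add: mtopology_of_def)
qed

lemma finite_sets_pm_measure:
  assumes X: "pm_space X" and Q: "finite Q" "Q \<subseteq> pm_carrier X"
  shows "Q \<in> sets (pm_measure X)"
proof -
  interpret Metric_space "pm_carrier X" "pm_dist X" by simp
  have "closedin mtopology Q"
    by (rule closedin_Hausdorff_finite[OF Hausdorff_space_mtopology _ Q(1)]) (use Q in simp)
  then show ?thesis
    using closedin_borel_of_metric[of "fst X" Q] pm_space_D(3)[OF X] by (simp add: mtopology_of_def)
qed

text \<open>The positions indexed by \<open>G\<close> lie in \<open>Q\<close>, so testing the
  measure inequality at \<open>Q\<close> counts every entry in \<open>G\<close>, even when positions
  coincide.\<close>

lemma has_atoms_sum_le: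
  assumes "has_atoms \<mu> \<alpha> f" "Q \<in> sets \<mu>" "finite G" "f ` G \<subseteq> Q" "\<And>i. 0 \<le> \<alpha> i" "prob_space \<mu>"
  shows "sum \<alpha> G \<le> measure \<mu> Q"
proof -
  interpret prob_space \<mu> by fact
  have "ennreal (sum \<alpha> G) = (\<Sum>i\<in>G. ennreal (\<alpha> i) * indicator Q (f i))"
  proof -
    have "(\<Sum>i\<in>G. ennreal (\<alpha> i) * indicator Q (f i)) = (\<Sum>i\<in>G. ennreal (\<alpha> i))"
      using assms(4) by (intro sum.cong) auto
    also have "\<dots> = ennreal (sum \<alpha> G)"
      by (rule sum_ennreal) (rule assms(5))
    finally show ?thesis ..
  qed
  also have "\<dots> \<le> (\<Sum>i. ennreal (\<alpha> i) * indicator Q (f i))"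
    by (rule sum_le_suminf) (use assms(3) in auto)
  also have "\<dots> \<le> emeasure \<mu> Q"
    using assms(1,2) by (simp add: has_atoms_def)
  also have "\<dots> = ennreal (measure \<mu> Q)"
    by (rule emeasure_eq_measure)
  finally show ?thesis by simp
qed

text \<open>A point outside a finite set has a positive least distance to it.\<close>

lemma finite_Inter_neighbourhoods:
  assumes M: "Metric_space M d" and L: "finite L" "L \<subseteq> M"
  shows "(\<Inter>k. \<Union>z\<in>L. {y \<in> M. d z y \<le> 1 / real (Suc k)}) = L"
proof -
  interpret Metric_space M d by fact
  show ?thesis
  proof (intro equalityI subsetI)
    fix y assume y: "y \<in> L"
    then have "y \<in> M" using L by blast
    then show "y \<in> (\<Inter>k. \<Union>z\<in>L. {y \<in> M. d z y \<le> 1 / real (Suc k)})"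
      using y by (auto intro!: bexI[of _ y])
  next
    fix y assume y: "y \<in> (\<Inter>k. \<Union>z\<in>L. {y \<in> M. d z y \<le> 1 / real (Suc k)})"
    then have yM: "y \<in> M" by blast
    show "y \<in> L"
    proof (rule ccontr)
      assume "y \<notin> L"
      then have pos: "0 < d z y" if "z \<in> L" for z
        using that L(2) yM mdist_pos_less[of z y] by blast
      obtain z0 where "z0 \<in> L" using y by blast
      define r where "r = Min ((\<lambda>z. d z y) ` L)"
      have "r \<in> (\<lambda>z. d z y) ` L"
        unfolding r_def using L(1) \<open>z0 \<in> L\<close> by (intro Min_in) auto
      then have "0 < r" using pos by auto
      then obtain k where k: "1 / real (Suc k) < r" by (meson nat_approx_posE)
      obtain z where z: "z \<in> L" "d z y \<le> 1 / real (Suc k)" using y by blast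
      have "r \<le> d z y" unfolding r_def using L(1) z(1) by (intro Min_le) auto
      then show False using z(2) k by linarith
    qed
  qed
qed

text \<open>For constant parameters this is closedness of a single pyramid; for varying ones it is
  the half of weak convergence that keeps foreign spaces away from the sequence.\<close>

lemma pyramid_limit:
  assumes C: "C \<in> pm_classes" and \<alpha>: "\<And>n. \<alpha> n \<in> V" and \<beta>: "\<beta> \<in> V"
    and \<alpha>_lim: "\<And>i. (\<lambda>n. \<alpha> n i) \<longlonglongrightarrow> \<beta> i" and \<delta>_lim: "\<delta> \<longlonglongrightarrow> \<delta>'"
    and D: "\<And>n. D n \<in> atoms_diam_pyramid (\<alpha> n) (\<delta> n)"
    and lim: "(\<lambda>n. box_dist (D n) C) \<longlonglongrightarrow> 0"
  shows "C \<in> atoms_diam_pyramid \<beta> \<delta>'"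
proof -
  define X where "X = pm_rep C"
  define Y where "Y n = pm_rep (D n)" for n
  \<comment> \<open>The infimum in \<open>box_dist\<close> may not be attained, hence the additional
    term.\<close>
  define \<epsilon> where "\<epsilon> n = box_dist (D n) C + 1 / real (Suc n)" for n
  have D_cl: "D n \<in> pm_classes" for n
    using D by (auto simp: atoms_diam_pyramid_iff atoms_pyramid_iff)
  have X: "pm_space X" "pm_supp X = pm_carrier X"
    using pm_rep_classes[OF C] by (auto simp: X_def)
  have Y: "pm_space (Y n)" for n
    using pm_rep_classes[OF D_cl] by (auto simp: Y_def)
  have Y_diam: "ennreal (pm_dist (Y n) x y) \<le> \<delta> n" if "x \<in> pm_carrier (Y n)" "y \<in> pm_carrier (Y n)" for n x y
    using D[of n] that by (auto simp: atoms_diam_pyramid_iff Y_def)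
  have \<epsilon>_lim: "\<epsilon> \<longlonglongrightarrow> 0"
    using tendsto_add[OF lim LIMSEQ_Suc[OF lim_const_over_n[of 1]]] by (simp add: \<epsilon>_def[abs_def])
  have rel: "box_rel (Y n) X (\<epsilon> n)" for n
    unfolding X_def Y_def by (rule box_rel_if_box_dist_less[OF D_cl C]) (simp add: \<epsilon>_def)
  have "\<forall>n. \<exists>b a I f. pm_parameter (Y n) b \<and> pm_parameter X a \<and> I \<in> unit_interval.events \<and>
      1 - \<epsilon> n \<le> unit_interval.prob I \<and>
      (\<forall>s\<in>I. \<forall>t\<in>I. \<bar>pm_dist (Y n) (b s) (b t) - pm_dist X (a s) (a t)\<bar> \<le> \<epsilon> n) \<and>
      (\<forall>i. f i \<in> pm_carrier (Y n)) \<and> has_atoms (pm_measure (Y n)) (\<alpha> n) f"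
  proof
    fix n
    have "\<exists>f. (\<forall>i. f i \<in> pm_carrier (Y n)) \<and> has_atoms (pm_measure (Y n)) (\<alpha> n) f"
      using D[of n] by (simp add: atoms_diam_pyramid_iff atoms_pyramid_iff Y_def)
    then show "\<exists>b a I f. pm_parameter (Y n) b \<and> pm_parameter X a \<and> I \<in> unit_interval.events \<and>
      1 - \<epsilon> n \<le> unit_interval.prob I \<and>
      (\<forall>s\<in>I. \<forall>t\<in>I. \<bar>pm_dist (Y n) (b s) (b t) - pm_dist X (a s) (a t)\<bar> \<le> \<epsilon> n) \<and>
      (\<forall>i. f i \<in> pm_carrier (Y n)) \<and> has_atoms (pm_measure (Y n)) (\<alpha> n) f"
      using rel[of n] unfolding box_rel_def by blast
  qed
  then obtain b a I f where
    "\<forall>n. pm_parameter (Y n) (b n) \<and> pm_parameter X (a n) \<and> I n \<in> unit_interval.events \<and>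
      1 - \<epsilon> n \<le> unit_interval.prob (I n) \<and>
      (\<forall>s\<in>I n. \<forall>t\<in>I n. \<bar>pm_dist (Y n) (b n s) (b n t) - pm_dist X (a n s) (a n t)\<bar> \<le> \<epsilon> n) \<and>
      (\<forall>i. f n i \<in> pm_carrier (Y n)) \<and> has_atoms (pm_measure (Y n)) (\<alpha> n) (f n)"
    unfolding choice_iff by (elim exE) rule
  then have b: "pm_parameter (Y n) (b n)" and a: "pm_parameter X (a n)"
    and I: "I n \<in> unit_interval.events" "1 - \<epsilon> n \<le> unit_interval.prob (I n)"
    and close: "\<And>s t. s \<in> I n \<Longrightarrow> t \<in> I n \<Longrightarrow>
      \<bar>pm_dist (Y n) (b n s) (b n t) - pm_dist X (a n s) (a n t)\<bar> \<le> \<epsilon> n"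
    and f: "f n i \<in> pm_carrier (Y n)" "has_atoms (pm_measure (Y n)) (\<alpha> n) (f n)" for n i
    by blast+
  have I_sub: "I n \<subseteq> {0..1}" for n
    using I(1)[of n] by (simp only: sets_unit_interval_iff)
  interpret Metric_space "pm_carrier X" "pm_dist X" by simp
  interpret \<mu>: prob_space "pm_measure X" by (rule pm_space_D(4)[OF X(1)])
  have b_carr: "b n t \<in> pm_carrier (Y n)" if "t \<in> I n" for n t
    using pm_parameter_carrier[OF Y b] that I_sub by blast
  have a_carr: "a n t \<in> pm_carrier X" if "t \<in> I n" for n t
    using pm_parameter_carrier[OF X(1) a] that I_sub by blast
  have cball_sets: "{y \<in> pm_carrier X. pm_dist X z y \<le> r} \<in> sets (pm_measure X)" if "z \<in> pm_carrier X" for z r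
  proof -
    have "{y \<in> pm_carrier X. pm_dist X z y \<le> r} = mcball z r" using that by auto
    then show ?thesis
      using closedin_borel_of_metric[of "fst X" "mcball z r"] pm_space_D(3)[OF X(1)] by (simp add: mtopology_of_def)
  qed

  have diam: "ennreal (pm_dist X x y) \<le> \<delta>'" if xy: "x \<in> pm_carrier X" "y \<in> pm_carrier X" for x y
  proof (rule ccontr)
    assume "\<not> ennreal (pm_dist X x y) \<le> \<delta>'"
    then obtain c where c: "\<delta>' < c" "c < ennreal (pm_dist X x y)"
      by (meson dense not_less)
    then obtain q where q: "c = ennreal q" "0 \<le> q"
      by (cases c) auto
    have qd: "q < pm_dist X x y" using c(2) q by (simp add: ennreal_less_iff)
    \<comment> \<open>One third of the gap is allowed for each of the balls about \<open>x\<close>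
      and \<open>y\<close>, and one third for the box error.\<close>
    define r where "r = (pm_dist X x y - q) / 3"
    have r: "0 < r" using qd by (simp add: r_def)
    define u where "u z = measure (pm_measure X) (mball z r)" for z
    have ball: "mball z r \<in> sets (pm_measure X)" "0 < u z" if "z \<in> pm_carrier X" for z
    proof -
      have op: "openin (mtopology_of (fst X)) (mball z r)" by (simp add: mtopology_of_def)
      then show "mball z r \<in> sets (pm_measure X)"
        using openin_borel_of_metric pm_space_D(3)[OF X(1)] by blast
      have "z \<in> pm_supp X" using that X(2) by simp
      then have "0 < emeasure (pm_measure X) (mball z r)"
        unfolding pm_supp_def using op that r by simp
      then show "0 < u z" by (simp add: u_def \<mu>.emeasure_eq_measure)
    qed
    have "\<forall>\<^sub>F n in sequentially. \<epsilon> n < min r (min (u x) (u y))"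
      using \<epsilon>_lim r ball(2) xy by (intro order_tendstoD) auto
    moreover have "\<forall>\<^sub>F n in sequentially. \<delta> n < ennreal q"
      using \<delta>_lim c(1) q by (intro order_tendstoD) auto
    ultimately have "\<forall>\<^sub>F n in sequentially. \<epsilon> n < min r (min (u x) (u y)) \<and> \<delta> n < ennreal q"
      by eventually_elim simp
    then obtain n where n: "\<epsilon> n < min r (min (u x) (u y))" "\<delta> n < ennreal q"
      using eventually_happens'[OF sequentially_bot] by blast
    \<comment> \<open>Full support gives the ball positive mass, which eventually exceeds the
      probability at most \<open>\<epsilon> n\<close> of the times outside \<open>I n\<close>; some
      good time therefore visits the ball.\<close>
    have meet: "\<exists>t\<in>I n. a n t \<in> mball z r" if "z \<in> pm_carrier X" "\<epsilon> n < u z" for z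
    proof (rule ccontr)
      assume none: "\<not> ?thesis"
      have "u z = unit_interval.prob (a n -` mball z r \<inter> {0..1})" "a n -` mball z r \<inter> {0..1} \<in> unit_interval.events"
        using measure_parameter[OF a ball(1)[OF that(1)]] by (auto simp: u_def)
      then have "u z + unit_interval.prob (I n) - 1 \<le> unit_interval.prob (a n -` mball z r \<inter> {0..1} \<inter> I n)"
        using unit_interval_prob_Int_ge I(1) by metis
      moreover have "a n -` mball z r \<inter> {0..1} \<inter> I n = {}" using none by blast
      ultimately show False using I(2)[of n] that(2) by simp
    qed
    obtain s where s: "s \<in> I n" "a n s \<in> mball x r" using meet[OF xy(1)] n(1) by auto
    obtain t where t: "t \<in> I n" "a n t \<in> mball y r" using meet[OF xy(2)] n(1) by auto
    have "pm_dist X x y \<le> pm_dist X x (a n s) + pm_dist X (a n s) (a n t) + pm_dist X (a n t) y"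
      using triangle[OF xy(1) a_carr[OF s(1)] xy(2)] triangle[OF a_carr[OF s(1)] a_carr[OF t(1)] xy(2)] by linarith
    moreover have "pm_dist X (a n t) y = pm_dist X y (a n t)" by (rule commute)
    moreover have "pm_dist X x (a n s) < r" "pm_dist X y (a n t) < r" using s t by auto
    ultimately have "q < pm_dist (Y n) (b n s) (b n t)"
      using close[OF s(1) t(1)] n(1) by (auto simp: r_def)
    then have "ennreal q \<le> ennreal (pm_dist (Y n) (b n s) (b n t))"
      by (intro ennreal_leI) simp
    also have "\<dots> \<le> \<delta> n" by (rule Y_diam[OF b_carr[OF s(1)] b_carr[OF t(1)]])
    finally show False using n(2) by simp
  qed

  obtain x0 where x0: "x0 \<in> pm_carrier X" using pm_space_nonempty[OF X(1)] by blast
  \<comment> \<open>The good times at which the parameter of \<open>Y n\<close> sits at its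
    \<open>i\<close>-th atom. One of them, \<tau>, carries that atom over to a point
    \<open>x n i\<close> of \<open>X\<close>; the default \<open>x0\<close> is used if there is no
    such time.\<close>
  define K where "K n i = {t \<in> I n. b n t = f n i}" for n i
  define \<tau> where "\<tau> n i = (SOME t. t \<in> K n i)" for n i
  define x where "x n i = (if K n i = {} then x0 else a n (\<tau> n i))" for n i
  have \<tau>: "\<tau> n i \<in> K n i" if "t \<in> K n i" for n i t
    unfolding \<tau>_def using that by (rule someI)
  have x_carr: "x n i \<in> pm_carrier X" for n i
  proof (cases "K n i = {}")
    case False
    then have "\<tau> n i \<in> I n" using \<tau> by (auto simp: K_def)
    then show ?thesis using False a_carr by (simp add: x_def)
  qed (simp add: x_def x0)
  \<comment> \<open>Any two times in \<open>K n i\<close> have distance zero in \<open>Y n\<close>,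
    hence distance at most \<open>\<epsilon> n\<close> in \<open>X\<close>.\<close>
  have x_close: "pm_dist X (x n i) (a n t) \<le> \<epsilon> n" if "t \<in> K n i" for n i t
  proof -
    have t: "t \<in> I n" "b n t = f n i" "\<tau> n i \<in> I n" "b n (\<tau> n i) = f n i"
      using that \<tau>[OF that] by (auto simp: K_def)
    have "pm_dist (Y n) (b n (\<tau> n i)) (b n t) = 0"
      using t f(1)[of n i] by simp
    then have "pm_dist X (a n (\<tau> n i)) (a n t) \<le> \<epsilon> n"
      using close[OF t(3,1)] by linarith
    moreover have "x n i = a n (\<tau> n i)" using that by (auto simp: x_def)
    ultimately show ?thesis by simp
  qed
  \<comment> \<open>The atoms in \<open>G\<close> together lose only the mass
    \<open>\<epsilon> n\<close> of the bad times, whatever the size of \<open>G\<close>.\<close>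
  have key: "sum (\<alpha> n) G - \<epsilon> n \<le> measure (pm_measure X) B"
    if G: "finite G" and B: "B \<in> sets (pm_measure X)"
      and sub: "\<And>i t. i \<in> G \<Longrightarrow> t \<in> K n i \<Longrightarrow> a n t \<in> B" for n G B
  proof -
    have fG: "f n ` G \<in> sets (pm_measure (Y n))"
      using G f(1) by (intro finite_sets_pm_measure[OF Y]) auto
    let ?A = "b n -` (f n ` G) \<inter> {0..1}"
    have "sum (\<alpha> n) G \<le> measure (pm_measure (Y n)) (f n ` G)"
      by (rule has_atoms_sum_le[OF f(2) fG G order_refl V_D(1)[OF \<alpha>] pm_space_D(4)[OF Y]])
    also have "\<dots> = unit_interval.prob ?A"
      by (rule measure_parameter(1)[OF b fG])
    finally have "sum (\<alpha> n) G - \<epsilon> n \<le> unit_interval.prob ?A + unit_interval.prob (I n) - 1"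
      using I(2)[of n] by linarith
    also have "\<dots> \<le> unit_interval.prob (?A \<inter> I n)"
      by (rule unit_interval_prob_Int_ge[OF measure_parameter(2)[OF b fG] I(1)])
    also have "\<dots> \<le> unit_interval.prob (a n -` B \<inter> {0..1})"
    proof (rule unit_interval.finite_measure_mono)
      show "?A \<inter> I n \<subseteq> a n -` B \<inter> {0..1}"
      proof
        fix t assume t: "t \<in> ?A \<inter> I n"
        then obtain i where "i \<in> G" "t \<in> K n i" by (auto simp: K_def)
        then show "t \<in> a n -` B \<inter> {0..1}" using sub t by blast
      qed
    qed (rule measure_parameter(2)[OF a B])
    also have "\<dots> = measure (pm_measure X) B"
      using measure_parameter(1)[OF a B] by simp
    finally show ?thesis .
  qed

  \<comment> \<open>For a single index, \<open>key\<close> gives the ball of radius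
    \<open>\<epsilon> n\<close> about \<open>x n i\<close> a mass that is eventually above
    \<open>\<beta> i / 2\<close>.\<close>
  have sub_lim: "\<exists>r l. strict_mono (r :: nat \<Rightarrow> nat) \<and> limitin mtopology (\<lambda>n. x (s (r n)) i) l sequentially"
    if s: "strict_mono (s :: nat \<Rightarrow> nat)" and pos: "0 < \<beta> i" for s i
  proof -
    have \<alpha>s: "(\<lambda>n. \<alpha> (s n) i) \<longlonglongrightarrow> \<beta> i" and \<epsilon>s: "(\<lambda>n. \<epsilon> (s n)) \<longlonglongrightarrow> 0"
      using LIMSEQ_subseq_LIMSEQ[OF \<alpha>_lim s] LIMSEQ_subseq_LIMSEQ[OF \<epsilon>_lim s] by (auto simp: o_def)
    have "(\<lambda>n. \<alpha> (s n) i - \<epsilon> (s n)) \<longlonglongrightarrow> \<beta> i" using tendsto_diff[OF \<alpha>s \<epsilon>s] by simp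
    then have half: "\<forall>\<^sub>F n in sequentially. \<beta> i / 2 < \<alpha> (s n) i - \<epsilon> (s n)"
      using pos by (intro order_tendstoD) auto
    have heavy: "\<alpha> (s n) i - \<epsilon> (s n) \<le> measure (pm_measure X) {y \<in> pm_carrier X. pm_dist X (x (s n) i) y \<le> \<epsilon> (s n)}" for n
    proof -
      have "sum (\<alpha> (s n)) {i} - \<epsilon> (s n) \<le> measure (pm_measure X) {y \<in> pm_carrier X. pm_dist X (x (s n) i) y \<le> \<epsilon> (s n)}"
        using x_close a_carr by (intro key cball_sets x_carr) (auto simp: K_def)
      then show ?thesis by simp
    qed
    have "\<forall>\<^sub>F n in sequentially. \<beta> i / 2 \<le> measure (pm_measure X) {y \<in> pm_carrier X. pm_dist X (x (s n) i) y \<le> \<epsilon> (s n)}"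
      using half
    proof eventually_elim
      case (elim n)
      then show ?case using heavy[of n] by linarith
    qed
    then obtain r l where "strict_mono (r :: nat \<Rightarrow> nat)" "limitin (mtopology_of (fst X)) ((\<lambda>n. x (s n) i) \<circ> r) l sequentially"
      using convergent_subsequence_of_heavy_balls[OF pm_space_D(1,3,4)[OF X(1)], of "\<lambda>n. x (s n) i" "\<lambda>n. \<epsilon> (s n)" "\<beta> i / 2"]
        x_carr \<epsilon>s pos by auto
    then show ?thesis by (auto simp: o_def mtopology_of_def)
  qed
  \<comment> \<open>Only indices with positive limiting mass have positions that must subconverge;
    the others are placed at \<open>x0\<close> below.\<close>
  define P where "P i s \<longleftrightarrow> 0 < \<beta> i \<longrightarrow> (\<exists>l. limitin mtopology (\<lambda>n. x (s n) i) l sequentially)" for i and s :: "nat \<Rightarrow> nat"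
  interpret subseqs P
  proof
    fix i and s :: "nat \<Rightarrow> nat" assume "strict_mono s"
    then show "\<exists>r'. strict_mono r' \<and> P i (s \<circ> r')"
      using sub_lim[of s i] strict_mono_id by (cases "0 < \<beta> i") (auto simp: P_def)
  qed
  define r where "r = diagseq"
  have r: "strict_mono r" unfolding r_def by (rule subseq_diagseq)
  have "\<exists>l. limitin mtopology (\<lambda>n. x (r n) i) l sequentially" if pos: "0 < \<beta> i" for i
  proof -
    have "P i (diagseq \<circ> (+) (Suc i))"
    proof (rule diagseq_holds)
      fix r s n assume "strict_mono (r :: nat \<Rightarrow> nat)" "P n s"
      then show "P n (s \<circ> r)"
        using limitin_subsequence[of r mtopology "\<lambda>k. x (s k) n"] by (auto simp: P_def o_def)
    qed
    then obtain l where "limitin mtopology (\<lambda>n. x (r (n + Suc i)) i) l sequentially"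
      using pos by (auto simp: P_def r_def o_def add.commute)
    then have "limitin mtopology (\<lambda>n. x (r n) i) l sequentially"
      by (rule limitin_sequentially_offset_rev)
    then show ?thesis by blast
  qed
  then obtain l where l: "\<And>i. 0 < \<beta> i \<Longrightarrow> limitin mtopology (\<lambda>n. x (r n) i) (l i) sequentially"
    by metis
  have l_carr: "l i \<in> pm_carrier X" if "0 < \<beta> i" for i
    using l[OF that] by (rule limitin_mspace)
  define F where "F i = (if 0 < \<beta> i then l i else x0)" for i
  have F_carr: "F i \<in> pm_carrier X" for i
    using l_carr x0 by (simp add: F_def)
  have \<alpha>r: "(\<lambda>n. \<alpha> (r n) i) \<longlonglongrightarrow> \<beta> i" for i
    using LIMSEQ_subseq_LIMSEQ[OF \<alpha>_lim r] by (simp add: o_def)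
  have \<epsilon>r: "(\<lambda>n. \<epsilon> (r n)) \<longlonglongrightarrow> 0"
    using LIMSEQ_subseq_LIMSEQ[OF \<epsilon>_lim r] by (simp add: o_def)

  have mass: "sum \<beta> G \<le> measure (pm_measure X) (F ` G)" if G: "finite G" "\<And>i. i \<in> G \<Longrightarrow> 0 < \<beta> i" for G
  proof -
    define B where "B k = (\<Union>z\<in>F ` G. {y \<in> pm_carrier X. pm_dist X z y \<le> 1 / real (Suc k)})" for k
    have B_sets: "B k \<in> sets (pm_measure X)" for k
      unfolding B_def using G(1) F_carr cball_sets by (intro sets.finite_UN) auto
    have B_ge: "sum \<beta> G \<le> measure (pm_measure X) (B k)" for k
    proof -
      define \<rho> where "\<rho> = 1 / real (Suc k)"
      have \<rho>: "0 < \<rho>" by (simp add: \<rho>_def)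
      have "\<forall>\<^sub>F n in sequentially. \<forall>i\<in>G. pm_dist X (x (r n) i) (l i) < \<rho> / 2"
      proof (rule eventually_ball_finite[OF G(1)], rule ballI)
        fix i assume "i \<in> G"
        then have "\<forall>\<^sub>F n in sequentially. x (r n) i \<in> pm_carrier X \<and> pm_dist X (x (r n) i) (l i) < \<rho> / 2"
          using l[OF G(2), of i] half_gt_zero[OF \<rho>] unfolding limitin_metric by blast
        then show "\<forall>\<^sub>F n in sequentially. pm_dist X (x (r n) i) (l i) < \<rho> / 2"
          by eventually_elim simp
      qed
      moreover have "\<forall>\<^sub>F n in sequentially. \<epsilon> (r n) < \<rho> / 2"
        using \<epsilon>r \<rho> by (intro order_tendstoD) auto
      ultimately have ev: "\<forall>\<^sub>F n in sequentially. sum (\<alpha> (r n)) G - \<epsilon> (r n) \<le> measure (pm_measure X) (B k)"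
      proof eventually_elim
        case (elim n)
        show ?case
        proof (rule key[OF G(1) B_sets])
          fix i t assume it: "i \<in> G" "t \<in> K (r n) i"
          have at: "a (r n) t \<in> pm_carrier X" using it a_carr by (simp add: K_def)
          have "pm_dist X (l i) (a (r n) t) \<le> pm_dist X (l i) (x (r n) i) + pm_dist X (x (r n) i) (a (r n) t)"
            by (rule triangle[OF l_carr[OF G(2)[OF it(1)]] x_carr at])
          moreover have "pm_dist X (l i) (x (r n) i) = pm_dist X (x (r n) i) (l i)" by (rule commute)
          ultimately have "pm_dist X (l i) (a (r n) t) \<le> \<rho>"
            using elim(1)[rule_format, OF it(1)] elim(2) x_close[OF it(2)] by linarith
          moreover have "F i = l i" using G(2)[OF it(1)] by (simp add: F_def)
          ultimately show "a (r n) t \<in> B k" using it(1) at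
            by (auto simp: B_def \<rho>_def intro!: bexI[of _ i])
        qed
      qed
      have "(\<lambda>n. sum (\<alpha> (r n)) G - \<epsilon> (r n)) \<longlonglongrightarrow> sum \<beta> G - 0"
        by (intro tendsto_diff tendsto_sum \<alpha>r \<epsilon>r)
      then show ?thesis
        using tendsto_upperbound[OF _ ev sequentially_bot] by simp
    qed
    have "decseq B"
      unfolding decseq_def B_def
    proof (intro allI impI UN_mono order_refl subsetI)
      fix k k' :: nat and z y assume "k \<le> k'" "y \<in> {y \<in> pm_carrier X. pm_dist X z y \<le> 1 / real (Suc k')}"
      moreover from this have "1 / real (Suc k') \<le> 1 / real (Suc k)" by (simp add: frac_le)
      ultimately show "y \<in> {y \<in> pm_carrier X. pm_dist X z y \<le> 1 / real (Suc k)}" by auto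
    qed
    then have "(\<lambda>k. measure (pm_measure X) (B k)) \<longlonglongrightarrow> measure (pm_measure X) (\<Inter>k. B k)"
      using B_sets by (intro \<mu>.finite_Lim_measure_decseq) auto
    moreover have "(\<Inter>k. B k) = F ` G"
      unfolding B_def using G(1) F_carr by (intro finite_Inter_neighbourhoods[OF Metric_space_axioms]) auto
    ultimately have "(\<lambda>k. measure (pm_measure X) (B k)) \<longlonglongrightarrow> measure (pm_measure X) (F ` G)" by simp
    then show ?thesis
      by (rule LIMSEQ_le_const) (use B_ge in blast)
  qed

  have "has_atoms (pm_measure X) \<beta> F"
    unfolding has_atoms_def
  proof
    fix A assume A: "A \<in> sets (pm_measure X)"
    show "(\<Sum>i. ennreal (\<beta> i) * indicator A (F i)) \<le> emeasure (pm_measure X) A"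
      unfolding suminf_eq_SUP
    proof (rule SUP_least)
      fix n
      \<comment> \<open>A series of nonnegative terms is controlled by its partial sums, and in a
        partial sum only these indices contribute.\<close>
      define G where "G = {i \<in> {..<n}. 0 < \<beta> i \<and> F i \<in> A}"
      have G: "finite G" "\<And>i. i \<in> G \<Longrightarrow> 0 < \<beta> i" by (auto simp: G_def)
      have "(\<Sum>i<n. ennreal (\<beta> i) * indicator A (F i)) = (\<Sum>i\<in>G. ennreal (\<beta> i))"
      proof (rule sum.mono_neutral_cong_right)
        show "\<forall>i\<in>{..<n} - G. ennreal (\<beta> i) * indicator A (F i) = 0"
          using V_D(1)[OF \<beta>] by (auto simp: G_def indicator_def ennreal_eq_0_iff not_less)
      qed (auto simp: G_def)
      also have "\<dots> = ennreal (sum \<beta> G)"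
        by (rule sum_ennreal) (rule V_D(1)[OF \<beta>])
      also have "\<dots> \<le> ennreal (measure (pm_measure X) (F ` G))"
        by (rule ennreal_leI[OF mass[OF G]])
      also have "\<dots> = emeasure (pm_measure X) (F ` G)"
        by (rule \<mu>.emeasure_eq_measure[symmetric])
      also have "\<dots> \<le> emeasure (pm_measure X) A"
        by (rule emeasure_mono) (use A in \<open>auto simp: G_def\<close>)
      finally show "(\<Sum>i<n. ennreal (\<beta> i) * indicator A (F i)) \<le> emeasure (pm_measure X) A" .
    qed
  qed
  then show ?thesis
    unfolding atoms_diam_pyramid_iff atoms_pyramid_iff using C F_carr diam by (auto simp: X_def)
qed

section \<open>Pyramids\<close>

lemma curve_rep_D:
  assumes "curve_rep m g C S h g'"
  shows "C \<in> pm_classes" "S \<subseteq> mspace m" "h ` S = pm_carrier (pm_rep C)"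
    "\<And>x y. x \<in> S \<Longrightarrow> y \<in> S \<Longrightarrow> pm_dist (pm_rep C) (h x) (h y) = mdist m x y"
    "S \<in> sets (borel_of_metric m)" "emeasure lborel (g -` S \<inter> {0..1}) = 1"
    "g -` S \<inter> {0..1} \<in> sets borel" "pm_parameter (pm_rep C) g'"
    "\<And>t. t \<in> {0..1} \<Longrightarrow> g t \<in> S \<Longrightarrow> g' t = h (g t)"
  using assms unfolding curve_rep_def by blast+

lemma curve_rep_inj:
  assumes "curve_rep m g C S h g'"
  shows "inj_on h S"
proof (rule inj_onI)
  note r = curve_rep_D[OF assms]
  fix x y assume xy: "x \<in> S" "y \<in> S" "h x = h y"
  interpret M: Metric_space "mspace m" "mdist m" by simp
  interpret R: Metric_space "pm_carrier (pm_rep C)" "pm_dist (pm_rep C)" by simp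
  have hy: "h y \<in> pm_carrier (pm_rep C)" using r(3) xy(2) by blast
  have "pm_dist (pm_rep C) (h x) (h y) = 0"
    unfolding xy(3) using R.zero[OF hy hy] by blast
  then have "mdist m x y = 0" using r(4)[OF xy(1,2)] by linarith
  then show "x = y" using M.zero[of x y] xy(1,2) r(2) by blast
qed

text \<open>A criterion on the curve and the ambient metric. The parameter \<open>g'\<close> is
  constant on items only where \<open>g\<close> is in the support, which
  \<open>has_atoms_of_parameter\<close> permits.\<close>

lemma curve_rep_in_pyramid:
  assumes rep: "curve_rep m g C S h g'" and \<alpha>: "\<alpha> \<in> V"
    and const: "\<And>i s t. s \<in> item 0 \<alpha> i \<Longrightarrow> t \<in> item 0 \<alpha> i \<Longrightarrow> g s = g t"
    and diam: "\<And>x y. x \<in> mspace m \<Longrightarrow> y \<in> mspace m \<Longrightarrow> ennreal (mdist m x y) \<le> \<delta>"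
  shows "C \<in> atoms_diam_pyramid \<alpha> \<delta>"
proof -
  note r = curve_rep_D[OF rep]
  have "g' s = g' t" if "s \<in> item 0 \<alpha> i \<inter> (g -` S \<inter> {0..1})" "t \<in> item 0 \<alpha> i \<inter> (g -` S \<inter> {0..1})" for i s t
  proof -
    have "g s = g t" using const that by blast
    moreover have "g' s = h (g s)" "g' t = h (g t)" using r(9) that by auto
    ultimately show ?thesis by simp
  qed
  then obtain f where "\<And>i. f i \<in> pm_carrier (pm_rep C)" "has_atoms (pm_measure (pm_rep C)) \<alpha> f"
    using has_atoms_of_parameter[OF pm_rep_classes(1)[OF r(1)] r(8) \<alpha> _ r(7) r(6)] by blast
  moreover have "ennreal (pm_dist (pm_rep C) x y) \<le> \<delta>"
    if "x \<in> pm_carrier (pm_rep C)" "y \<in> pm_carrier (pm_rep C)" for x y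
  proof -
    obtain u v where "u \<in> S" "v \<in> S" "x = h u" "y = h v" using \<open>x \<in> _\<close> \<open>y \<in> _\<close> r(3) by blast
    then show ?thesis using r(2,4) diam by fastforce
  qed
  ultimately show ?thesis
    unfolding atoms_diam_pyramid_iff atoms_pyramid_iff using r(1) by blast
qed

lemma emeasure_eq_on_full_set:
  assumes J: "J \<subseteq> {0..1}" "J \<in> sets borel" "emeasure lborel J = 1"
    and A: "A \<subseteq> {0..1}" "A \<in> sets borel" and B: "B \<subseteq> {0..1}" "B \<in> sets borel"
    and eq: "A \<inter> J = B \<inter> J"
  shows "emeasure lborel A = emeasure lborel (B :: real set)"
proof -
  note null = null_sets_compl_full[OF J]
  have "emeasure lborel A = emeasure lborel (A - ({0..1} - J))"
    using emeasure_Diff_null_set[OF null, of A] A by simp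
  also have "A - ({0..1} - J) = B - ({0..1} - J)" using A(1) B(1) eq by blast
  also have "emeasure lborel \<dots> = emeasure lborel B"
    using emeasure_Diff_null_set[OF null, of B] B by simp
  finally show ?thesis .
qed

lemma Lipschitz_measurable:
  assumes X: "pm_space X" and Y: "pm_space Y" and \<phi>: "\<phi> \<in> pm_carrier X \<rightarrow> pm_carrier Y"
    and lip: "\<And>x y. x \<in> pm_carrier X \<Longrightarrow> y \<in> pm_carrier X \<Longrightarrow> pm_dist Y (\<phi> x) (\<phi> y) \<le> pm_dist X x y"
  shows "\<phi> \<in> pm_measure X \<rightarrow>\<^sub>M pm_measure Y"
proof -
  have "Lipschitz_continuous_map (fst X) (fst Y) \<phi>"
    unfolding Lipschitz_continuous_map_def using \<phi> lip by (intro conjI exI[of _ 1]) auto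
  then have "\<phi> \<in> borel_of_metric (fst X) \<rightarrow>\<^sub>M borel_of_metric (fst Y)"
    by (intro measurable_continuous_map Lipschitz_continuous_imp_continuous_map)
  then show ?thesis
    using measurable_cong_sets[OF pm_space_D(3)[OF X] pm_space_D(3)[OF Y]] by simp
qed

text \<open>Composing \<psi> with the inverse of the isometry \<open>h\<close> gives a 1-Lipschitz
  map on the representative. It has the right image measure because both laws are read from the same
  times: along the curve \<psi> reproduces the parameter \<open>a\<close>, up to a null set.\<close>

lemma lip_le_curve_rep:
  assumes rep: "curve_rep m g E S h g'" and C: "C \<in> pm_classes" and a: "pm_parameter (pm_rep C) a"
    and \<psi>: "\<psi> \<in> mspace m \<rightarrow> pm_carrier (pm_rep C)"
    and lip: "\<And>x y. x \<in> mspace m \<Longrightarrow> y \<in> mspace m \<Longrightarrow> pm_dist (pm_rep C) (\<psi> x) (\<psi> y) \<le> mdist m x y"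
    and \<psi>g: "\<And>t. t \<in> {0..1} \<Longrightarrow> \<psi> (g t) = a t"
  shows "lip_le C E"
proof -
  note r = curve_rep_D[OF rep]
  define X where "X = pm_rep C"
  define R where "R = pm_rep E"
  have X: "pm_space X" and R: "pm_space R"
    using pm_rep_classes[OF C] pm_rep_classes[OF r(1)] by (auto simp: X_def R_def)
  define k where "k = inv_into S h"
  have k: "k x \<in> S" "h (k x) = x" if "x \<in> pm_carrier R" for x
    using that r(3) unfolding k_def R_def by (metis inv_into_into, metis f_inv_into_f)
  have kh: "k (h u) = u" if "u \<in> S" for u
    unfolding k_def by (rule inv_into_f_f[OF curve_rep_inj[OF rep] that])
  define \<phi> where "\<phi> = \<psi> \<circ> k"
  have \<phi>: "\<phi> \<in> pm_carrier R \<rightarrow> pm_carrier X"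
    using k(1) r(2) \<psi> by (fastforce simp: \<phi>_def X_def)
  have \<phi>_lip: "pm_dist X (\<phi> x) (\<phi> y) \<le> pm_dist R x y" if "x \<in> pm_carrier R" "y \<in> pm_carrier R" for x y
  proof -
    have "pm_dist R x y = pm_dist R (h (k x)) (h (k y))" using k that by simp
    also have "\<dots> = mdist m (k x) (k y)" unfolding R_def by (rule r(4)) (use k that in auto)
    finally show ?thesis
      using lip[of "k x" "k y"] k(1)[OF that(1)] k(1)[OF that(2)] r(2) by (auto simp: \<phi>_def X_def)
  qed
  have \<phi>_meas: "\<phi> \<in> pm_measure R \<rightarrow>\<^sub>M pm_measure X"
    by (rule Lipschitz_measurable[OF R X \<phi> \<phi>_lip])
  have "distr (pm_measure R) (pm_measure X) \<phi> = pm_measure X"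
  proof (rule measure_eqI)
    fix A assume "A \<in> sets (distr (pm_measure R) (pm_measure X) \<phi>)"
    then have A: "A \<in> sets (pm_measure X)" by simp
    define B where "B = \<phi> -` A \<inter> pm_carrier R"
    have B: "B \<in> sets (pm_measure R)"
      unfolding B_def using measurable_sets[OF \<phi>_meas A] pm_space_space[OF R] by simp
    have g': "pm_parameter R g'" using r(8) by (simp add: R_def)
    have a': "pm_parameter X a" using a by (simp add: X_def)
    have "emeasure (distr (pm_measure R) (pm_measure X) \<phi>) A = emeasure (pm_measure R) B"
      using emeasure_distr[OF \<phi>_meas A] pm_space_space[OF R] by (simp add: B_def)
    also have "\<dots> = emeasure lborel (g' -` B \<inter> {0..1})"
      by (rule emeasure_parameter(1)[OF g' B])
    also have "\<dots> = emeasure lborel (a -` A \<inter> {0..1})"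
    proof (rule emeasure_eq_on_full_set[OF _ r(7) r(6)])
      show "g' -` B \<inter> {0..1} \<in> sets borel" by (rule emeasure_parameter(2)[OF g' B])
      show "a -` A \<inter> {0..1} \<in> sets borel" by (rule emeasure_parameter(2)[OF a' A])
      have "g' t \<in> B \<longleftrightarrow> a t \<in> A" if t: "t \<in> {0..1}" "g t \<in> S" for t
      proof -
        have "g' t = h (g t)" by (rule r(9)[OF t])
        then have "\<phi> (g' t) = a t" "g' t \<in> pm_carrier R"
          using kh[OF t(2)] \<psi>g[OF t(1)] r(3) t(2) by (auto simp: \<phi>_def R_def)
        then show ?thesis by (simp add: B_def)
      qed
      then show "g' -` B \<inter> {0..1} \<inter> (g -` S \<inter> {0..1}) = a -` A \<inter> {0..1} \<inter> (g -` S \<inter> {0..1})" by blast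
    qed auto
    also have "\<dots> = emeasure (pm_measure X) A"
      by (rule emeasure_parameter(1)[OF a' A, symmetric])
    finally show "emeasure (distr (pm_measure R) (pm_measure X) \<phi>) A = emeasure (pm_measure X) A" .
  qed simp
  then show ?thesis
    unfolding lip_le_def Let_def X_def[symmetric] R_def[symmetric] using \<phi> \<phi>_lip by blast
qed

text \<open>
  The library's Euclidean product metric would not preserve the bound \<open>\<delta>\<close> on the diameter; the maximum
  metric does.
\<close>

definition evens :: "(nat \<Rightarrow> real) \<Rightarrow> nat \<Rightarrow> real" where "evens z = (\<lambda>n. z (2 * n))"

definition odds :: "(nat \<Rightarrow> real) \<Rightarrow> nat \<Rightarrow> real" where "odds z = (\<lambda>n. z (Suc (2 * n)))"

text \<open>A pair of sequences coded as one, because the product of two carriers must again be a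
  set of sequences.\<close>

definition interleave :: "(nat \<Rightarrow> real) \<Rightarrow> (nat \<Rightarrow> real) \<Rightarrow> nat \<Rightarrow> real"
  where "interleave u v = (\<lambda>n. if even n then u (n div 2) else v (n div 2))"

lemma evens_interleave [simp]: "evens (interleave u v) = u"
  by (simp add: evens_def interleave_def)

lemma odds_interleave [simp]: "odds (interleave u v) = v"
  by (simp add: odds_def interleave_def)

lemma interleave_evens_odds [simp]: "interleave (evens z) (odds z) = z"
  by (auto simp: evens_def odds_def interleave_def fun_eq_iff odd_two_times_div_two_succ)

definition max_metric :: "(nat \<Rightarrow> real) metric \<Rightarrow> (nat \<Rightarrow> real) metric \<Rightarrow> (nat \<Rightarrow> real) metric"
  where "max_metric m1 m2 = metric ({z. evens z \<in> mspace m1 \<and> odds z \<in> mspace m2},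
    \<lambda>z z'. max (mdist m1 (evens z) (evens z')) (mdist m2 (odds z) (odds z')))"

section \<open>The maximum metric on coded pairs\<close>

lemma Metric_space_max:
  "Metric_space {z. evens z \<in> mspace m1 \<and> odds z \<in> mspace m2}
    (\<lambda>z z'. max (mdist m1 (evens z) (evens z')) (mdist m2 (odds z) (odds z')))"
proof -
  interpret M1: Metric_space "mspace m1" "mdist m1" by simp
  interpret M2: Metric_space "mspace m2" "mdist m2" by simp
  show ?thesis
  proof
    fix x y :: "nat \<Rightarrow> real"
    show "0 \<le> max (mdist m1 (evens x) (evens y)) (mdist m2 (odds x) (odds y))"
      by (simp add: le_max_iff_disj)
    show "max (mdist m1 (evens x) (evens y)) (mdist m2 (odds x) (odds y)) =
        max (mdist m1 (evens y) (evens x)) (mdist m2 (odds y) (odds x))"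
      using M1.commute M2.commute by metis
  next
    fix x y
    assume xy: "x \<in> {z. evens z \<in> mspace m1 \<and> odds z \<in> mspace m2}" "y \<in> {z. evens z \<in> mspace m1 \<and> odds z \<in> mspace m2}"
    show "(max (mdist m1 (evens x) (evens y)) (mdist m2 (odds x) (odds y)) = 0) = (x = y)"
    proof
      assume "max (mdist m1 (evens x) (evens y)) (mdist m2 (odds x) (odds y)) = 0"
      then have "mdist m1 (evens x) (evens y) = 0" "mdist m2 (odds x) (odds y) = 0"
        using M1.nonneg[of "evens x" "evens y"] M2.nonneg[of "odds x" "odds y"] by linarith+
      then have "evens x = evens y" "odds x = odds y" using xy M1.zero M2.zero by blast+
      then show "x = y" by (metis interleave_evens_odds)
    qed (use xy in simp)
    fix z assume z: "z \<in> {z. evens z \<in> mspace m1 \<and> odds z \<in> mspace m2}"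
    have "mdist m1 (evens x) (evens z) \<le> mdist m1 (evens x) (evens y) + mdist m1 (evens y) (evens z)"
      "mdist m2 (odds x) (odds z) \<le> mdist m2 (odds x) (odds y) + mdist m2 (odds y) (odds z)"
      using xy z by (auto intro!: M1.triangle M2.triangle)
    then show "max (mdist m1 (evens x) (evens z)) (mdist m2 (odds x) (odds z))
       \<le> max (mdist m1 (evens x) (evens y)) (mdist m2 (odds x) (odds y)) +
         max (mdist m1 (evens y) (evens z)) (mdist m2 (odds y) (odds z))"
      by linarith
  qed
qed

lemma mspace_max_metric: "mspace (max_metric m1 m2) = {z. evens z \<in> mspace m1 \<and> odds z \<in> mspace m2}"
  unfolding max_metric_def by (rule Metric_space.mspace_metric[OF Metric_space_max])

lemma mdist_max_metric:
  "mdist (max_metric m1 m2) z z' = max (mdist m1 (evens z) (evens z')) (mdist m2 (odds z) (odds z'))"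
  unfolding max_metric_def by (subst Metric_space.mdist_metric[OF Metric_space_max]) (rule refl)

lemma mcomplete_max_metric:
  assumes "mcomplete_of m1" "mcomplete_of m2"
  shows "mcomplete_of (max_metric m1 m2)"
proof -
  interpret M1: Metric_space "mspace m1" "mdist m1" by simp
  interpret M2: Metric_space "mspace m2" "mdist m2" by simp
  interpret M: Metric_space "mspace (max_metric m1 m2)" "mdist (max_metric m1 m2)" by simp
  show ?thesis
    unfolding mcomplete_of_def M.mcomplete_def
  proof (intro allI impI)
    fix \<sigma> assume \<sigma>: "M.MCauchy \<sigma>"
    have "range \<sigma> \<subseteq> mspace (max_metric m1 m2)" using \<sigma> unfolding M.MCauchy_def by blast
    then have ran: "evens (\<sigma> n) \<in> mspace m1" "odds (\<sigma> n) \<in> mspace m2" for n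
      unfolding mspace_max_metric by auto
    have cauchy: "\<exists>N. \<forall>n n'. N \<le> n \<longrightarrow> N \<le> n' \<longrightarrow>
        mdist m1 (evens (\<sigma> n)) (evens (\<sigma> n')) < e \<and> mdist m2 (odds (\<sigma> n)) (odds (\<sigma> n')) < e"
      if "0 < e" for e
      using \<sigma> that unfolding M.MCauchy_def mdist_max_metric max_less_iff_conj by blast
    have "M1.MCauchy (\<lambda>n. evens (\<sigma> n))" "M2.MCauchy (\<lambda>n. odds (\<sigma> n))"
      unfolding M1.MCauchy_def M2.MCauchy_def using ran cauchy by (blast, blast)
    then obtain u v where u: "limitin M1.mtopology (\<lambda>n. evens (\<sigma> n)) u sequentially"
      and v: "limitin M2.mtopology (\<lambda>n. odds (\<sigma> n)) v sequentially"
      using assms unfolding mcomplete_of_def M1.mcomplete_def M2.mcomplete_def by blast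
    have "limitin M.mtopology \<sigma> (interleave u v) sequentially"
      unfolding M.limitin_metric
    proof (intro conjI allI impI)
      show "interleave u v \<in> mspace (max_metric m1 m2)"
        using M1.limitin_mspace[OF u] M2.limitin_mspace[OF v] by (simp add: mspace_max_metric)
      fix e :: real assume "0 < e"
      then have "\<forall>\<^sub>F n in sequentially. evens (\<sigma> n) \<in> mspace m1 \<and> mdist m1 (evens (\<sigma> n)) u < e"
        "\<forall>\<^sub>F n in sequentially. odds (\<sigma> n) \<in> mspace m2 \<and> mdist m2 (odds (\<sigma> n)) v < e"
        using u v unfolding M1.limitin_metric M2.limitin_metric by blast+
      then show "\<forall>\<^sub>F n in sequentially. \<sigma> n \<in> mspace (max_metric m1 m2) \<and> mdist (max_metric m1 m2) (\<sigma> n) (interleave u v) < e"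
        by eventually_elim (simp add: mspace_max_metric mdist_max_metric)
    qed
    then show "\<exists>x. limitin M.mtopology \<sigma> x sequentially" by blast
  qed
qed

lemma dense_seq_max_metric:
  assumes p: "dense_seq m1 p" and q: "dense_seq m2 q"
  shows "dense_seq (max_metric m1 m2) (\<lambda>n. interleave (p (fst (prod_decode n))) (q (snd (prod_decode n))))"
  unfolding dense_seq_def mspace_max_metric mdist_max_metric
proof (intro conjI ballI allI impI)
  fix x and r :: real assume x: "x \<in> {z. evens z \<in> mspace m1 \<and> odds z \<in> mspace m2}" and "0 < r"
  obtain i where i: "mdist m1 (p i) (evens x) < r"
    using p x \<open>0 < r\<close> unfolding dense_seq_def by blast
  obtain j where j: "mdist m2 (q j) (odds x) < r"
    using q x \<open>0 < r\<close> unfolding dense_seq_def by blast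
  show "\<exists>n. max (mdist m1 (evens (interleave (p (fst (prod_decode n))) (q (snd (prod_decode n))))) (evens x))
            (mdist m2 (odds (interleave (p (fst (prod_decode n))) (q (snd (prod_decode n))))) (odds x)) < r"
    using i j by (intro exI[of _ "prod_encode (i, j)"]) simp
qed (use p q in \<open>auto simp: dense_seq_def\<close>)

text \<open>A ball of the maximum metric is a product of two balls, so its preimage is an
  intersection of two preimages of balls.\<close>

lemma measurable_interleave:
  assumes p: "dense_seq m1 p" and q: "dense_seq m2 q"
    and a: "a \<in> N \<rightarrow>\<^sub>M borel_of_metric m1" and b: "b \<in> N \<rightarrow>\<^sub>M borel_of_metric m2"
  shows "(\<lambda>t. interleave (a t) (b t)) \<in> N \<rightarrow>\<^sub>M borel_of_metric (max_metric m1 m2)"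
proof (rule measurable_dense_ballI[OF dense_seq_max_metric[OF p q]])
  have ab: "a t \<in> mspace m1" "b t \<in> mspace m2" if "t \<in> space N" for t
    using measurable_space[OF a that] measurable_space[OF b that] by simp_all
  then show "(\<lambda>t. interleave (a t) (b t)) \<in> space N \<rightarrow> mspace (max_metric m1 m2)"
    by (simp add: mspace_max_metric)
  fix n and r :: real
  define i where "i = fst (prod_decode n)"
  define j where "j = snd (prod_decode n)"
  have "p i \<in> mspace m1" "q j \<in> mspace m2" using p q by (auto simp: dense_seq_def)
  then have "a -` {x \<in> mspace m1. mdist m1 (p i) x < r} \<inter> space N \<in> sets N"
    "b -` {x \<in> mspace m2. mdist m2 (q j) x < r} \<inter> space N \<in> sets N"
    using measurable_sets[OF a mball_borel_of_metric] measurable_sets[OF b mball_borel_of_metric] by blast+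
  then have "(a -` {x \<in> mspace m1. mdist m1 (p i) x < r} \<inter> space N) \<inter>
      (b -` {x \<in> mspace m2. mdist m2 (q j) x < r} \<inter> space N) \<in> sets N"
    by (rule sets.Int)
  also have "(a -` {x \<in> mspace m1. mdist m1 (p i) x < r} \<inter> space N) \<inter>
      (b -` {x \<in> mspace m2. mdist m2 (q j) x < r} \<inter> space N) =
    {t \<in> space N. mdist (max_metric m1 m2) (interleave (p i) (q j)) (interleave (a t) (b t)) < r}"
    using ab by (auto simp: mdist_max_metric)
  finally show "{t \<in> space N. mdist (max_metric m1 m2)
      (interleave (p (fst (prod_decode n))) (q (snd (prod_decode n)))) (interleave (a t) (b t)) < r} \<in> sets N"
    by (simp add: i_def j_def)
qed

text \<open>The upper bound carries a coupling that pairs the \<open>i\<close>-th atoms with each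
  other: both spaces are parametrized by the items of \<alpha>, so the joint curve is constant on
  each item. The product measure would in general break the atoms into smaller ones.\<close>

lemma atoms_diam_pyramid_directed:
  assumes \<alpha>: "\<alpha> \<in> V" and C: "C \<in> atoms_diam_pyramid \<alpha> \<delta>" and D: "D \<in> atoms_diam_pyramid \<alpha> \<delta>"
  shows "\<exists>E\<in>atoms_diam_pyramid \<alpha> \<delta>. lip_le C E \<and> lip_le D E"
proof -
  define X where "X = pm_rep C"
  define Y where "Y = pm_rep D"
  have cl: "C \<in> pm_classes" "D \<in> pm_classes"
    using C D by (auto simp: atoms_diam_pyramid_iff atoms_pyramid_iff)
  have X: "pm_space X" and Y: "pm_space Y"
    using pm_rep_classes cl by (auto simp: X_def Y_def)
  obtain f where f: "\<And>i. f i \<in> pm_carrier X" "has_atoms (pm_measure X) \<alpha> f"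
    using C by (auto simp: atoms_diam_pyramid_iff atoms_pyramid_iff X_def)
  obtain f' where f': "\<And>i. f' i \<in> pm_carrier Y" "has_atoms (pm_measure Y) \<alpha> f'"
    using D by (auto simp: atoms_diam_pyramid_iff atoms_pyramid_iff Y_def)
  obtain a where a: "a \<in> unit_interval_measure \<rightarrow>\<^sub>M pm_measure X"
      "distr unit_interval_measure (pm_measure X) a = pm_measure X" "\<And>i t. t \<in> item 0 \<alpha> i \<Longrightarrow> a t = f i"
    using item_parameter[OF pm_space_D[OF X] \<alpha> f] by metis
  obtain b where b: "b \<in> unit_interval_measure \<rightarrow>\<^sub>M pm_measure Y"
      "distr unit_interval_measure (pm_measure Y) b = pm_measure Y" "\<And>i t. t \<in> item 0 \<alpha> i \<Longrightarrow> b t = f' i"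
    using item_parameter[OF pm_space_D[OF Y] \<alpha> f'] by metis
  have ab: "pm_parameter X a" "pm_parameter Y b" using a b by (auto simp: pm_parameter_def)
  have am: "a \<in> unit_interval_measure \<rightarrow>\<^sub>M borel_of_metric (fst X)"
    using a(1) unfolding measurable_cong_sets[OF refl pm_space_D(3)[OF X]] .
  have bm: "b \<in> unit_interval_measure \<rightarrow>\<^sub>M borel_of_metric (fst Y)"
    using b(1) unfolding measurable_cong_sets[OF refl pm_space_D(3)[OF Y]] .
  obtain p where p: "dense_seq (fst X) p"
    using separable_imp_dense_seq[OF pm_space_D(2)[OF X] pm_space_nonempty[OF X]] by blast
  obtain q where q: "dense_seq (fst Y) q"
    using separable_imp_dense_seq[OF pm_space_D(2)[OF Y] pm_space_nonempty[OF Y]] by blast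
  define m where "m = max_metric (fst X) (fst Y)"
  define g where "g = (\<lambda>t. interleave (a t) (b t))"
  have m: "mcomplete_of m" "separable_space (mtopology_of m)"
    unfolding m_def using mcomplete_max_metric[OF pm_space_D(1)[OF X] pm_space_D(1)[OF Y]]
      dense_seq_imp_separable[OF dense_seq_max_metric[OF p q]] by auto
  have g: "g \<in> unit_interval_measure \<rightarrow>\<^sub>M borel_of_metric m"
    unfolding g_def m_def by (rule measurable_interleave[OF p q am bm])
  obtain E S h g' where rep: "curve_rep m g E S h g'" by (rule curve_rep_exists[OF m g])
  have "E \<in> atoms_diam_pyramid \<alpha> \<delta>"
  proof (rule curve_rep_in_pyramid[OF rep \<alpha>])
    show "g s = g t" if "s \<in> item 0 \<alpha> i" "t \<in> item 0 \<alpha> i" for i s t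
      using that a(3) b(3) by (simp add: g_def)
    show "ennreal (mdist m x y) \<le> \<delta>" if "x \<in> mspace m" "y \<in> mspace m" for x y
    proof -
      have "ennreal (pm_dist X (evens x) (evens y)) \<le> \<delta>" "ennreal (pm_dist Y (odds x) (odds y)) \<le> \<delta>"
        using that C D by (auto simp: m_def mspace_max_metric atoms_diam_pyramid_iff X_def Y_def)
      then show ?thesis by (simp add: m_def mdist_max_metric max_def)
    qed
  qed
  moreover have "lip_le C E"
    by (rule lip_le_curve_rep[OF rep cl(1), where a = a and \<psi> = evens])
      (use ab in \<open>auto simp: X_def m_def mspace_max_metric mdist_max_metric g_def\<close>)
  moreover have "lip_le D E"
    by (rule lip_le_curve_rep[OF rep cl(2), where a = b and \<psi> = odds])
      (use ab in \<open>auto simp: Y_def m_def mspace_max_metric mdist_max_metric g_def\<close>)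
  ultimately show ?thesis by blast
qed

text \<open>Atoms are pushed forward by \<phi>. The image of \<phi> meets every ball of
  \<open>Y\<close>, because \<open>Y\<close> has full support, so the diameter bound passes from the
  image to all of \<open>Y\<close>.\<close>

lemma atoms_diam_pyramid_downward:
  assumes C: "C \<in> atoms_diam_pyramid \<alpha> \<delta>" and D: "D \<in> pm_classes" and le: "lip_le D C"
  shows "D \<in> atoms_diam_pyramid \<alpha> \<delta>"
proof -
  define X where "X = pm_rep C"
  define Y where "Y = pm_rep D"
  have C_cl: "C \<in> pm_classes" using C by (auto simp: atoms_diam_pyramid_iff atoms_pyramid_iff)
  have X: "pm_space X" and Y: "pm_space Y" "pm_supp Y = pm_carrier Y"
    using pm_rep_classes C_cl D by (auto simp: X_def Y_def)
  obtain \<phi> where \<phi>: "\<phi> \<in> pm_carrier X \<rightarrow> pm_carrier Y"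
    "\<And>x y. x \<in> pm_carrier X \<Longrightarrow> y \<in> pm_carrier X \<Longrightarrow> pm_dist Y (\<phi> x) (\<phi> y) \<le> pm_dist X x y"
    "distr (pm_measure X) (pm_measure Y) \<phi> = pm_measure Y"
    using le unfolding lip_le_def Let_def X_def Y_def by blast
  have meas: "\<phi> \<in> pm_measure X \<rightarrow>\<^sub>M pm_measure Y"
    by (rule Lipschitz_measurable[OF X Y(1) \<phi>(1,2)])
  have em: "emeasure (pm_measure Y) A = emeasure (pm_measure X) (\<phi> -` A \<inter> pm_carrier X)"
    and vim: "\<phi> -` A \<inter> pm_carrier X \<in> sets (pm_measure X)" if "A \<in> sets (pm_measure Y)" for A
    using emeasure_distr[OF meas that] measurable_sets[OF meas that] pm_space_space[OF X] by (simp_all add: \<phi>(3))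
  obtain f where f: "\<And>i. f i \<in> pm_carrier X" "has_atoms (pm_measure X) \<alpha> f"
    using C by (auto simp: atoms_diam_pyramid_iff atoms_pyramid_iff X_def)
  have atoms: "has_atoms (pm_measure Y) \<alpha> (\<lambda>i. \<phi> (f i))"
    unfolding has_atoms_def
  proof
    fix A assume A: "A \<in> sets (pm_measure Y)"
    have "(\<Sum>i. ennreal (\<alpha> i) * indicator A (\<phi> (f i))) = (\<Sum>i. ennreal (\<alpha> i) * indicator (\<phi> -` A \<inter> pm_carrier X) (f i))"
      using f(1) by (intro suminf_cong) (simp add: indicator_def)
    also have "\<dots> \<le> emeasure (pm_measure X) (\<phi> -` A \<inter> pm_carrier X)"
      using f(2) vim[OF A] by (simp add: has_atoms_def)
    finally show "(\<Sum>i. ennreal (\<alpha> i) * indicator A (\<phi> (f i))) \<le> emeasure (pm_measure Y) A"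
      by (simp add: em[OF A])
  qed
  have carr: "\<phi> (f i) \<in> pm_carrier Y" for i using f(1) \<phi>(1) by blast
  have diam: "ennreal (pm_dist Y y y') \<le> \<delta>" if yy: "y \<in> pm_carrier Y" "y' \<in> pm_carrier Y" for y y'
  proof (rule ccontr)
    interpret Metric_space "pm_carrier Y" "pm_dist Y" by simp
    assume "\<not> ennreal (pm_dist Y y y') \<le> \<delta>"
    then obtain c where c: "\<delta> < c" "c < ennreal (pm_dist Y y y')"
      by (meson dense not_less)
    then obtain q where q: "c = ennreal q" "0 \<le> q" by (cases c) auto
    have qd: "q < pm_dist Y y y'" using c(2) q by (simp add: ennreal_less_iff)
    \<comment> \<open>Half of the gap is allowed for replacing each of \<open>y\<close> and
      \<open>y'\<close> by a point of the image.\<close>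
    define r where "r = (pm_dist Y y y' - q) / 2"
    have r: "0 < r" using qd by (simp add: r_def)
    have meet: "\<exists>x\<in>pm_carrier X. pm_dist Y z (\<phi> x) < r" if z: "z \<in> pm_carrier Y" for z
    proof (rule ccontr)
      assume none: "\<not> ?thesis"
      have op: "openin (mtopology_of (fst Y)) (mball z r)" by (simp add: mtopology_of_def)
      then have bs: "mball z r \<in> sets (pm_measure Y)"
        using openin_borel_of_metric pm_space_D(3)[OF Y(1)] by blast
      have "z \<in> pm_supp Y" using z Y(2) by simp
      then have "0 < emeasure (pm_measure Y) (mball z r)"
        unfolding pm_supp_def using op z r by simp
      moreover have "\<phi> -` mball z r \<inter> pm_carrier X = {}" using none by auto
      ultimately show False using em[OF bs] by simp
    qed
    obtain x where x: "x \<in> pm_carrier X" "pm_dist Y y (\<phi> x) < r" using meet[OF yy(1)] by blast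
    obtain x' where x': "x' \<in> pm_carrier X" "pm_dist Y y' (\<phi> x') < r" using meet[OF yy(2)] by blast
    have \<phi>x: "\<phi> x \<in> pm_carrier Y" "\<phi> x' \<in> pm_carrier Y" using \<phi>(1) x x' by auto
    have "pm_dist Y y y' \<le> pm_dist Y y (\<phi> x) + pm_dist Y (\<phi> x) (\<phi> x') + pm_dist Y (\<phi> x') y'"
      using triangle[OF yy(1) \<phi>x(1) yy(2)] triangle[OF \<phi>x yy(2)] by linarith
    moreover have "pm_dist Y (\<phi> x') y' = pm_dist Y y' (\<phi> x')" by (rule commute)
    ultimately have "q \<le> pm_dist X x x'"
      using \<phi>(2)[OF x(1) x'(1)] x(2) x'(2) by (simp add: r_def)
    then have "ennreal q \<le> ennreal (pm_dist X x x')" by (rule ennreal_leI)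
    also have "\<dots> \<le> \<delta>" using C x(1) x'(1) by (auto simp: atoms_diam_pyramid_iff X_def)
    finally show False using c(1) q by simp
  qed
  show ?thesis
    unfolding atoms_diam_pyramid_iff atoms_pyramid_iff Y_def[symmetric]
    by (intro conjI D exI[of _ "\<lambda>i. \<phi> (f i)"] allI ballI atoms carr diam)
qed

text \<open>The one-point space, as the law of a constant curve, satisfies every
  prescription.\<close>

lemma atoms_diam_pyramid_nonempty:
  assumes \<alpha>: "\<alpha> \<in> V"
  shows "atoms_diam_pyramid \<alpha> \<delta> \<noteq> {}"
proof -
  define z :: "nat \<Rightarrow> real" where "z = (\<lambda>_. 0)"
  have ms: "Metric_space {z} (\<lambda>_ _. 0)" by standard auto
  define m where "m = metric ({z}, \<lambda>_ _. 0)"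
  have m: "mspace m = {z}" "mdist m = (\<lambda>_ _. 0)"
    unfolding m_def by (rule Metric_space.mspace_metric[OF ms], rule Metric_space.mdist_metric[OF ms])
  interpret Metric_space "mspace m" "mdist m" by simp
  have "mcomplete_of m"
    unfolding mcomplete_of_def mcomplete_def
  proof (intro allI impI)
    fix \<sigma> assume "MCauchy \<sigma>"
    then have "range \<sigma> \<subseteq> mspace m" unfolding MCauchy_def by blast
    then have "\<sigma> n = z" for n unfolding m(1) by blast
    then have "limitin mtopology \<sigma> z sequentially" unfolding limitin_metric by (simp add: m)
    then show "\<exists>x. limitin mtopology \<sigma> x sequentially" by blast
  qed
  moreover have "dense_seq m (\<lambda>_. z)" by (simp add: dense_seq_def m)
  then have "separable_space (mtopology_of m)" by (rule dense_seq_imp_separable)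
  moreover have "(\<lambda>_. z) \<in> unit_interval_measure \<rightarrow>\<^sub>M borel_of_metric m" by (simp add: m)
  ultimately obtain E S h g' where rep: "curve_rep m (\<lambda>_. z) E S h g'" by (rule curve_rep_exists)
  have "E \<in> atoms_diam_pyramid \<alpha> \<delta>"
    by (rule curve_rep_in_pyramid[OF rep \<alpha>]) (simp_all add: m)
  then show ?thesis by blast
qed

lemma atoms_diam_pyramid_in_pyramids:
  assumes \<alpha>: "\<alpha> \<in> V"
  shows "atoms_diam_pyramid \<alpha> \<delta> \<in> pyramids"
proof -
  have "box_closed (atoms_diam_pyramid \<alpha> \<delta>)"
    unfolding box_closed_def
  proof (intro allI ballI impI)
    fix Cs C assume "C \<in> pm_classes" and *: "(\<forall>n. Cs n \<in> atoms_diam_pyramid \<alpha> \<delta>) \<and> box_tendsto Cs C"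
    then show "C \<in> atoms_diam_pyramid \<alpha> \<delta>"
      using pyramid_limit[of C "\<lambda>_. \<alpha>" \<alpha> "\<lambda>_. \<delta>" \<delta> Cs] \<alpha> by (simp add: box_tendsto_def)
  qed
  moreover have "atoms_diam_pyramid \<alpha> \<delta> \<subseteq> pm_classes"
    by (auto simp: atoms_diam_pyramid_iff atoms_pyramid_iff)
  ultimately show ?thesis
    unfolding pyramids_def
    using atoms_diam_pyramid_nonempty[OF \<alpha>] atoms_diam_pyramid_directed[OF \<alpha>] atoms_diam_pyramid_downward
    by blast
qed

section \<open>Approximation\<close>

text \<open>The first \<open>i + 1\<close> entries are all at least \<open>\<alpha> i\<close>, and
  their sum is at most 1.\<close>

lemma V_le_inverse:
  assumes "\<alpha> \<in> V"
  shows "\<alpha> i \<le> 1 / real (Suc i)"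
proof -
  have "(\<Sum>j<Suc i. \<alpha> i) \<le> (\<Sum>j<Suc i. \<alpha> j)"
    by (rule sum_mono) (use V_antimono[OF assms] in auto)
  then have "real (Suc i) * \<alpha> i \<le> 1"
    using V_sum_le(2)[OF assms, of "Suc i"] by simp
  then show ?thesis by (simp add: field_simps)
qed

definition mid :: "(nat \<Rightarrow> real) \<Rightarrow> nat \<Rightarrow> real"
  where "mid \<alpha> i = (\<Sum>j<i. \<alpha> j) + \<alpha> i / 2"

text \<open>
  \<open>resample a \<alpha>\<close> is constant on the items of \<open>\<alpha>\<close>, so its law has the atoms \<open>\<alpha>\<close>. Midpoints rather than
  endpoints are used since they stay inside the items when \<open>\<alpha>\<close> is perturbed.
\<close>

definition resample :: "(real \<Rightarrow> 'a) \<Rightarrow> (nat \<Rightarrow> real) \<Rightarrow> real \<Rightarrow> 'a"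
  where "resample a \<alpha> t = (if t < suminf \<alpha> then a (mid \<alpha> (THE i. t \<in> item 0 \<alpha> i)) else a t)"

section \<open>Resampling a curve on the items of a sequence\<close>

lemma resample_item:
  assumes "\<alpha> \<in> V" "t \<in> item 0 \<alpha> i"
  shows "resample a \<alpha> t = a (mid \<alpha> i)"
proof -
  have "(THE i. t \<in> item 0 \<alpha> i) = i"
    using item_V_unique[OF assms(1)] assms(2) by blast
  moreover have "t < suminf \<alpha>" using item_V_subset(1)[OF assms(1), of i] assms(2) by auto
  ultimately show ?thesis by (simp add: resample_def)
qed

lemma resample_tail: "suminf \<alpha> \<le> t \<Longrightarrow> resample a \<alpha> t = a t"
  by (simp add: resample_def)

lemma mid_bounds:
  assumes "\<alpha> \<in> V"
  shows "mid \<alpha> i \<in> {0..1}" "(\<Sum>j<i. \<alpha> j) \<le> mid \<alpha> i" "mid \<alpha> i \<le> (\<Sum>j<Suc i. \<alpha> j)"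
  using V_sum_le(2,3)[OF assms, of i] V_sum_le(2)[OF assms, of "Suc i"] V_D(1)[OF assms, of i] by (auto simp: mid_def)

text \<open>The second argument of \<open>P\<close> allows comparison with \<open>a t\<close>
  itself, so the lemma gives measurability of the resampled curve and also of the set where it is
  close to \<open>a\<close>.\<close>

lemma resample_sets:
  assumes \<alpha>: "\<alpha> \<in> V" and a: "\<And>i. {t \<in> {0..1}. P (a (mid \<alpha> i)) t} \<in> sets borel"
    and tail: "{t \<in> {0..1}. P (a t) t} \<in> sets borel"
  shows "{t \<in> {0..1}. P (resample a \<alpha> t) t} \<in> sets borel"
proof -
  have "{t \<in> {0..1}. P (resample a \<alpha> t) t} =
      (\<Union>i. item 0 \<alpha> i \<inter> {t \<in> {0..1}. P (a (mid \<alpha> i)) t}) \<union> ({suminf \<alpha>..} \<inter> {t \<in> {0..1}. P (a t) t})"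
  proof (intro set_eqI iffI)
    fix t assume t: "t \<in> {t \<in> {0..1}. P (resample a \<alpha> t) t}"
    show "t \<in> (\<Union>i. item 0 \<alpha> i \<inter> {t \<in> {0..1}. P (a (mid \<alpha> i)) t}) \<union> ({suminf \<alpha>..} \<inter> {t \<in> {0..1}. P (a t) t})"
    proof (cases "t < suminf \<alpha>")
      case True
      then have "t \<in> (\<Union>i. item 0 \<alpha> i)" unfolding UN_item_V[OF \<alpha>] using t by simp
      then obtain i where i: "t \<in> item 0 \<alpha> i" by blast
      then have "P (a (mid \<alpha> i)) t" using t by (simp add: resample_item[OF \<alpha>])
      then show ?thesis using i t by blast
    next
      case False
      then show ?thesis using t by (simp add: resample_tail)
    qed
  next
    fix t assume "t \<in> (\<Union>i. item 0 \<alpha> i \<inter> {t \<in> {0..1}. P (a (mid \<alpha> i)) t}) \<union> ({suminf \<alpha>..} \<inter> {t \<in> {0..1}. P (a t) t})"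
    then consider i where "t \<in> item 0 \<alpha> i" "t \<in> {0..1}" "P (a (mid \<alpha> i)) t"
      | "suminf \<alpha> \<le> t" "t \<in> {0..1}" "P (a t) t" by blast
    then show "t \<in> {t \<in> {0..1}. P (resample a \<alpha> t) t}"
      by cases (simp_all add: resample_item[OF \<alpha>] resample_tail)
  qed
  also have "\<dots> \<in> sets borel"
    using a tail by (intro sets.Un sets.countable_UN sets.Int) auto
  finally show ?thesis .
qed

text \<open>Inside the \<open>i\<close>-th item of \<beta>, eventually both \<open>t\<close> lies in
  the \<open>i\<close>-th item of \<open>\<alpha> n\<close> and the midpoint of that item lies in
  the \<open>i\<close>-th item of \<beta>, so the value is unchanged. Beyond all items of \<beta>,
  either \<open>t\<close> is not resampled or it lies in an item of large index; such items are
  short and continuity at \<open>t\<close> applies.\<close>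

lemma resample_tendsto:
  assumes \<alpha>: "\<And>n. \<alpha> n \<in> V" and \<beta>: "\<beta> \<in> V" and lim: "\<And>i. (\<lambda>n. \<alpha> n i) \<longlonglongrightarrow> \<beta> i"
    and t: "t \<in> {0..1}" "t \<noteq> suminf \<beta>" "\<And>i. t \<noteq> (\<Sum>j<i. \<beta> j)"
    and atoms: "\<And>i s s'. s \<in> item 0 \<beta> i \<Longrightarrow> s' \<in> item 0 \<beta> i \<Longrightarrow> a s = a s'"
    and refl: "P (a t)"
    and cont: "suminf \<beta> < t \<Longrightarrow> \<exists>\<eta>>0. \<forall>s\<in>{0..1}. \<bar>s - t\<bar> < \<eta> \<longrightarrow> P (a s)"
  shows "\<forall>\<^sub>F n in sequentially. P (resample a (\<alpha> n) t)"
proof -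
  have S_lim: "(\<lambda>n. \<Sum>j<i. \<alpha> n j) \<longlonglongrightarrow> (\<Sum>j<i. \<beta> j)" for i
    by (intro tendsto_sum lim)
  show ?thesis
  proof (cases "t < suminf \<beta>")
    case True
    then have "t \<in> (\<Union>i. item 0 \<beta> i)" unfolding UN_item_V[OF \<beta>] using t by simp
    then obtain i where i: "t \<in> item 0 \<beta> i" by blast
    have ti: "(\<Sum>j<i. \<beta> j) < t" "t < (\<Sum>j<Suc i. \<beta> j)"
      using i t(3)[of i] by (auto simp: item_def less_le)
    have mid_lim: "(\<lambda>n. mid (\<alpha> n) i) \<longlonglongrightarrow> mid \<beta> i"
      unfolding mid_def by (intro tendsto_add S_lim tendsto_divide lim tendsto_const) simp
    have mid_i: "(\<Sum>j<i. \<beta> j) < mid \<beta> i" "mid \<beta> i < (\<Sum>j<Suc i. \<beta> j)"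
      using ti by (auto simp: mid_def)
    have "\<forall>\<^sub>F n in sequentially. (\<Sum>j<i. \<alpha> n j) < t" by (rule order_tendstoD(2)[OF S_lim ti(1)])
    moreover have "\<forall>\<^sub>F n in sequentially. t < (\<Sum>j<Suc i. \<alpha> n j)" by (rule order_tendstoD(1)[OF S_lim ti(2)])
    moreover have "\<forall>\<^sub>F n in sequentially. (\<Sum>j<i. \<beta> j) < mid (\<alpha> n) i" by (rule order_tendstoD(1)[OF mid_lim mid_i(1)])
    moreover have "\<forall>\<^sub>F n in sequentially. mid (\<alpha> n) i < (\<Sum>j<Suc i. \<beta> j)" by (rule order_tendstoD(2)[OF mid_lim mid_i(2)])
    ultimately show ?thesis
    proof eventually_elim
      case (elim n)
      then have "t \<in> item 0 (\<alpha> n) i" "mid (\<alpha> n) i \<in> item 0 \<beta> i" by (auto simp: item_def)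
      then have "resample a (\<alpha> n) t = a t"
        using resample_item[OF \<alpha>] atoms[OF _ i] by metis
      then show ?case using refl by simp
    qed
  next
    case False
    then have Tt: "suminf \<beta> < t" using t(2) by simp
    obtain \<eta> where \<eta>: "0 < \<eta>" "\<And>s. s \<in> {0..1} \<Longrightarrow> \<bar>s - t\<bar> < \<eta> \<Longrightarrow> P (a s)"
      using cont[OF Tt] by blast
    \<comment> \<open>Items of index above \<open>K\<close> are shorter than \<eta>, and the first
      \<open>K + 1\<close> items of \<open>\<alpha> n\<close> eventually end before
      \<open>t\<close>.\<close>
    obtain K where K: "1 / real (Suc K) < \<eta>" using \<eta>(1) by (meson nat_approx_posE)
    have "(\<Sum>j<Suc K. \<beta> j) < t" using V_sum_le(1)[OF \<beta>, of "Suc K"] Tt by linarith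
    then have "\<forall>\<^sub>F n in sequentially. (\<Sum>j<Suc K. \<alpha> n j) < t" by (rule order_tendstoD(2)[OF S_lim])
    then show ?thesis
    proof eventually_elim
      case (elim n)
      show ?case
      proof (cases "t < suminf (\<alpha> n)")
        case True
        then have "t \<in> (\<Union>i. item 0 (\<alpha> n) i)" unfolding UN_item_V[OF \<alpha>] using t by simp
        then obtain i where i: "t \<in> item 0 (\<alpha> n) i" by blast
        then have ti: "(\<Sum>j<i. \<alpha> n j) \<le> t" "t < (\<Sum>j<Suc i. \<alpha> n j)" by (auto simp: item_def)
        have "K < i"
        proof (rule ccontr)
          assume "\<not> K < i"
          then have "(\<Sum>j<Suc i. \<alpha> n j) \<le> (\<Sum>j<Suc K. \<alpha> n j)"
            by (intro sum_lessThan_mono V_D(1)[OF \<alpha>]) simp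
          then show False using ti elim by linarith
        qed
        have "\<bar>mid (\<alpha> n) i - t\<bar> \<le> \<alpha> n i"
          using mid_bounds(2,3)[OF \<alpha>, of n i] ti by (simp add: abs_le_iff)
        also have "\<dots> \<le> 1 / real (Suc i)" by (rule V_le_inverse[OF \<alpha>])
        also have "\<dots> \<le> 1 / real (Suc K)" using \<open>K < i\<close> by (simp add: frac_le)
        finally have "\<bar>mid (\<alpha> n) i - t\<bar> < \<eta>" using K by linarith
        then show ?thesis
          using \<eta>(2)[OF mid_bounds(1)[OF \<alpha>]] by (simp add: resample_item[OF \<alpha> i])
      next
        case False
        then show ?thesis using refl by (simp add: resample_tail)
      qed
    qed
  qed
qed

text \<open>Dominated convergence for the indicator functions, the countable set \<open>N\<close>
  being null.\<close>

lemma unit_interval_prob_tendsto_1: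
  assumes B: "\<And>n. B n \<in> unit_interval.events" and N: "countable N"
    and ev: "\<And>t. t \<in> {0..1} - N \<Longrightarrow> \<forall>\<^sub>F n in sequentially. t \<in> B n"
  shows "(\<lambda>n. unit_interval.prob (B n)) \<longlonglongrightarrow> 1"
proof -
  have "N \<inter> {0..1} \<in> null_sets lborel"
    using N by (intro countable_imp_null_set_lborel) blast
  then have null: "N \<inter> {0..1} \<in> null_sets unit_interval_measure"
    by (auto simp: null_sets_def sets_unit_interval_iff emeasure_unit_interval)
  have ae: "AE t in unit_interval_measure. (\<lambda>n. indicator (B n) t :: real) \<longlonglongrightarrow> 1"
  proof (rule AE_I'[OF null], rule subsetI)
    fix t assume t: "t \<in> {t \<in> space unit_interval_measure. \<not> (\<lambda>n. indicator (B n) t :: real) \<longlonglongrightarrow> 1}"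
    show "t \<in> N \<inter> {0..1}"
    proof (rule ccontr)
      assume "t \<notin> N \<inter> {0..1}"
      then have "\<forall>\<^sub>F n in sequentially. t \<in> B n" using ev t by simp
      then have "\<forall>\<^sub>F n in sequentially. indicator (B n) t = (1 :: real)"
        by eventually_elim simp
      then have "(\<lambda>n. indicator (B n) t :: real) \<longlonglongrightarrow> 1"
        by (rule tendsto_eventually)
      then show False using t by blast
    qed
  qed
  have "(\<lambda>n. \<integral>t. indicator (B n) t \<partial>unit_interval_measure) \<longlonglongrightarrow> (\<integral>t. (1 :: real) \<partial>unit_interval_measure)"
  proof (rule integral_dominated_convergence[where w = "\<lambda>_. 1"])
    show "AE t in unit_interval_measure. (\<lambda>n. indicator (B n) t :: real) \<longlonglongrightarrow> 1" by (rule ae)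
    show "(\<lambda>t. indicator (B n) t :: real) \<in> borel_measurable unit_interval_measure" for n
      using B by simp
  qed (auto simp: indicator_def)
  moreover have "(\<integral>t. indicator (B n) t \<partial>unit_interval_measure) = unit_interval.prob (B n)" for n
  proof -
    have "B n \<inter> space unit_interval_measure = B n" using sets.sets_into_space[OF B] by blast
    then show ?thesis using B by simp
  qed
  moreover have "(\<integral>t. (1 :: real) \<partial>unit_interval_measure) = 1"
    using unit_interval.prob_space by simp
  ultimately show ?thesis by simp
qed

lemma box_dist_curve_rep_le:
  assumes rep: "curve_rep m g E S h g'" and C: "C \<in> pm_classes" and a: "pm_parameter (pm_rep C) a"
    and e: "0 < e" and I: "I \<in> unit_interval.events" "1 - e \<le> unit_interval.prob I"
    and close: "\<And>s t. s \<in> I \<Longrightarrow> t \<in> I \<Longrightarrow> \<bar>mdist m (g s) (g t) - pm_dist (pm_rep C) (a s) (a t)\<bar> \<le> e"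
  shows "box_dist E C \<le> e"
proof (rule box_dist_le[OF e])
  note r = curve_rep_D[OF rep]
  define J where "J = g -` S \<inter> {0..1}"
  have J: "J \<in> unit_interval.events" "unit_interval.prob J = 1"
    using r(6,7) by (auto simp: J_def sets_unit_interval_iff measure_def emeasure_unit_interval)
  have IJ: "I \<inter> J \<in> unit_interval.events" "1 - e \<le> unit_interval.prob (I \<inter> J)"
    using sets.Int[OF I(1) J(1)] unit_interval_prob_Int_ge[OF I(1) J(1)] I(2) J(2) by linarith+
  have "\<bar>pm_dist (pm_rep E) (g' s) (g' t) - pm_dist (pm_rep C) (a s) (a t)\<bar> \<le> e"
    if "s \<in> I \<inter> J" "t \<in> I \<inter> J" for s t
  proof -
    have st: "g s \<in> S" "g t \<in> S" "g' s = h (g s)" "g' t = h (g t)"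
      using that r(9) by (auto simp: J_def)
    then have "pm_dist (pm_rep E) (g' s) (g' t) = mdist m (g s) (g t)" using r(4) by simp
    then show ?thesis using close[of s t] that by simp
  qed
  then show "box_rel (pm_rep E) (pm_rep C) e"
    unfolding box_rel_def using r(8) a IJ by blast
qed

text \<open>The convention of \<open>capped_metric\<close>: a bound \<open>k \<le> 0\<close> means
  no cap. Since \<open>enn2real\<close> sends infinity to 0, an infinite diameter bound correctly
  leaves the metric alone, but so does the bound 0, which has to be treated separately.\<close>

definition cap :: "real \<Rightarrow> real \<Rightarrow> real"
  where "cap k x = (if k \<le> 0 then x else min k x)"

lemma cap_diff: "\<bar>cap k x - cap k y\<bar> \<le> \<bar>x - y\<bar>"
  by (auto simp: cap_def min_def)

lemma mdist_capped_metric: "mdist (capped_metric k m) x y = cap k (mdist m x y)"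
  by (simp add: capped_metric_mdist cap_def)

lemma mcomplete_of_capped_metric:
  assumes "mcomplete_of m"
  shows "mcomplete_of (capped_metric k m)"
proof -
  interpret Metric_space "mspace m" "mdist m" by simp
  have "mdist (capped_metric k m) = capped_dist k"
    by (auto simp: capped_metric_mdist capped_dist_def fun_eq_iff)
  then show ?thesis
    using mcomplete_capped_metric[of k] assms by (simp add: mcomplete_of_def)
qed

lemma borel_of_capped_metric: "borel_of_metric (capped_metric k m) = borel_of_metric m"
  by (simp add: borel_of_metric_def mtopology_capped_metric)

text \<open>For a finite bound \<open>D\<close> is the bound itself; for an infinite one most of the
  mass lies in a large ball. The strict inequality \<open>D - e < \<delta>\<close> is an open
  condition and so survives the passage to nearby bounds, for which capping then changes distances
  up to \<open>D\<close> by at most \<open>e\<close>. The alternative \<open>D = 0\<close> is there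
  because nothing lies strictly below a zero bound.\<close>

lemma bounded_up_to_small_mass:
  assumes X: "pm_space X" and a: "pm_parameter X a" and e: "0 < e"
    and diam: "\<And>x y. x \<in> pm_carrier X \<Longrightarrow> y \<in> pm_carrier X \<Longrightarrow> ennreal (pm_dist X x y) \<le> \<delta>"
  obtains D I where "0 \<le> D" "D = 0 \<or> ennreal (D - e) < \<delta>" "I \<in> unit_interval.events"
    "1 - e < unit_interval.prob I" "\<And>s t. s \<in> I \<Longrightarrow> t \<in> I \<Longrightarrow> pm_dist X (a s) (a t) \<le> D"
proof (cases "\<delta> = top")
  case False
  then obtain D where D: "\<delta> = ennreal D" "0 \<le> D" by (cases \<delta>) auto
  have "D = 0 \<or> ennreal (D - e) < \<delta>"
    using D e by (cases "0 \<le> D - e") (auto simp: ennreal_less_iff ennreal_neg)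
  moreover have "pm_dist X (a s) (a t) \<le> D" if "s \<in> {0..1}" "t \<in> {0..1}" for s t
    using diam[OF pm_parameter_carrier[OF X a that(1)] pm_parameter_carrier[OF X a that(2)]] D by simp
  moreover have "{0..1} \<in> unit_interval.events" "unit_interval.prob {0..1} = 1"
    using unit_interval.prob_space by (auto simp: sets_unit_interval_iff)
  ultimately show thesis using that[of D "{0..1}"] D e by simp
next
  case True
  interpret Metric_space "pm_carrier X" "pm_dist X" by simp
  obtain x0 where x0: "x0 \<in> pm_carrier X" using pm_space_nonempty[OF X] by blast
  define B where "B n = a -` mcball x0 (real n) \<inter> {0..1}" for n
  have "mcball x0 (real n) \<in> sets (pm_measure X)" for n
    using closedin_borel_of_metric[of "fst X" "mcball x0 (real n)"] pm_space_D(3)[OF X] by (simp add: mtopology_of_def)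
  then have B: "B n \<in> unit_interval.events" for n
    unfolding B_def by (rule measure_parameter(2)[OF a])
  have "(\<lambda>n. unit_interval.prob (B n)) \<longlonglongrightarrow> 1"
  proof (rule unit_interval_prob_tendsto_1[OF B countable_empty])
    fix t :: real assume t: "t \<in> {0..1} - {}"
    then have at: "a t \<in> pm_carrier X" using pm_parameter_carrier[OF X a] by simp
    obtain k where k: "pm_dist X x0 (a t) \<le> real k" using real_arch_simple by blast
    show "\<forall>\<^sub>F n in sequentially. t \<in> B n"
      using eventually_ge_at_top[of k]
    proof eventually_elim
      case (elim n)
      then have "pm_dist X x0 (a t) \<le> real n" using k by linarith
      then show ?case using t at x0 by (simp add: B_def)
    qed
  qed
  then have "\<forall>\<^sub>F n in sequentially. 1 - e < unit_interval.prob (B n)"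
    using e by (intro order_tendstoD) auto
  then obtain n where n: "1 - e < unit_interval.prob (B n)"
    using eventually_happens'[OF sequentially_bot] by blast
  have "pm_dist X (a s) (a t) \<le> 2 * real n" if "s \<in> B n" "t \<in> B n" for s t
  proof -
    have st: "a s \<in> pm_carrier X" "a t \<in> pm_carrier X" "pm_dist X x0 (a s) \<le> real n" "pm_dist X x0 (a t) \<le> real n"
      using that by (auto simp: B_def)
    have "pm_dist X (a s) (a t) \<le> pm_dist X (a s) x0 + pm_dist X x0 (a t)"
      by (rule triangle[OF st(1) x0 st(2)])
    moreover have "pm_dist X (a s) x0 = pm_dist X x0 (a s)" by (rule commute)
    ultimately show ?thesis using st by linarith
  qed
  then show thesis using that[of "2 * real n" "B n"] B n True by (simp add: ennreal_less_top)
qed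

lemma cap_close:
  assumes D: "D = 0 \<or> ennreal (D - e) < \<delta>" and e: "0 < e" and x: "0 \<le> x" "x \<le> D"
  shows "\<bar>cap (enn2real \<delta>) x - x\<bar> \<le> e"
proof (cases "enn2real \<delta> \<le> 0 \<or> x = 0")
  case True
  then show ?thesis using e by (auto simp: cap_def)
next
  case False
  then have pos: "0 < enn2real \<delta>" by simp
  then obtain k where k: "\<delta> = ennreal k" "0 \<le> k" by (cases \<delta>) auto
  then have k': "enn2real \<delta> = k" by simp
  have "ennreal (D - e) < ennreal k" using D False x k(1) by auto
  then have "D - e < enn2real \<delta>"
    using pos unfolding k' by (cases "0 \<le> D - e") (auto simp: ennreal_less_iff)
  then show ?thesis using pos x e by (auto simp: cap_def min_def)
qed

text \<open>The approximating space is the law of the resampled curve in the capped metric.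
  Resampling changes distances by at most \<open>e / 3\<close> at each of two times and capping by
  another \<open>e / 3\<close>; the excluded times have measure at most
  \<open>e / 2 + e / 3\<close>.\<close>

lemma pyramid_approx:
  assumes C: "C \<in> atoms_diam_pyramid \<beta> \<delta>'" and \<alpha>: "\<And>n. \<alpha> n \<in> V" and \<beta>: "\<beta> \<in> V"
    and \<alpha>_lim: "\<And>i. (\<lambda>n. \<alpha> n i) \<longlonglongrightarrow> \<beta> i" and \<delta>_lim: "\<delta> \<longlonglongrightarrow> \<delta>'" and e: "0 < e"
  shows "\<forall>\<^sub>F n in sequentially. \<exists>E\<in>atoms_diam_pyramid (\<alpha> n) (\<delta> n). box_dist E C \<le> e"
proof -
  define X where "X = pm_rep C"
  have C_cl: "C \<in> pm_classes" using C by (auto simp: atoms_diam_pyramid_iff atoms_pyramid_iff)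
  have X: "pm_space X" using pm_rep_classes[OF C_cl] by (simp add: X_def)
  have diam: "ennreal (pm_dist X x y) \<le> \<delta>'" if "x \<in> pm_carrier X" "y \<in> pm_carrier X" for x y
    using C that by (auto simp: atoms_diam_pyramid_iff X_def)
  obtain f where f: "\<And>i. f i \<in> pm_carrier X" "has_atoms (pm_measure X) \<beta> f"
    using C by (auto simp: atoms_diam_pyramid_iff atoms_pyramid_iff X_def)
  obtain a N where a_meas: "a \<in> unit_interval_measure \<rightarrow>\<^sub>M pm_measure X"
      and a_law: "distr unit_interval_measure (pm_measure X) a = pm_measure X"
      and a_item: "\<And>i t. t \<in> item 0 \<beta> i \<Longrightarrow> a t = f i" and N: "countable N"
      and a_cont: "\<And>t e. t \<in> {0..1} - N \<Longrightarrow> suminf \<beta> < t \<Longrightarrow> 0 < e \<Longrightarrow>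
        \<exists>\<eta>>0. \<forall>s\<in>{0..1}. \<bar>s - t\<bar> < \<eta> \<longrightarrow> pm_dist X (a s) (a t) < e"
    by (rule item_parameter[OF pm_space_D[OF X] \<beta> f]) (rule that, (assumption | blast)+)
  have a: "pm_parameter X a" using a_meas a_law by (simp add: pm_parameter_def)
  interpret Metric_space "pm_carrier X" "pm_dist X" by simp
  have a_carr: "a t \<in> pm_carrier X" if "t \<in> {0..1}" for t
    by (rule pm_parameter_carrier[OF X a that])
  define g where "g n = resample a (\<alpha> n)" for n
  define m where "m n = capped_metric (enn2real (\<delta> n)) (fst X)" for n
  have g_carr: "g n t \<in> pm_carrier X" if "t \<in> {0..1}" for n t
  proof (cases "t < suminf (\<alpha> n)")
    case True
    then show ?thesis
      using a_carr[OF mid_bounds(1)[OF \<alpha>]] by (simp add: g_def resample_def)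
  next
    case False
    then show ?thesis using a_carr[OF that] by (simp add: g_def resample_def)
  qed
  have a_vim: "{t \<in> {0..1}. a t \<in> A} \<in> sets borel" if "A \<in> sets (pm_measure X)" for A
  proof -
    have "a -` A \<inter> {0..1} = {t \<in> {0..1}. a t \<in> A}" by blast
    then show ?thesis using emeasure_parameter(2)[OF a that] by simp
  qed
  have g_meas: "g n \<in> unit_interval_measure \<rightarrow>\<^sub>M borel_of_metric (m n)" for n
  proof (rule measurableI)
    show "g n t \<in> space (borel_of_metric (m n))" if "t \<in> space unit_interval_measure" for t
      using g_carr that by (simp add: m_def)
    fix A assume "A \<in> sets (borel_of_metric (m n))"
    then have A: "A \<in> sets (pm_measure X)"
      using pm_space_D(3)[OF X] by (simp add: m_def borel_of_capped_metric)
    have "{t \<in> {0..1 :: real}. a (mid (\<alpha> n) i) \<in> A} \<in> sets borel" for i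
      by (cases "a (mid (\<alpha> n) i) \<in> A") simp_all
    then have "{t \<in> {0..1}. g n t \<in> A} \<in> sets borel"
      unfolding g_def
      by (rule resample_sets[OF \<alpha>, where P = "\<lambda>y t. y \<in> A", OF _ a_vim[OF A]])
    moreover have "g n -` A \<inter> space unit_interval_measure = {t \<in> {0..1}. g n t \<in> A}" by auto
    ultimately show "g n -` A \<inter> space unit_interval_measure \<in> unit_interval.events"
      by (auto simp: sets_unit_interval_iff)
  qed
  have m: "mcomplete_of (m n)" "separable_space (mtopology_of (m n))" for n
    using mcomplete_of_capped_metric[OF pm_space_D(1)[OF X]] pm_space_D(2)[OF X]
    by (simp_all add: m_def Abstract_Metric_Spaces.mtopology_capped_metric)
  have m_dist: "mdist (m n) x y = cap (enn2real (\<delta> n)) (pm_dist X x y)" for n x y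
    by (simp add: m_def mdist_capped_metric)

  define B where "B n = {t \<in> {0..1}. pm_dist X (g n t) (a t) \<le> e / 3}" for n
  have B: "B n \<in> unit_interval.events" for n
  proof -
    have cball: "{t \<in> {0..1}. pm_dist X z (a t) \<le> e / 3} \<in> sets borel" if "z \<in> pm_carrier X" for z
    proof -
      have "mcball z (e / 3) \<in> sets (pm_measure X)"
        using closedin_borel_of_metric[of "fst X" "mcball z (e / 3)"] pm_space_D(3)[OF X] by (simp add: mtopology_of_def)
      then have "{t \<in> {0..1}. a t \<in> mcball z (e / 3)} \<in> sets borel" by (rule a_vim)
      moreover have "{t \<in> {0..1}. a t \<in> mcball z (e / 3)} = {t \<in> {0..1}. pm_dist X z (a t) \<le> e / 3}"
        using that a_carr by auto
      ultimately show ?thesis by simp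
    qed
    have "{t \<in> {0..1}. pm_dist X (a t) (a t) \<le> e / 3} = {0..1}" using a_carr e by auto
    then have "B n \<in> sets borel"
      unfolding B_def g_def
      by (intro resample_sets[OF \<alpha>, where P = "\<lambda>y t. pm_dist X y (a t) \<le> e / 3"] cball a_carr mid_bounds(1)[OF \<alpha>]) simp
    then show ?thesis by (auto simp: sets_unit_interval_iff B_def)
  qed
  have "(\<lambda>n. unit_interval.prob (B n)) \<longlonglongrightarrow> 1"
  proof (rule unit_interval_prob_tendsto_1[OF B])
    show "countable (N \<union> {suminf \<beta>} \<union> range (\<lambda>i. \<Sum>j<i. \<beta> j))" using N by simp
    fix t assume t: "t \<in> {0..1} - (N \<union> {suminf \<beta>} \<union> range (\<lambda>i. \<Sum>j<i. \<beta> j))"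
    have "\<forall>\<^sub>F n in sequentially. pm_dist X (resample a (\<alpha> n) t) (a t) \<le> e / 3"
    proof (rule resample_tendsto[where P = "\<lambda>y. pm_dist X y (a t) \<le> e / 3", OF \<alpha> \<beta> \<alpha>_lim])
      show "t \<in> {0..1}" "t \<noteq> suminf \<beta>" "t \<noteq> (\<Sum>j<i. \<beta> j)" for i using t by auto
      show "a s = a s'" if "s \<in> item 0 \<beta> i" "s' \<in> item 0 \<beta> i" for i s s' using a_item that by simp
      show "pm_dist X (a t) (a t) \<le> e / 3" using t a_carr e by simp
      show "\<exists>\<eta>>0. \<forall>s\<in>{0..1}. \<bar>s - t\<bar> < \<eta> \<longrightarrow> pm_dist X (a s) (a t) \<le> e / 3" if "suminf \<beta> < t"
        using a_cont[of t "e / 3"] t that e by (auto intro: less_imp_le)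
    qed
    then show "\<forall>\<^sub>F n in sequentially. t \<in> B n"
      by eventually_elim (use t in \<open>simp add: B_def g_def\<close>)
  qed
  then have ev1: "\<forall>\<^sub>F n in sequentially. 1 - e / 2 < unit_interval.prob (B n)"
    using e by (intro order_tendstoD) auto

  obtain D I where D: "0 \<le> D" "D = 0 \<or> ennreal (D - e / 3) < \<delta>'" and I: "I \<in> unit_interval.events"
    "1 - e / 3 < unit_interval.prob I" "\<And>s t. s \<in> I \<Longrightarrow> t \<in> I \<Longrightarrow> pm_dist X (a s) (a t) \<le> D"
    using bounded_up_to_small_mass[OF X a _ diam, of "e / 3"] e by (metis divide_pos_pos zero_less_numeral)
  have I_sub: "I \<subseteq> {0..1}" using I(1) by (simp only: sets_unit_interval_iff)
  have ev2: "\<forall>\<^sub>F n in sequentially. D = 0 \<or> ennreal (D - e / 3) < \<delta> n"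
  proof (cases "D = 0")
    case False
    then have "ennreal (D - e / 3) < \<delta>'" using D by blast
    then have "\<forall>\<^sub>F n in sequentially. ennreal (D - e / 3) < \<delta> n"
      by (rule order_tendstoD(1)[OF \<delta>_lim])
    then show ?thesis by eventually_elim simp
  qed simp
  \<comment> \<open>A bound \<open>\<delta> n = 0\<close> would not cap the metric. It is eventually
    excluded unless \<delta>' = 0, and then all distances in \<open>X\<close> vanish
    already.\<close>
  have ev3: "\<forall>\<^sub>F n in sequentially. \<delta>' = 0 \<or> 0 < \<delta> n"
  proof (cases "\<delta>' = 0")
    case False
    then have "0 < \<delta>'" by (simp add: zero_less_iff_neq_zero)
    then have "\<forall>\<^sub>F n in sequentially. 0 < \<delta> n"
      by (rule order_tendstoD(1)[OF \<delta>_lim])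
    then show ?thesis by eventually_elim simp
  qed simp
  show ?thesis
    using ev1 ev2 ev3
  proof eventually_elim
    case (elim n)
    obtain E S h g' where rep: "curve_rep (m n) (g n) E S h g'"
      by (rule curve_rep_exists[OF m g_meas])
    have "E \<in> atoms_diam_pyramid (\<alpha> n) (\<delta> n)"
    proof (rule curve_rep_in_pyramid[OF rep \<alpha>])
      show "g n s = g n t" if "s \<in> item 0 (\<alpha> n) i" "t \<in> item 0 (\<alpha> n) i" for i s t
        using that by (simp add: g_def resample_item[OF \<alpha>])
      fix x y assume "x \<in> mspace (m n)" "y \<in> mspace (m n)"
      then have xy: "x \<in> pm_carrier X" "y \<in> pm_carrier X" by (auto simp: m_def)
      show "ennreal (mdist (m n) x y) \<le> \<delta> n"
      proof (cases "\<delta> n = top")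
        case False
        then obtain k where k: "\<delta> n = ennreal k" "0 \<le> k" by (cases "\<delta> n") auto
        show ?thesis
        proof (cases "k = 0")
          case True
          then have "\<delta>' = 0" using elim(3) k by simp
          then have "pm_dist X x y = 0" using diam[OF xy] nonneg[of x y] by simp
          then show ?thesis using True k by (simp add: m_dist cap_def)
        next
          case False
          then show ?thesis using k by (simp add: m_dist cap_def)
        qed
      qed simp
    qed
    moreover have "box_dist E C \<le> e"
    proof (rule box_dist_curve_rep_le[OF rep C_cl _ e])
      show "pm_parameter (pm_rep C) a" using a by (simp add: X_def)
      show "B n \<inter> I \<in> unit_interval.events" using B I(1) by (rule sets.Int)
      have "unit_interval.prob (B n) + unit_interval.prob I - 1 \<le> unit_interval.prob (B n \<inter> I)"
        by (rule unit_interval_prob_Int_ge[OF B I(1)])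
      then show "1 - e \<le> unit_interval.prob (B n \<inter> I)" using elim(1) I(2) e by linarith
      fix s t assume st: "s \<in> B n \<inter> I" "t \<in> B n \<inter> I"
      then have st01: "s \<in> {0..1}" "t \<in> {0..1}" using I_sub by auto
      note carr = g_carr[OF st01(1), of n] g_carr[OF st01(2), of n] a_carr[OF st01(1)] a_carr[OF st01(2)]
      have s: "pm_dist X (g n s) (a s) \<le> e / 3" and t: "pm_dist X (g n t) (a t) \<le> e / 3"
        using st by (auto simp: B_def)
      have "\<bar>pm_dist X (g n s) (g n t) - pm_dist X (a s) (a t)\<bar> \<le> e / 3 + e / 3"
        using triangle[OF carr(1,3,2)] triangle[OF carr(3,4,2)] triangle[OF carr(3,1,4)] triangle[OF carr(1,2,4)]
          commute[of "a s" "g n s"] commute[of "a t" "g n t"] s t by linarith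
      moreover have "\<bar>cap (enn2real (\<delta> n)) (pm_dist X (a s) (a t)) - pm_dist X (a s) (a t)\<bar> \<le> e / 3"
        by (rule cap_close[OF elim(2)]) (use e st I(3) in auto)
      ultimately have "\<bar>mdist (m n) (g n s) (g n t) - pm_dist X (a s) (a t)\<bar> \<le> e"
        unfolding m_dist using cap_diff[of "enn2real (\<delta> n)" "pm_dist X (g n s) (g n t)" "pm_dist X (a s) (a t)"]
        by linarith
      then show "\<bar>mdist (m n) (g n s) (g n t) - pm_dist (pm_rep C) (a s) (a t)\<bar> \<le> e"
        by (simp add: X_def)
    qed
    ultimately show ?case by blast
  qed
qed

section \<open>Injectivity\<close>

lemma V_eq_one_V:
  assumes "\<alpha> \<in> V" "1 \<le> \<alpha> 0"
  shows "\<alpha> = one_V"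
proof
  fix i
  have "\<alpha> 0 \<le> 1" using V_sum_le(2)[OF assms(1), of 1] by simp
  moreover have "\<alpha> 0 + \<alpha> 1 \<le> 1" using V_sum_le(2)[OF assms(1), of 2] by (simp add: numeral_2_eq_2)
  moreover have "\<alpha> i \<le> \<alpha> 1" if "i \<noteq> 0" using V_antimono[OF assms(1), of 1 i] that by simp
  ultimately show "\<alpha> i = one_V i"
    using V_D(1)[OF assms(1), of i] assms(2) by (cases "i = 0") (auto simp: one_V_def)
qed

text \<open>Induction on the largest element: it is at least the number of the other elements, so by
  monotonicity its entry is at most the next entry of the initial segment.\<close>

lemma V_sum_le_initial:
  assumes \<alpha>: "\<alpha> \<in> V" and F: "finite F"
  shows "sum \<alpha> F \<le> (\<Sum>i<card F. \<alpha> i)"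
  using F
proof (induction F rule: finite_linorder_max_induct)
  case (insert b F)
  have "F \<subseteq> {..<b}" using insert by auto
  then have "card F \<le> b" using card_mono[of "{..<b}" F] by simp
  then have "\<alpha> b \<le> \<alpha> (card F)" by (rule V_antimono[OF \<alpha>])
  moreover have "b \<notin> F" using insert by auto
  ultimately show ?case using insert by simp
qed simp

section \<open>Equilateral spaces with prescribed masses\<close>

definition const_seq :: "nat \<Rightarrow> nat \<Rightarrow> real"
  where "const_seq n = (\<lambda>_. real n)"

lemma const_seq_eq_iff [simp]: "const_seq m = const_seq n \<longleftrightarrow> m = n"
  by (auto simp: const_seq_def fun_eq_iff)

definition equilateral :: "real \<Rightarrow> (nat \<Rightarrow> real) metric"
  where "equilateral c = metric (range const_seq, \<lambda>x y. if x = y then 0 else c)"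

context
  fixes c :: real assumes c: "0 < c"
begin

lemma Metric_space_equilateral: "Metric_space (range const_seq) (\<lambda>x y. if x = y then 0 else c)"
  by standard (use c in auto)

lemma mspace_equilateral: "mspace (equilateral c) = range const_seq"
  unfolding equilateral_def by (rule Metric_space.mspace_metric[OF Metric_space_equilateral])

lemma mdist_equilateral: "mdist (equilateral c) x y = (if x = y then 0 else c)"
  unfolding equilateral_def Metric_space.mdist_metric[OF Metric_space_equilateral] by (rule refl)

lemma dense_seq_equilateral: "dense_seq (equilateral c) const_seq"
  unfolding dense_seq_def mspace_equilateral mdist_equilateral by auto

text \<open>Distances below \<open>c\<close> are zero, so Cauchy sequences are eventually
  constant.\<close>

lemma mcomplete_equilateral: "mcomplete_of (equilateral c)"
proof -
  interpret Metric_space "mspace (equilateral c)" "mdist (equilateral c)" by simp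
  show ?thesis
    unfolding mcomplete_of_def mcomplete_def
  proof (intro allI impI)
    fix \<sigma> assume \<sigma>: "MCauchy \<sigma>"
    then obtain N where N: "\<And>n n'. N \<le> n \<Longrightarrow> N \<le> n' \<Longrightarrow> mdist (equilateral c) (\<sigma> n) (\<sigma> n') < c"
      unfolding MCauchy_def using c by blast
    have const: "\<sigma> n = \<sigma> N" if "N \<le> n" for n
    proof (rule ccontr)
      assume "\<sigma> n \<noteq> \<sigma> N"
      then have "mdist (equilateral c) (\<sigma> n) (\<sigma> N) = c" by (simp only: mdist_equilateral if_False)
      then show False using N[OF that order_refl] by linarith
    qed
    have "range \<sigma> \<subseteq> mspace (equilateral c)" using \<sigma> unfolding MCauchy_def by blast
    then have ran: "\<sigma> n \<in> mspace (equilateral c)" for n by blast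
    have "limitin mtopology \<sigma> (\<sigma> N) sequentially"
      unfolding limitin_metric
    proof (intro conjI allI impI ran)
      fix e :: real assume "0 < e"
      show "\<forall>\<^sub>F n in sequentially. \<sigma> n \<in> mspace (equilateral c) \<and> mdist (equilateral c) (\<sigma> n) (\<sigma> N) < e"
        using eventually_ge_at_top[of N]
      proof eventually_elim
        case (elim n)
        have "\<sigma> n = \<sigma> N" by (rule const[OF elim])
        then have "mdist (equilateral c) (\<sigma> n) (\<sigma> N) = 0" by (simp only: mdist_equilateral refl if_True)
        then show ?case using ran \<open>0 < e\<close> by simp
      qed
    qed
    then show "\<exists>x. limitin mtopology \<sigma> x sequentially" by blast
  qed
qed

lemma measurable_equilateral:
  assumes ran: "\<And>t. t \<in> space N \<Longrightarrow> g t \<in> range const_seq"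
    and sets: "\<And>n. {t \<in> space N. g t = const_seq n} \<in> sets N"
  shows "g \<in> N \<rightarrow>\<^sub>M borel_of_metric (equilateral c)"
proof (rule measurable_dense_ballI[OF dense_seq_equilateral])
  show "g \<in> space N \<rightarrow> mspace (equilateral c)" using ran by (simp add: mspace_equilateral)
  fix n and r :: real assume "0 < r"
  show "{t \<in> space N. mdist (equilateral c) (const_seq n) (g t) < r} \<in> sets N"
  proof (cases "c < r")
    case True
    then have "{t \<in> space N. mdist (equilateral c) (const_seq n) (g t) < r} = space N"
      using \<open>0 < r\<close> by (auto simp: mdist_equilateral)
    then show ?thesis by simp
  next
    case False
    then have "{t \<in> space N. mdist (equilateral c) (const_seq n) (g t) < r} = {t \<in> space N. g t = const_seq n}"
      using \<open>0 < r\<close> by (auto simp: mdist_equilateral)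
    then show ?thesis using sets by simp
  qed
qed

end

text \<open>
  A curve whose law on the equilateral space has the atoms \<open>\<alpha> i\<close> at the points \<open>2 * i\<close>, while the
  remaining mass is split into atoms of size at most \<open>\<eta>\<close> at the odd points.
\<close>

definition spread :: "(nat \<Rightarrow> real) \<Rightarrow> real \<Rightarrow> real \<Rightarrow> nat \<Rightarrow> real"
  where "spread \<alpha> \<eta> t = const_seq (if t < suminf \<alpha> then 2 * (THE i. t \<in> item 0 \<alpha> i) else Suc (2 * nat \<lfloor>t / \<eta>\<rfloor>))"

section \<open>Masses of the points under \<open>spread\<close>\<close>

lemma spread_item:
  assumes "\<alpha> \<in> V" "t \<in> item 0 \<alpha> i"
  shows "spread \<alpha> \<eta> t = const_seq (2 * i)"
proof -
  have "(THE i. t \<in> item 0 \<alpha> i) = i"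
    using item_V_unique[OF assms(1)] assms(2) by blast
  moreover have "t < suminf \<alpha>" using item_V_subset(1)[OF assms(1), of i] assms(2) by auto
  ultimately show ?thesis by (simp add: spread_def)
qed

lemma spread_even:
  assumes \<alpha>: "\<alpha> \<in> V"
  shows "{t \<in> {0..1}. spread \<alpha> \<eta> t = const_seq (2 * i)} = item 0 \<alpha> i"
proof (intro set_eqI iffI)
  fix t assume t: "t \<in> {t \<in> {0..1}. spread \<alpha> \<eta> t = const_seq (2 * i)}"
  have "t < suminf \<alpha>"
  proof (rule ccontr)
    assume "\<not> t < suminf \<alpha>"
    then have "Suc (2 * nat \<lfloor>t / \<eta>\<rfloor>) = 2 * i" using t by (simp add: spread_def)
    then show False by (metis even_Suc dvd_triv_left)
  qed
  then have "t \<in> (\<Union>i. item 0 \<alpha> i)" unfolding UN_item_V[OF \<alpha>] using t by simp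
  then obtain k where k: "t \<in> item 0 \<alpha> k" by blast
  then have "2 * k = 2 * i" using t spread_item[OF \<alpha> k, of \<eta>] by simp
  then show "t \<in> item 0 \<alpha> i" using k by simp
next
  fix t assume t: "t \<in> item 0 \<alpha> i"
  then show "t \<in> {t \<in> {0..1}. spread \<alpha> \<eta> t = const_seq (2 * i)}"
    using spread_item[OF \<alpha> t] item_V_subset(2)[OF \<alpha>, of i] by blast
qed

lemma spread_odd:
  "{t \<in> {0..1}. spread \<alpha> \<eta> t = const_seq (Suc (2 * l))} = {t \<in> {0..1}. suminf \<alpha> \<le> t \<and> nat \<lfloor>t / \<eta>\<rfloor> = l}"
proof -
  have "2 * k \<noteq> Suc (2 * l)" for k by presburger
  then show ?thesis by (auto simp: spread_def not_less split: if_splits)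
qed

lemma spread_sets:
  assumes \<alpha>: "\<alpha> \<in> V"
  shows "{t \<in> {0..1}. spread \<alpha> \<eta> t = const_seq n} \<in> sets borel"
proof (cases "even n")
  case True
  then obtain i where "n = 2 * i" by blast
  then show ?thesis using spread_even[OF \<alpha>] by simp
next
  case False
  then obtain l where l: "n = Suc (2 * l)" using oddE by fastforce
  have "{t \<in> {0..1}. suminf \<alpha> \<le> t \<and> nat \<lfloor>t / \<eta>\<rfloor> = l} \<in> sets borel"
    by measurable
  then show ?thesis unfolding l spread_odd .
qed

lemma spread_prob:
  assumes \<alpha>: "\<alpha> \<in> V" and \<eta>: "0 < \<eta>"
  shows "unit_interval.prob {t \<in> {0..1}. spread \<alpha> \<eta> t = const_seq (2 * i)} = \<alpha> i"
    and "unit_interval.prob {t \<in> {0..1}. spread \<alpha> \<eta> t = const_seq (Suc (2 * l))} \<le> \<eta>"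
proof -
  show "unit_interval.prob {t \<in> {0..1}. spread \<alpha> \<eta> t = const_seq (2 * i)} = \<alpha> i"
  proof -
    have "measure lborel (item 0 \<alpha> i) = \<alpha> i"
      using emeasure_item[of \<alpha> i 0] V_D(1)[OF \<alpha>] by (simp add: measure_def)
    then show ?thesis
      unfolding spread_even[OF \<alpha>] measure_unit_interval[OF item_V_subset(2)[OF \<alpha>]] .
  qed
  have "{t \<in> {0..1}. suminf \<alpha> \<le> t \<and> nat \<lfloor>t / \<eta>\<rfloor> = l} \<subseteq> {real l * \<eta> .. (real l + 1) * \<eta>}"
  proof
    fix t assume t: "t \<in> {t \<in> {0..1}. suminf \<alpha> \<le> t \<and> nat \<lfloor>t / \<eta>\<rfloor> = l}"
    then have "\<lfloor>t / \<eta>\<rfloor> = int l" using \<eta> by auto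
    then have "real l \<le> t / \<eta>" "t / \<eta> < real l + 1" by (auto simp: floor_eq_iff)
    then show "t \<in> {real l * \<eta> .. (real l + 1) * \<eta>}" using \<eta> by (auto simp: field_simps)
  qed
  moreover have "{t \<in> {0..1}. suminf \<alpha> \<le> t \<and> nat \<lfloor>t / \<eta>\<rfloor> = l} \<subseteq> {0..1}" by blast
  ultimately have "unit_interval.prob {t \<in> {0..1}. suminf \<alpha> \<le> t \<and> nat \<lfloor>t / \<eta>\<rfloor> = l} \<le>
      measure lborel {real l * \<eta> .. (real l + 1) * \<eta>}"
    unfolding measure_unit_interval[OF \<open>_ \<subseteq> {0..1}\<close>]
    by (intro measure_mono_fmeasurable) (auto intro!: fmeasurable_compact)
  also have "\<dots> = \<eta>" using \<eta> by (simp add: algebra_simps)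
  finally show "unit_interval.prob {t \<in> {0..1}. spread \<alpha> \<eta> t = const_seq (Suc (2 * l))} \<le> \<eta>"
    by (simp only: spread_odd)
qed

lemma spread_curve_rep:
  assumes \<alpha>: "\<alpha> \<in> V" and c: "0 < c" "ennreal c \<le> \<delta>"
  obtains E S h g' where "curve_rep (equilateral c) (spread \<alpha> \<eta>) E S h g'" "E \<in> atoms_diam_pyramid \<alpha> \<delta>"
proof -
  have "spread \<alpha> \<eta> \<in> unit_interval_measure \<rightarrow>\<^sub>M borel_of_metric (equilateral c)"
  proof (rule measurable_equilateral[OF c(1)])
    show "spread \<alpha> \<eta> t \<in> range const_seq" for t by (simp add: spread_def)
    show "{t \<in> space unit_interval_measure. spread \<alpha> \<eta> t = const_seq n} \<in> unit_interval.events" for n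
      using spread_sets[OF \<alpha>, of \<eta> n] by (auto simp: sets_unit_interval_iff)
  qed
  then obtain E S h g' where rep: "curve_rep (equilateral c) (spread \<alpha> \<eta>) E S h g'"
    by (rule curve_rep_exists[OF mcomplete_equilateral[OF c(1)]
        dense_seq_imp_separable[OF dense_seq_equilateral[OF c(1)]]])
  have "E \<in> atoms_diam_pyramid \<alpha> \<delta>"
    by (rule curve_rep_in_pyramid[OF rep \<alpha>])
      (use c spread_item[OF \<alpha>] in \<open>auto simp: mdist_equilateral\<close>)
  then show thesis by (rule that[OF rep])
qed

lemma unit_interval_prob_finite_UN_le:
  assumes "finite F" "\<And>n. n \<in> F \<Longrightarrow> A n \<in> unit_interval.events"
  shows "unit_interval.prob (\<Union>n\<in>F. A n) \<le> (\<Sum>n\<in>F. unit_interval.prob (A n))"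
  by (rule unit_interval.finite_measure_subadditive_finite[OF assms(1)]) (use assms(2) in blast)

text \<open>Among \<open>k\<close> points the even ones have at most the \<open>k\<close> largest
  entries of \<alpha> as mass, and each odd one has mass at most \<eta>.\<close>

lemma spread_prob_finite:
  assumes \<alpha>: "\<alpha> \<in> V" and \<eta>: "0 < \<eta>" and F: "finite F" "card F \<le> k"
  shows "unit_interval.prob (\<Union>n\<in>F. {t \<in> {0..1}. spread \<alpha> \<eta> t = const_seq n}) \<le> (\<Sum>i<k. \<alpha> i) + real k * \<eta>"
proof -
  define w where "w n = unit_interval.prob {t \<in> {0..1}. spread \<alpha> \<eta> t = const_seq n}" for n
  have w_even: "w (2 * i) = \<alpha> i" and w_odd: "w (Suc (2 * i)) \<le> \<eta>" for i
    unfolding w_def by (rule spread_prob[OF \<alpha> \<eta>])+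
  have "unit_interval.prob (\<Union>n\<in>F. {t \<in> {0..1}. spread \<alpha> \<eta> t = const_seq n}) \<le> sum w F"
    unfolding w_def using spread_sets[OF \<alpha>]
    by (intro unit_interval_prob_finite_UN_le F) (auto simp: sets_unit_interval_iff)
  also have "sum w F = sum w {n \<in> F. even n} + sum w {n \<in> F. odd n}"
  proof -
    have "{n \<in> F. even n} \<union> {n \<in> F. odd n} = F" by blast
    moreover have "sum w ({n \<in> F. even n} \<union> {n \<in> F. odd n}) = sum w {n \<in> F. even n} + sum w {n \<in> F. odd n}"
      by (rule sum.union_disjoint) (use F(1) in auto)
    ultimately show ?thesis by metis
  qed
  also have "sum w {n \<in> F. even n} \<le> (\<Sum>i<k. \<alpha> i)"
  proof -
    define G where "G = (\<lambda>n. n div 2) ` {n \<in> F. even n}"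
    have "inj_on (\<lambda>n. n div 2) {n \<in> F. even n}" by (auto intro!: inj_onI elim!: evenE)
    then have "sum \<alpha> G = (\<Sum>n\<in>{n \<in> F. even n}. \<alpha> (n div 2))"
      unfolding G_def by (simp add: sum.reindex)
    also have "\<dots> = sum w {n \<in> F. even n}"
      by (intro sum.cong refl) (auto simp: w_even elim!: evenE)
    finally have "sum w {n \<in> F. even n} = sum \<alpha> G" ..
    also have "\<dots> \<le> (\<Sum>i<card G. \<alpha> i)"
      by (rule V_sum_le_initial[OF \<alpha>]) (use F in \<open>simp add: G_def\<close>)
    also have "card G \<le> k"
    proof -
      have "card G \<le> card {n \<in> F. even n}" unfolding G_def by (rule card_image_le) (use F in simp)
      also have "\<dots> \<le> card F" by (rule card_mono) (use F in auto)
      finally show ?thesis using F by simp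
    qed
    then have "(\<Sum>i<card G. \<alpha> i) \<le> (\<Sum>i<k. \<alpha> i)"
      by (rule sum_lessThan_mono[OF V_D(1)[OF \<alpha>]])
    finally show ?thesis .
  qed
  also have "sum w {n \<in> F. odd n} \<le> real k * \<eta>"
  proof -
    have "w n \<le> \<eta>" if "odd n" for n using that w_odd by (auto elim!: oddE)
    then have "sum w {n \<in> F. odd n} \<le> real (card {n \<in> F. odd n}) * \<eta>"
      by (intro sum_bounded_above) auto
    also have "card {n \<in> F. odd n} \<le> card F" by (rule card_mono) (use F in auto)
    then have "real (card {n \<in> F. odd n}) * \<eta> \<le> real k * \<eta>"
      using F \<eta> by (intro mult_right_mono) auto
    finally show ?thesis .
  qed
  finally show ?thesis by simp
qed

text \<open>The first \<open>k\<close> atoms of \<beta> occupy at most \<open>k\<close> points,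
  whose mass is bounded by \<open>spread_prob_finite\<close>. If \<open>\<alpha> 0\<close> and
  \<eta> are below 1, no single point carries all the mass, so the support contains two points, and
  their distance is \<open>c\<close>.\<close>

lemma spread_in_pyramid_imp:
  assumes \<alpha>: "\<alpha> \<in> V" and \<beta>: "\<beta> \<in> V" and \<eta>: "0 < \<eta>" and c: "0 < c"
    and rep: "curve_rep (equilateral c) (spread \<alpha> \<eta>) E S h g'" and E: "E \<in> atoms_diam_pyramid \<beta> \<delta>"
  shows "(\<Sum>i<k. \<beta> i) \<le> (\<Sum>i<k. \<alpha> i) + real k * \<eta>"
    and "\<alpha> 0 < 1 \<Longrightarrow> \<eta> < 1 \<Longrightarrow> ennreal c \<le> \<delta>"
proof -
  note r = curve_rep_D[OF rep]
  define R where "R = pm_rep E"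
  have R: "pm_space R" using pm_rep_classes[OF r(1)] by (simp add: R_def)
  define J where "J = spread \<alpha> \<eta> -` S \<inter> {0..1}"
  have J: "J \<in> unit_interval.events" "unit_interval.prob J = 1"
    using r(6,7) by (auto simp: J_def sets_unit_interval_iff measure_def emeasure_unit_interval)
  have S: "\<exists>n. z = const_seq n" if "z \<in> S" for z
    using r(2) that unfolding mspace_equilateral[OF c] by blast
  have A: "{t \<in> {0..1}. spread \<alpha> \<eta> t = const_seq n} \<in> unit_interval.events" for n
    using spread_sets[OF \<alpha>, of \<eta> n] by (auto simp: sets_unit_interval_iff)
  obtain f where f: "\<And>i. f i \<in> pm_carrier R" "has_atoms (pm_measure R) \<beta> f"
    using E by (auto simp: atoms_diam_pyramid_iff atoms_pyramid_iff R_def)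
  have "\<exists>n. const_seq n \<in> S \<and> f i = h (const_seq n)" for i
  proof -
    have "f i \<in> h ` S" using f(1) r(3) by (simp add: R_def)
    then show ?thesis using S by blast
  qed
  then obtain \<nu> where \<nu>: "\<And>i. const_seq (\<nu> i) \<in> S" "\<And>i. f i = h (const_seq (\<nu> i))" by metis
  define Q where "Q = f ` {..<k}"
  define F where "F = \<nu> ` {..<k}"
  have Q: "Q \<in> sets (pm_measure R)"
    unfolding Q_def using f(1) by (intro finite_sets_pm_measure[OF R]) auto
  have g': "pm_parameter R g'" using r(8) by (simp add: R_def)
  have "(\<Sum>i<k. \<beta> i) \<le> measure (pm_measure R) Q"
    by (rule has_atoms_sum_le[OF f(2) Q _ _ V_D(1)[OF \<beta>] pm_space_D(4)[OF R]]) (auto simp: Q_def)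
  also have "\<dots> = unit_interval.prob (g' -` Q \<inter> {0..1})"
    by (rule measure_parameter(1)[OF g' Q])
  also have "\<dots> \<le> unit_interval.prob (g' -` Q \<inter> {0..1} \<inter> J)"
    using unit_interval_prob_Int_ge[OF measure_parameter(2)[OF g' Q] J(1)] J(2) by simp
  also have "\<dots> \<le> unit_interval.prob (\<Union>n\<in>F. {t \<in> {0..1}. spread \<alpha> \<eta> t = const_seq n})"
  proof (rule unit_interval.finite_measure_mono)
    show "g' -` Q \<inter> {0..1} \<inter> J \<subseteq> (\<Union>n\<in>F. {t \<in> {0..1}. spread \<alpha> \<eta> t = const_seq n})"
    proof
      fix t assume t: "t \<in> g' -` Q \<inter> {0..1} \<inter> J"
      then obtain i where i: "i < k" "g' t = f i" by (auto simp: Q_def)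
      have tS: "spread \<alpha> \<eta> t \<in> S" "t \<in> {0..1}" using t by (auto simp: J_def)
      then have "h (spread \<alpha> \<eta> t) = h (const_seq (\<nu> i))" using r(9) i \<nu>(2) by metis
      then have "spread \<alpha> \<eta> t = const_seq (\<nu> i)"
        using curve_rep_inj[OF rep] tS(1) \<nu>(1) by (meson inj_onD)
      moreover have "\<nu> i \<in> F" using i(1) by (simp add: F_def)
      ultimately show "t \<in> (\<Union>n\<in>F. {t \<in> {0..1}. spread \<alpha> \<eta> t = const_seq n})" using tS(2) by blast
    qed
    show "(\<Union>n\<in>F. {t \<in> {0..1}. spread \<alpha> \<eta> t = const_seq n}) \<in> unit_interval.events"
      using A by (intro sets.finite_UN) (auto simp: F_def)
  qed
  also have "\<dots> \<le> (\<Sum>i<k. \<alpha> i) + real k * \<eta>"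
    by (rule spread_prob_finite[OF \<alpha> \<eta>]) (auto simp: F_def intro: card_image_le[of "{..<k}", simplified])
  finally show "(\<Sum>i<k. \<beta> i) \<le> (\<Sum>i<k. \<alpha> i) + real k * \<eta>" .
  show "ennreal c \<le> \<delta>" if lt: "\<alpha> 0 < 1" "\<eta> < 1"
  proof -
    have small: "unit_interval.prob {t \<in> {0..1}. spread \<alpha> \<eta> t = const_seq n} < 1" for n
    proof (cases "even n")
      case True
      then obtain i where "n = 2 * i" by blast
      then show ?thesis
        using spread_prob(1)[OF \<alpha> \<eta>, of i] V_antimono[OF \<alpha>, of 0 i] lt(1) by simp
    next
      case False
      then obtain l where "n = Suc (2 * l)" using oddE by fastforce
      then show ?thesis using spread_prob(2)[OF \<alpha> \<eta>, of l] lt(2) by simp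
    qed
    have "J \<noteq> {}" using J(2) by auto
    then obtain x where x: "x \<in> S" by (auto simp: J_def)
    obtain n where n: "x = const_seq n" using S[OF x] by blast
    have "\<not> J \<subseteq> {t \<in> {0..1}. spread \<alpha> \<eta> t = const_seq n}"
    proof
      assume "J \<subseteq> {t \<in> {0..1}. spread \<alpha> \<eta> t = const_seq n}"
      then have "unit_interval.prob J \<le> unit_interval.prob {t \<in> {0..1}. spread \<alpha> \<eta> t = const_seq n}"
        by (rule unit_interval.finite_measure_mono[OF _ A])
      then show False using small[of n] J(2) by simp
    qed
    then obtain y where y: "y \<in> S" "y \<noteq> x" using n by (auto simp: J_def)
    have "pm_dist R (h x) (h y) = c"
      using r(4)[OF x y(1)] y(2) by (simp add: R_def mdist_equilateral[OF c])
    moreover have "h x \<in> pm_carrier R" "h y \<in> pm_carrier R" using x y(1) r(3) by (auto simp: R_def)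
    ultimately show ?thesis using E by (auto simp: atoms_diam_pyramid_iff R_def)
  qed
qed

text \<open>The spaces given by \<open>spread\<close> are tested for membership in the larger
  pyramid: varying \<open>c\<close> bounds \<delta>, and letting \<eta> tend to 0 compares partial
  sums.\<close>

lemma pyramid_subset_imp:
  assumes \<alpha>: "\<alpha> \<in> V" "\<alpha> \<noteq> one_V" and \<delta>: "\<delta> \<noteq> 0" and \<beta>: "\<beta> \<in> V"
    and sub: "atoms_diam_pyramid \<alpha> \<delta> \<subseteq> atoms_diam_pyramid \<beta> \<delta>'"
  shows "\<delta> \<le> \<delta>'" "(\<Sum>i<k. \<beta> i) \<le> (\<Sum>i<k. \<alpha> i)"
proof -
  have \<alpha>0: "\<alpha> 0 < 1" using V_eq_one_V[OF \<alpha>(1)] \<alpha>(2) by linarith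
  have c_le: "ennreal c \<le> \<delta>'" if c: "0 < c" "ennreal c \<le> \<delta>" for c
  proof -
    \<comment> \<open>Any \<eta> below 1 serves here; it only prevents an odd point from carrying
      all the mass.\<close>
    obtain E S h g' where rep: "curve_rep (equilateral c) (spread \<alpha> (1/2)) E S h g'" "E \<in> atoms_diam_pyramid \<alpha> \<delta>"
      using spread_curve_rep[OF \<alpha>(1) c] by blast
    then have "E \<in> atoms_diam_pyramid \<beta> \<delta>'" using sub by blast
    then show ?thesis
      using spread_in_pyramid_imp(2)[OF \<alpha>(1) \<beta> _ c(1) rep(1)] \<alpha>0 by simp
  qed
  show "\<delta> \<le> \<delta>'"
  proof (rule ccontr)
    assume "\<not> \<delta> \<le> \<delta>'"
    \<comment> \<open>As \<delta> may be infinite, it is approached from below by finite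
      distances.\<close>
    then obtain d where d: "\<delta>' < d" "d < \<delta>" by (meson dense not_less)
    then obtain q where q: "d = ennreal q" "0 \<le> q" by (cases d) auto
    then have "0 < q" using d(1) by (cases "q = 0") auto
    then have "ennreal q \<le> \<delta>'" using c_le d(2) q by simp
    then show False using d(1) q by simp
  qed
  have "0 < \<delta>" using \<delta> by (simp add: zero_less_iff_neq_zero)
  then obtain d where d: "0 < d" "d < \<delta>" using dense by blast
  then obtain c where c: "d = ennreal c" "0 \<le> c" by (cases d) auto
  have c': "0 < c" "ennreal c \<le> \<delta>" using d c by auto
  show "(\<Sum>i<k. \<beta> i) \<le> (\<Sum>i<k. \<alpha> i)"
  proof (rule field_le_epsilon)
    fix e :: real assume e: "0 < e"
    \<comment> \<open>Keeps the total error \<open>k * \<eta>\<close> at most \<open>e\<close>, also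
      for \<open>k = 0\<close>.\<close>
    define \<eta> where "\<eta> = e / real (Suc k)"
    have \<eta>: "0 < \<eta>" using e by (simp add: \<eta>_def)
    obtain E S h g' where rep: "curve_rep (equilateral c) (spread \<alpha> \<eta>) E S h g'" "E \<in> atoms_diam_pyramid \<alpha> \<delta>"
      using spread_curve_rep[OF \<alpha>(1) c'] by blast
    then have "E \<in> atoms_diam_pyramid \<beta> \<delta>'" using sub by blast
    then have "(\<Sum>i<k. \<beta> i) \<le> (\<Sum>i<k. \<alpha> i) + real k * \<eta>"
      by (rule spread_in_pyramid_imp(1)[OF \<alpha>(1) \<beta> \<eta> c'(1) rep(1)])
    moreover have "real k * \<eta> \<le> e" using e by (simp add: \<eta>_def field_simps)
    ultimately show "(\<Sum>i<k. \<beta> i) \<le> (\<Sum>i<k. \<alpha> i) + e" by linarith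
  qed
qed

text \<open>The parameters collapsed to one point by \<open>sim\<close>; their common pyramid
  consists of the one-point class.\<close>

definition trivial_param :: "(nat \<Rightarrow> real) \<times> ennreal \<Rightarrow> bool"
  where "trivial_param x \<longleftrightarrow> fst x = one_V \<or> snd x = 0"

text \<open>An atom of mass 1 has an open null complement, which is empty by full support; a zero
  diameter bound collapses the space directly. Conversely all of the mass of a one-point space is
  available for the atoms, whose total is at most 1.\<close>

lemma trivial_pyramid:
  assumes \<alpha>: "\<alpha> \<in> V" and triv: "trivial_param (\<alpha>, \<delta>)"
  shows "atoms_diam_pyramid \<alpha> \<delta> =
    {C \<in> pm_classes. \<forall>x\<in>pm_carrier (pm_rep C). \<forall>y\<in>pm_carrier (pm_rep C). x = y}"
proof (intro equalityI subsetI)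
  fix C assume C: "C \<in> atoms_diam_pyramid \<alpha> \<delta>"
  define X where "X = pm_rep C"
  have C_cl: "C \<in> pm_classes" using C by (auto simp: atoms_diam_pyramid_iff atoms_pyramid_iff)
  have X: "pm_space X" "pm_supp X = pm_carrier X" using pm_rep_classes[OF C_cl] by (auto simp: X_def)
  interpret Metric_space "pm_carrier X" "pm_dist X" by simp
  interpret \<mu>: prob_space "pm_measure X" by (rule pm_space_D(4)[OF X(1)])
  have "x = y" if xy: "x \<in> pm_carrier X" "y \<in> pm_carrier X" for x y
  proof (cases "\<delta> = 0")
    case True
    then have "ennreal (pm_dist X x y) \<le> 0" using C xy by (auto simp: atoms_diam_pyramid_iff X_def)
    then have "pm_dist X x y = 0" using nonneg[of x y] by simp
    then show ?thesis using zero[OF xy] by simp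
  next
    case False
    then have one: "\<alpha> = one_V" using triv by (simp add: trivial_param_def)
    obtain f where f: "\<And>i. f i \<in> pm_carrier X" "has_atoms (pm_measure X) \<alpha> f"
      using C by (auto simp: atoms_diam_pyramid_iff atoms_pyramid_iff X_def)
    have Q: "{f 0} \<in> sets (pm_measure X)"
      using f(1) by (intro finite_sets_pm_measure[OF X(1)]) auto
    have "sum \<alpha> {0} \<le> measure (pm_measure X) {f 0}"
      by (rule has_atoms_sum_le[OF f(2) Q _ _ V_D(1)[OF \<alpha>] \<mu>.prob_space_axioms]) auto
    then have "1 \<le> measure (pm_measure X) {f 0}" by (simp add: one one_V_def)
    then have "measure (pm_measure X) (space (pm_measure X) - {f 0}) \<le> 0"
      using \<mu>.prob_compl[OF Q] by simp
    then have null: "emeasure (pm_measure X) (pm_carrier X - {f 0}) = 0"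
      using pm_space_space[OF X(1)] \<mu>.emeasure_eq_measure measure_nonneg[of "pm_measure X" "pm_carrier X - {f 0}"]
      by simp
    have "z = f 0" if z: "z \<in> pm_carrier X" for z
    proof (rule ccontr)
      assume "z \<noteq> f 0"
      have "closedin mtopology {f 0}"
        by (rule closedin_Hausdorff_finite[OF Hausdorff_space_mtopology]) (use f(1) in auto)
      then have "openin (mtopology_of (fst X)) (pm_carrier X - {f 0})"
        by (auto simp: mtopology_of_def closedin_def)
      moreover have "z \<in> pm_supp X" using z X(2) by simp
      ultimately have "0 < emeasure (pm_measure X) (pm_carrier X - {f 0})"
        unfolding pm_supp_def using z \<open>z \<noteq> f 0\<close> by blast
      then show False using null by simp
    qed
    then show ?thesis using xy by metis
  qed
  then show "C \<in> {C \<in> pm_classes. \<forall>x\<in>pm_carrier (pm_rep C). \<forall>y\<in>pm_carrier (pm_rep C). x = y}"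
    using C_cl by (auto simp: X_def)
next
  fix C assume C: "C \<in> {C \<in> pm_classes. \<forall>x\<in>pm_carrier (pm_rep C). \<forall>y\<in>pm_carrier (pm_rep C). x = y}"
  define X where "X = pm_rep C"
  have C_cl: "C \<in> pm_classes" using C by blast
  have X: "pm_space X" using pm_rep_classes[OF C_cl] by (simp add: X_def)
  interpret Metric_space "pm_carrier X" "pm_dist X" by simp
  interpret \<mu>: prob_space "pm_measure X" by (rule pm_space_D(4)[OF X])
  obtain x0 where x0: "x0 \<in> pm_carrier X" using pm_space_nonempty[OF X] by blast
  have all: "x = x0" if "x \<in> pm_carrier X" for x using C that x0 by (auto simp: X_def)
  have "has_atoms (pm_measure X) \<alpha> (\<lambda>_. x0)"
    unfolding has_atoms_def
  proof
    fix A assume A: "A \<in> sets (pm_measure X)"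
    show "(\<Sum>i. ennreal (\<alpha> i) * indicator A x0) \<le> emeasure (pm_measure X) A"
    proof (cases "x0 \<in> A")
      case True
      then have "space (pm_measure X) \<subseteq> A" using all pm_space_space[OF X] by auto
      then have "A = space (pm_measure X)" using sets.sets_into_space[OF A] by blast
      then have "emeasure (pm_measure X) A = 1" using \<mu>.emeasure_space_1 by simp
      moreover have "(\<Sum>i. ennreal (\<alpha> i)) = ennreal (suminf \<alpha>)"
        by (rule suminf_ennreal2) (use V_D[OF \<alpha>] in auto)
      ultimately show ?thesis using True V_D(3)[OF \<alpha>] by simp
    qed simp
  qed
  then have atoms: "\<exists>f. (\<forall>i. f i \<in> pm_carrier X) \<and> has_atoms (pm_measure X) \<alpha> f"
    by (intro exI[of _ "\<lambda>_. x0"] conjI allI x0)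
  have diam: "ennreal (pm_dist X x y) \<le> \<delta>" if "x \<in> pm_carrier X" "y \<in> pm_carrier X" for x y
  proof -
    have "pm_dist X x y = 0" using all[OF that(1)] all[OF that(2)] x0 by simp
    then show ?thesis by simp
  qed
  show "C \<in> atoms_diam_pyramid \<alpha> \<delta>"
    unfolding atoms_diam_pyramid_iff atoms_pyramid_iff X_def[symmetric]
    by (intro conjI ballI C_cl atoms diam)
qed

text \<open>Two nontrivial parameters with equal pyramids bound each other, so their diameter bounds
  and partial sums agree, and entries are differences of partial sums.\<close>

lemma pyramid_eq_iff:
  assumes \<alpha>: "\<alpha> \<in> V" and \<beta>: "\<beta> \<in> V"
  shows "atoms_diam_pyramid \<alpha> \<delta> = atoms_diam_pyramid \<beta> \<delta>' \<longleftrightarrow>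
    (\<alpha>, \<delta>) = (\<beta>, \<delta>') \<or> trivial_param (\<alpha>, \<delta>) \<and> trivial_param (\<beta>, \<delta>')"
proof
  \<comment> \<open>The inclusion forces \<delta> \<le> \<delta>', so \<delta>' is nonzero and
    \<beta> must be \<open>one_V\<close>; comparing the first entries then makes \<alpha> equal to
    \<open>one_V\<close> as well.\<close>
  have no_trivial: False
    if "\<alpha> \<in> V" "\<beta> \<in> V" "\<not> trivial_param (\<alpha>, \<delta>)" "trivial_param (\<beta>, \<delta>')"
      "atoms_diam_pyramid \<alpha> \<delta> \<subseteq> atoms_diam_pyramid \<beta> \<delta>'" for \<alpha> \<beta> \<delta> \<delta>'
  proof -
    have nt: "\<alpha> \<noteq> one_V" "\<delta> \<noteq> 0" using that(3) by (auto simp: trivial_param_def)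
    note * = pyramid_subset_imp[OF that(1) nt that(2,5)]
    have "\<beta> = one_V" using *(1) nt(2) that(4) by (auto simp: trivial_param_def)
    then have "1 \<le> \<alpha> 0" using *(2)[of 1] by (simp add: one_V_def)
    then show False using V_eq_one_V[OF that(1)] nt(1) by blast
  qed
  assume eq: "atoms_diam_pyramid \<alpha> \<delta> = atoms_diam_pyramid \<beta> \<delta>'"
  show "(\<alpha>, \<delta>) = (\<beta>, \<delta>') \<or> trivial_param (\<alpha>, \<delta>) \<and> trivial_param (\<beta>, \<delta>')"
  proof (cases "trivial_param (\<alpha>, \<delta>) \<or> trivial_param (\<beta>, \<delta>')")
    case True
    then show ?thesis
      using no_trivial[OF \<alpha> \<beta>] no_trivial[OF \<beta> \<alpha>] eq by blast
  next
    case False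
    then have nt: "\<alpha> \<noteq> one_V" "\<delta> \<noteq> 0" "\<beta> \<noteq> one_V" "\<delta>' \<noteq> 0" by (auto simp: trivial_param_def)
    note 1 = pyramid_subset_imp[OF \<alpha> nt(1,2) \<beta>, of \<delta>'] and 2 = pyramid_subset_imp[OF \<beta> nt(3,4) \<alpha>, of \<delta>]
    have "\<delta> = \<delta>'" using 1(1) 2(1) eq by auto
    moreover have sums: "(\<Sum>i<k. \<alpha> i) = (\<Sum>i<k. \<beta> i)" for k
      using 1(2)[of k] 2(2)[of k] eq by auto
    have "\<alpha> i = \<beta> i" for i
      using sums[of "Suc i"] sums[of i] by simp
    then have "\<alpha> = \<beta>" by blast
    ultimately show ?thesis by blast
  qed
next
  assume "(\<alpha>, \<delta>) = (\<beta>, \<delta>') \<or> trivial_param (\<alpha>, \<delta>) \<and> trivial_param (\<beta>, \<delta>')"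
  then show "atoms_diam_pyramid \<alpha> \<delta> = atoms_diam_pyramid \<beta> \<delta>'"
  proof
    assume "trivial_param (\<alpha>, \<delta>) \<and> trivial_param (\<beta>, \<delta>')"
    then show ?thesis
      using trivial_pyramid[OF \<alpha>, of \<delta>] trivial_pyramid[OF \<beta>, of \<delta>'] by metis
  qed blast
qed

section \<open>The weak topology\<close>

lemma pyramids_subset: "P \<in> pyramids \<Longrightarrow> P \<subseteq> pm_classes"
  by (simp add: pyramids_def)

lemma strict_mono_choice:
  fixes Q :: "nat \<Rightarrow> nat \<Rightarrow> bool"
  assumes "\<And>k N. \<exists>n\<ge>N. Q k n"
  obtains r where "strict_mono r" "\<And>k. Q k (r k)"
proof -
  have "\<exists>r. \<forall>k. Q k (r k) \<and> r k < r (Suc k)"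
    by (rule dependent_nat_choice) (use assms Suc_le_eq in blast)+
  then show thesis using that strict_mono_Suc_iff by blast
qed

lemma weak_tendsto_box_dist_small:
  assumes P: "\<not> 0 < liminf (\<lambda>n. INF D\<in>Ps n. ereal (box_dist C D))" and e: "0 < e"
  shows "\<exists>n\<ge>N. \<exists>D\<in>Ps n. box_dist C D < e"
proof (rule ccontr)
  assume "\<not> ?thesis"
  then have *: "e \<le> box_dist C D" if "N \<le> n" "D \<in> Ps n" for n D
    using that by (meson not_less)
  have "\<forall>\<^sub>F n in sequentially. ereal e \<le> (INF D\<in>Ps n. ereal (box_dist C D))"
    using eventually_ge_at_top[of N]
  proof eventually_elim
    case (elim n)
    then show ?case using * by (intro INF_greatest) simp
  qed
  then have "ereal e \<le> liminf (\<lambda>n. INF D\<in>Ps n. ereal (box_dist C D))"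
    by (rule Liminf_bounded)
  then show False using P e by (meson ereal_less(2) less_le_trans)
qed

text \<open>A member of \<open>P\<close> outside \<open>Q\<close> would be approached by members of
  \<open>Ps n\<close> and at the same time kept at a positive distance from them. Equality of limits
  follows by exchanging \<open>P\<close> and \<open>Q\<close>.\<close>

lemma weak_tendsto_unique:
  assumes P: "weak_tendsto Ps P" "P \<subseteq> pm_classes" and Q: "weak_tendsto Ps Q"
  shows "P \<subseteq> Q"
proof
  fix C assume C: "C \<in> P"
  then obtain Cs where Cs: "\<And>n. Cs n \<in> Ps n" "box_tendsto Cs C"
    using P(1) unfolding weak_tendsto_def by blast
  show "C \<in> Q"
  proof (rule ccontr)
    assume "C \<notin> Q"
    then have pos: "0 < liminf (\<lambda>n. INF D\<in>Ps n. ereal (box_dist C D))"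
      using Q C P(2) by (auto simp: weak_tendsto_def)
    have "(\<lambda>n. ereal (box_dist (Cs n) C)) \<longlonglongrightarrow> ereal 0"
      using Cs(2) by (simp add: box_tendsto_def)
    then have "liminf (\<lambda>n. ereal (box_dist (Cs n) C)) = 0"
      by (subst lim_imp_Liminf) (auto simp: zero_ereal_def)
    moreover have "liminf (\<lambda>n. INF D\<in>Ps n. ereal (box_dist C D)) \<le> liminf (\<lambda>n. ereal (box_dist (Cs n) C))"
    proof (rule Liminf_mono, rule always_eventually, rule allI)
      show "(INF D\<in>Ps n. ereal (box_dist C D)) \<le> ereal (box_dist (Cs n) C)" for n
        using INF_lower[OF Cs(1)[of n], of "\<lambda>D. ereal (box_dist C D)"] by (simp only: box_dist_commute[of C "Cs n"])
    qed
    ultimately show False using pos by simp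
  qed
qed

lemma weak_tendsto_subseq:
  assumes P: "weak_tendsto Ps P" and r: "strict_mono r"
  shows "weak_tendsto (\<lambda>n. Ps (r n)) P"
  unfolding weak_tendsto_def
proof (intro conjI ballI)
  fix C assume "C \<in> P"
  then obtain Cs where Cs: "\<And>n. Cs n \<in> Ps n" "box_tendsto Cs C"
    using P unfolding weak_tendsto_def by blast
  have "box_tendsto (\<lambda>n. Cs (r n)) C"
    using LIMSEQ_subseq_LIMSEQ[OF Cs(2)[unfolded box_tendsto_def] r] by (simp add: box_tendsto_def o_def)
  then show "\<exists>Cs. (\<forall>n. Cs n \<in> Ps (r n)) \<and> box_tendsto Cs C"
    using Cs(1) by (intro exI[of _ "\<lambda>n. Cs (r n)"]) simp
next
  fix C assume "C \<in> pm_classes - P"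
  then have "0 < liminf (\<lambda>n. INF D\<in>Ps n. ereal (box_dist C D))"
    using P by (auto simp: weak_tendsto_def)
  also have "\<dots> \<le> liminf ((\<lambda>n. INF D\<in>Ps n. ereal (box_dist C D)) \<circ> r)"
    by (rule liminf_subseq_mono[OF r])
  finally show "0 < liminf (\<lambda>n. INF D\<in>Ps (r n). ereal (box_dist C D))"
    by (simp add: o_def)
qed

text \<open>The approximation half is \<open>pyramid_approx\<close>. For the other half, a class not
  kept away from the pyramids is a box limit along a subsequence, and \<open>pyramid_limit\<close>
  puts it into the limit pyramid.\<close>

lemma weak_tendsto_atoms_diam_pyramid:
  assumes \<alpha>: "\<And>n. \<alpha> n \<in> V" and \<beta>: "\<beta> \<in> V" and \<alpha>_lim: "\<And>i. (\<lambda>n. \<alpha> n i) \<longlonglongrightarrow> \<beta> i" and \<delta>_lim: "\<delta> \<longlonglongrightarrow> \<delta>'"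
  shows "weak_tendsto (\<lambda>n. atoms_diam_pyramid (\<alpha> n) (\<delta> n)) (atoms_diam_pyramid \<beta> \<delta>')"
  unfolding weak_tendsto_def
proof (intro conjI ballI)
  fix C assume C: "C \<in> atoms_diam_pyramid \<beta> \<delta>'"
  define P where "P n = atoms_diam_pyramid (\<alpha> n) (\<delta> n)" for n
  have C_cl: "C \<in> pm_classes" using C by (auto simp: atoms_diam_pyramid_iff atoms_pyramid_iff)
  have P_cl: "P n \<subseteq> pm_classes" "P n \<noteq> {}" for n
    using pyramids_subset[OF atoms_diam_pyramid_in_pyramids[OF \<alpha>]] atoms_diam_pyramid_nonempty[OF \<alpha>]
    by (auto simp: P_def)
  \<comment> \<open>The witnesses of \<open>pyramid_approx\<close> depend on \<open>e\<close>. Near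
    minimizers of the distance to \<open>C\<close> form one sequence that serves for every
    \<open>e\<close>.\<close>
  define \<iota> where "\<iota> n = (INF E\<in>P n. box_dist E C)" for n
  have bdd: "bdd_below ((\<lambda>E. box_dist E C) ` P n)" for n
    using P_cl box_dist_nonneg[OF _ C_cl] by (intro bdd_belowI[of _ 0]) blast
  have "\<exists>E\<in>P n. box_dist E C < \<iota> n + 1 / real (Suc n)" for n
  proof -
    have ne: "(\<lambda>E. box_dist E C) ` P n \<noteq> {}" using P_cl by simp
    have "\<iota> n < \<iota> n + 1 / real (Suc n)" by simp
    then show ?thesis using cInf_lessD[OF ne, of "\<iota> n + 1 / real (Suc n)"] unfolding \<iota>_def by blast
  qed
  then obtain Cs where Cs: "\<And>n. Cs n \<in> P n" "\<And>n. box_dist (Cs n) C < \<iota> n + 1 / real (Suc n)" by metis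
  have "(\<lambda>n. box_dist (Cs n) C) \<longlonglongrightarrow> 0"
  proof (rule LIMSEQ_I)
    fix e :: real assume e: "0 < e"
    have "\<forall>\<^sub>F n in sequentially. \<exists>E\<in>P n. box_dist E C \<le> e / 2"
      unfolding P_def by (rule pyramid_approx[OF C \<alpha> \<beta> \<alpha>_lim \<delta>_lim]) (use e in simp)
    moreover have "\<forall>\<^sub>F n in sequentially. 1 / real (Suc n) < e / 2"
      using e by (intro order_tendstoD(2)[OF LIMSEQ_Suc[OF lim_const_over_n[of 1]]]) simp
    ultimately have "\<forall>\<^sub>F n in sequentially. norm (box_dist (Cs n) C - 0) < e"
    proof eventually_elim
      case (elim n)
      then obtain E where E: "E \<in> P n" "box_dist E C \<le> e / 2" by blast
      have "\<iota> n \<le> box_dist E C" unfolding \<iota>_def by (rule cINF_lower[OF bdd E(1)])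
      then have "box_dist (Cs n) C < e" using E(2) elim(2) Cs(2)[of n] by linarith
      moreover have "0 \<le> box_dist (Cs n) C" using Cs(1) P_cl C_cl by (intro box_dist_nonneg) auto
      ultimately show ?case by simp
    qed
    then show "\<exists>no. \<forall>n\<ge>no. norm (box_dist (Cs n) C - 0) < e"
      by (simp add: eventually_sequentially)
  qed
  then show "\<exists>Cs. (\<forall>n. Cs n \<in> atoms_diam_pyramid (\<alpha> n) (\<delta> n)) \<and> box_tendsto Cs C"
    using Cs(1) by (intro exI[of _ Cs]) (simp add: box_tendsto_def P_def)
next
  fix C assume C: "C \<in> pm_classes - atoms_diam_pyramid \<beta> \<delta>'"
  show "0 < liminf (\<lambda>n. INF D\<in>atoms_diam_pyramid (\<alpha> n) (\<delta> n). ereal (box_dist C D))"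
  proof (rule ccontr)
    assume neg: "\<not> ?thesis"
    define Q where "Q k n \<longleftrightarrow> (\<exists>D\<in>atoms_diam_pyramid (\<alpha> n) (\<delta> n). box_dist C D < 1 / real (Suc k))" for k n
    have "\<exists>n\<ge>N. Q k n" for k N
      unfolding Q_def by (rule weak_tendsto_box_dist_small[OF neg]) simp
    then obtain r where r: "strict_mono r" "\<And>k. Q k (r k)"
      using strict_mono_choice[of Q] by blast
    obtain D where D: "\<And>k. D k \<in> atoms_diam_pyramid (\<alpha> (r k)) (\<delta> (r k))" "\<And>k. box_dist C (D k) < 1 / real (Suc k)"
      using r(2) unfolding Q_def by metis
    have D_cl: "D k \<in> pm_classes" for k using D(1) by (auto simp: atoms_diam_pyramid_iff atoms_pyramid_iff)
    have "(\<lambda>k. box_dist (D k) C) \<longlonglongrightarrow> 0"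
    proof (rule tendsto_sandwich[OF _ _ tendsto_const])
      show "(\<lambda>k. 1 / real (Suc k)) \<longlonglongrightarrow> 0" by (rule LIMSEQ_Suc[OF lim_const_over_n[of 1]])
      show "\<forall>\<^sub>F k in sequentially. 0 \<le> box_dist (D k) C"
        using box_dist_nonneg[OF D_cl] C by simp
      show "\<forall>\<^sub>F k in sequentially. box_dist (D k) C \<le> 1 / real (Suc k)"
        using D(2) by (intro always_eventually allI) (simp only: box_dist_commute[of _ C] less_imp_le)
    qed
    moreover have "(\<lambda>k. \<alpha> (r k) i) \<longlonglongrightarrow> \<beta> i" for i
      using LIMSEQ_subseq_LIMSEQ[OF \<alpha>_lim r(1)] by (simp add: o_def)
    moreover have "(\<lambda>k. \<delta> (r k)) \<longlonglongrightarrow> \<delta>'"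
      using LIMSEQ_subseq_LIMSEQ[OF \<delta>_lim r(1)] by (simp add: o_def)
    ultimately have "C \<in> atoms_diam_pyramid \<beta> \<delta>'"
      using C D(1) \<alpha> by (intro pyramid_limit[of C "\<lambda>k. \<alpha> (r k)" \<beta> "\<lambda>k. \<delta> (r k)" \<delta>' D] \<beta>) auto
    then show False using C by blast
  qed
qed

text \<open>A diagonal subsequence converges in every entry. The limit stays in \<open>V\<close>
  because all its conditions reduce to weak inequalities between finitely many entries; in
  particular the sum stays at most 1, although it may drop.\<close>

lemma V_convergent_subsequence:
  assumes \<alpha>: "\<And>n. \<alpha> n \<in> V"
  obtains r \<beta> where "strict_mono (r :: nat \<Rightarrow> nat)" "\<beta> \<in> V" "\<And>i. (\<lambda>n. \<alpha> (r n) i) \<longlonglongrightarrow> \<beta> i"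
proof -
  define P where "P i s \<longleftrightarrow> convergent (\<lambda>n. \<alpha> (s n) i)" for i and s :: "nat \<Rightarrow> nat"
  have le1: "\<alpha> n i \<in> {0..1}" for n i
  proof -
    have "1 / real (Suc i) \<le> 1" by simp
    then show ?thesis
      using V_le_inverse[OF \<alpha>, of n i] V_D(1)[OF \<alpha>, of n i] unfolding atLeastAtMost_iff by linarith
  qed
  interpret subseqs P
  proof
    fix i and s :: "nat \<Rightarrow> nat"
    have "\<forall>n. \<alpha> (s n) i \<in> {0..1}" using le1 by blast
    then obtain l r where "strict_mono (r :: nat \<Rightarrow> nat)" "((\<lambda>n. \<alpha> (s n) i) \<circ> r) \<longlonglongrightarrow> l"
      using seq_compactE[OF compact_imp_seq_compact[OF compact_Icc]] by metis
    then show "\<exists>r'. strict_mono r' \<and> P i (s \<circ> r')"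
      by (intro exI[of _ r]) (auto simp: P_def convergent_def o_def)
  qed
  have "convergent (\<lambda>n. \<alpha> (diagseq n) i)" for i
  proof -
    have "P i (diagseq \<circ> (+) (Suc i))"
    proof (rule diagseq_holds)
      fix r s n assume "strict_mono (r :: nat \<Rightarrow> nat)" "P n s"
      then show "P n (s \<circ> r)"
        using convergent_subseq_convergent[of "\<lambda>k. \<alpha> (s k) n" r] by (simp add: P_def o_def)
    qed
    then have "convergent (\<lambda>n. \<alpha> (diagseq (n + Suc i)) i)" by (simp add: P_def o_def add.commute)
    then show ?thesis using convergent_ignore_initial_segment[of "\<lambda>n. \<alpha> (diagseq n) i" "Suc i"] by blast
  qed
  then obtain \<beta> where \<beta>: "\<And>i. (\<lambda>n. \<alpha> (diagseq n) i) \<longlonglongrightarrow> \<beta> i" unfolding convergent_def by metis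
  have nn: "0 \<le> \<beta> i" for i
    by (rule LIMSEQ_le_const[OF \<beta>]) (use V_D(1)[OF \<alpha>] in blast)
  have sum_le: "(\<Sum>i<k. \<beta> i) \<le> 1" for k
  proof (rule LIMSEQ_le_const2)
    show "(\<lambda>n. \<Sum>i<k. \<alpha> (diagseq n) i) \<longlonglongrightarrow> (\<Sum>i<k. \<beta> i)" by (intro tendsto_sum \<beta>)
    show "\<exists>N. \<forall>n\<ge>N. (\<Sum>i<k. \<alpha> (diagseq n) i) \<le> 1" using V_sum_le(2)[OF \<alpha>] by blast
  qed
  have "\<beta> (Suc i) \<le> \<beta> i" for i
    by (rule LIMSEQ_le[OF \<beta> \<beta>]) (use V_D(4)[OF \<alpha>] in blast)
  moreover have sm: "summable \<beta>"
    by (rule summableI_nonneg_bounded[OF nn sum_le])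
  moreover have "suminf \<beta> \<le> 1"
    by (rule suminf_le_const[OF sm sum_le])
  ultimately have "\<beta> \<in> V" using nn by (simp add: V_def)
  then show thesis using that[OF subseq_diagseq _ \<beta>] by blast
qed

section \<open>Sequences in the parameter space\<close>

abbreviation V_metric :: "(nat \<Rightarrow> real) metric"
  where "V_metric \<equiv> submetric (funspace UNIV euclidean_metric) V"

lemma mspace_V_metric: "mspace V_metric = V" "V \<subseteq> mspace (funspace UNIV (euclidean_metric :: real metric))"
proof -
  have "topspace (mtopology_of V_metric) = V"
    using topspace_V_topology by (simp only: V_topology_def mtopology_of_submetric)
  then show *: "mspace V_metric = V" by (simp only: topspace_mtopology_of)
  then show "V \<subseteq> mspace (funspace UNIV (euclidean_metric :: real metric))"
    unfolding mspace_submetric by blast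
qed

lemma V_topology_eq: "V_topology = mtopology_of V_metric"
  by (simp only: V_topology_def mtopology_of_submetric)

lemma mdist_V_le_iff:
  assumes "\<alpha> \<in> V" "\<beta> \<in> V"
  shows "mdist V_metric \<alpha> \<beta> \<le> e \<longleftrightarrow> (\<forall>i. \<bar>\<alpha> i - \<beta> i\<bar> \<le> e)"
proof -
  have "mdist (funspace UNIV euclidean_metric) \<alpha> \<beta> \<le> e \<longleftrightarrow> (\<forall>i\<in>UNIV. mdist euclidean_metric (\<alpha> i) (\<beta> i) \<le> e)"
    by (rule funspace_mdist_le) (use assms mspace_V_metric(2) in blast)+
  then show ?thesis
    by (simp only: mdist_submetric mdist_euclidean_metric dist_real_def ball_UNIV)
qed

text \<open>The tails are uniformly small, since \<open>\<alpha> i \<le> 1 / (i + 1)\<close> for all \<open>\<alpha>\<close> in \<open>V\<close>.\<close>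

lemma V_pointwise_imp_uniform:
  assumes \<alpha>: "\<And>n. \<alpha> n \<in> V" and \<beta>: "\<beta> \<in> V" and lim: "\<And>i. (\<lambda>n. \<alpha> n i) \<longlonglongrightarrow> \<beta> i" and e: "0 < e"
  shows "\<forall>\<^sub>F n in sequentially. mdist V_metric \<beta> (\<alpha> n) \<le> e"
proof -
  obtain K where K: "1 / real (Suc K) < e" using e by (meson nat_approx_posE)
  have "\<forall>\<^sub>F n in sequentially. \<forall>i\<in>{..<K}. \<bar>\<beta> i - \<alpha> n i\<bar> < e"
  proof (rule eventually_ball_finite, simp, rule ballI)
    fix i
    have "(\<lambda>n. \<bar>\<beta> i - \<alpha> n i\<bar>) \<longlonglongrightarrow> \<bar>\<beta> i - \<beta> i\<bar>" by (intro tendsto_intros lim)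
    then show "\<forall>\<^sub>F n in sequentially. \<bar>\<beta> i - \<alpha> n i\<bar> < e"
      using e by (intro order_tendstoD) auto
  qed
  then show ?thesis
  proof eventually_elim
    case (elim n)
    have "\<bar>\<beta> i - \<alpha> n i\<bar> \<le> e" for i
    proof (cases "i < K")
      case True
      then show ?thesis using elim by (simp add: less_imp_le)
    next
      case False
      then have "1 / real (Suc i) \<le> 1 / real (Suc K)" by (simp add: frac_le)
      then show ?thesis
        using V_le_inverse[OF \<beta>, of i] V_le_inverse[OF \<alpha>, of n i] V_D(1)[OF \<beta>, of i] V_D(1)[OF \<alpha>, of n i] K
        by (simp only: abs_le_iff) linarith
    qed
    then show ?case using mdist_V_le_iff[OF \<beta> \<alpha>] by blast
  qed
qed

abbreviation param_topology :: "((nat \<Rightarrow> real) \<times> ennreal) topology"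
  where "param_topology \<equiv> prod_topology V_topology euclidean"

lemma closedin_param_topology_limit:
  assumes K: "closedin param_topology K" and \<alpha>: "\<And>n. (\<alpha> n, \<delta> n) \<in> K"
    and \<beta>: "\<beta> \<in> V" and lim: "\<And>i. (\<lambda>n. \<alpha> n i) \<longlonglongrightarrow> \<beta> i" "\<delta> \<longlonglongrightarrow> \<delta>'"
  shows "(\<beta>, \<delta>') \<in> K"
proof (rule ccontr)
  interpret Metric_space "mspace V_metric" "mdist V_metric" by (rule Metric_space_mspace_mdist)
  have \<alpha>V: "\<alpha> n \<in> V" for n using closedin_subset[OF K] \<alpha>[of n] by auto
  assume "(\<beta>, \<delta>') \<notin> K"
  then have mem: "(\<beta>, \<delta>') \<in> V \<times> UNIV - K" using \<beta> by simp
  have "openin param_topology (V \<times> UNIV - K)"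
    using K by (simp add: closedin_def)
  then have "\<forall>x y. (x, y) \<in> V \<times> UNIV - K \<longrightarrow>
      (\<exists>A B. openin V_topology A \<and> openin euclidean B \<and> x \<in> A \<and> y \<in> B \<and> A \<times> B \<subseteq> V \<times> UNIV - K)"
    unfolding openin_prod_topology_alt .
  then obtain A B where A: "openin V_topology A" "\<beta> \<in> A" and B: "openin euclidean B" "\<delta>' \<in> B"
    and sub: "A \<times> B \<subseteq> V \<times> UNIV - K"
    using mem by blast
  have "openin mtopology A" using A(1) by (simp only: V_topology_eq mtopology_of_def)
  then obtain r where r: "0 < r" "mball \<beta> r \<subseteq> A" using A(2) unfolding openin_mtopology by blast
  have "\<forall>\<^sub>F n in sequentially. mdist V_metric \<beta> (\<alpha> n) \<le> r / 2"
    by (rule V_pointwise_imp_uniform[OF \<alpha>V \<beta> lim(1)]) (use r in simp)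
  moreover have "\<forall>\<^sub>F n in sequentially. \<delta> n \<in> B"
    by (rule topological_tendstoD[OF lim(2) _ B(2)]) (rule B(1)[folded open_openin])
  ultimately have "\<forall>\<^sub>F n in sequentially. mdist V_metric \<beta> (\<alpha> n) \<le> r / 2 \<and> \<delta> n \<in> B"
    by eventually_elim blast
  then obtain n where n: "mdist V_metric \<beta> (\<alpha> n) \<le> r / 2" "\<delta> n \<in> B"
    using eventually_happens'[OF sequentially_bot] by blast
  have "mdist V_metric \<beta> (\<alpha> n) < r" using n(1) r(1) by linarith
  moreover have "\<beta> \<in> mspace V_metric" "\<alpha> n \<in> mspace V_metric"
    unfolding mspace_V_metric(1) by (rule \<beta>, rule \<alpha>V)
  ultimately have "\<alpha> n \<in> mball \<beta> r"
    unfolding in_mball by blast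
  then have "(\<alpha> n, \<delta> n) \<in> A \<times> B" using r(2) n(2) by blast
  then show False using sub \<alpha>[of n] by blast
qed

text \<open>If some parameter in \<open>W\<close> had no product neighbourhood inside
  \<open>W\<close>, parameters outside \<open>W\<close> would converge to it. Their pyramids
  converge weakly, and a sequentially open set eventually contains them.\<close>

lemma openin_param_vimage:
  assumes U: "openin weak_topology U"
  shows "openin param_topology {x \<in> V \<times> UNIV. atoms_diam_pyramid (fst x) (snd x) \<in> U}"
proof -
  define W where "W = {x \<in> V \<times> UNIV. atoms_diam_pyramid (fst x) (snd x) \<in> U}"
  interpret Metric_space "mspace V_metric" "mdist V_metric" by (rule Metric_space_mspace_mdist)
  have False if mem: "(\<beta>, \<delta>') \<in> W"
      and no: "\<not> (\<exists>A B. openin V_topology A \<and> openin euclidean B \<and> \<beta> \<in> A \<and> \<delta>' \<in> B \<and> A \<times> B \<subseteq> W)"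
    for \<beta> \<delta>'
  proof -
  have \<beta>: "\<beta> \<in> V" using mem by (simp add: W_def)
  \<comment> \<open>A decreasing countable neighbourhood base in \<open>ennreal\<close>, playing the
    part that shrinking balls play in \<open>V\<close>.\<close>
  obtain B :: "nat \<Rightarrow> ennreal set" where B: "\<And>n. open (B n)" "\<And>n. \<delta>' \<in> B n"
    "\<And>S. open S \<Longrightarrow> \<delta>' \<in> S \<Longrightarrow> \<forall>\<^sub>F n in sequentially. B n \<subseteq> S"
    using countable_basis_at_decseq[of \<delta>'] by metis
  have "\<exists>\<alpha> \<delta>. \<alpha> \<in> mball \<beta> (1 / real (Suc n)) \<and> \<delta> \<in> B n \<and> (\<alpha>, \<delta>) \<notin> W" for n
  proof -
    have "openin V_topology (mball \<beta> (1 / real (Suc n)))"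
      by (simp only: V_topology_eq mtopology_of_def openin_mball)
    moreover have "\<beta> \<in> mball \<beta> (1 / real (Suc n))"
    proof (rule centre_in_mball_iff[THEN iffD2, OF conjI])
      show "\<beta> \<in> mspace V_metric" unfolding mspace_V_metric(1) by (rule \<beta>)
      show "0 < 1 / real (Suc n)" by simp
    qed
    moreover have "openin euclidean (B n)" using B(1)[of n] open_openin by blast
    ultimately have "\<not> mball \<beta> (1 / real (Suc n)) \<times> B n \<subseteq> W"
      using no B(2)[of n] by metis
    then show ?thesis unfolding subset_iff mem_Sigma_iff split_paired_All by metis
  qed
  then obtain \<alpha> \<delta> where \<alpha>: "\<And>n. \<alpha> n \<in> mball \<beta> (1 / real (Suc n))" and \<delta>: "\<And>n. \<delta> n \<in> B n"
    and notin: "\<And>n. (\<alpha> n, \<delta> n) \<notin> W" by metis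
  have "\<alpha> n \<in> mspace V_metric" and dist: "mdist V_metric \<beta> (\<alpha> n) < 1 / real (Suc n)" for n
    using \<alpha>[of n] unfolding in_mball by blast+
  then have \<alpha>V: "\<alpha> n \<in> V" for n unfolding mspace_V_metric(1) by blast
  have "(\<lambda>n. \<alpha> n i) \<longlonglongrightarrow> \<beta> i" for i
  proof (rule tendstoI)
    fix e :: real assume e: "0 < e"
    have "\<forall>\<^sub>F n in sequentially. 1 / real (Suc n) < e"
      using e by (intro order_tendstoD(2)[OF LIMSEQ_Suc[OF lim_const_over_n[of 1]]]) simp
    then show "\<forall>\<^sub>F n in sequentially. dist (\<alpha> n i) (\<beta> i) < e"
    proof eventually_elim
      case (elim n)
      have "\<bar>\<beta> i - \<alpha> n i\<bar> \<le> 1 / real (Suc n)"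
        using mdist_V_le_iff[OF \<beta> \<alpha>V, of n "1 / real (Suc n)"] dist[of n] by (simp add: less_imp_le)
      then show ?case using elim by (simp add: dist_real_def abs_minus_commute)
    qed
  qed
  moreover have "\<delta> \<longlonglongrightarrow> \<delta>'"
  proof (rule topological_tendstoI)
    fix S assume "open S" "\<delta>' \<in> S"
    then have "\<forall>\<^sub>F n in sequentially. B n \<subseteq> S" by (rule B(3))
    then show "\<forall>\<^sub>F n in sequentially. \<delta> n \<in> S"
      by eventually_elim (use \<delta> in blast)
  qed
  ultimately have "weak_tendsto (\<lambda>n. atoms_diam_pyramid (\<alpha> n) (\<delta> n)) (atoms_diam_pyramid \<beta> \<delta>')"
    by (intro weak_tendsto_atoms_diam_pyramid[OF \<alpha>V \<beta>])
  then have lim: "(\<forall>n. atoms_diam_pyramid (\<alpha> n) (\<delta> n) \<in> pyramids) \<and>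
      weak_tendsto (\<lambda>n. atoms_diam_pyramid (\<alpha> n) (\<delta> n)) (atoms_diam_pyramid \<beta> \<delta>')"
    by (intro conjI allI atoms_diam_pyramid_in_pyramids \<alpha>V)
  have *: "\<forall>Ps. \<forall>P\<in>U. (\<forall>n. Ps n \<in> pyramids) \<and> weak_tendsto Ps P \<longrightarrow> (\<forall>\<^sub>F n in sequentially. Ps n \<in> U)"
    using U unfolding openin_weak_topology by (rule conjunct2)
  have "atoms_diam_pyramid \<beta> \<delta>' \<in> U" using mem by (simp add: W_def)
  then have "\<forall>\<^sub>F n in sequentially. atoms_diam_pyramid (\<alpha> n) (\<delta> n) \<in> U"
    using *[THEN spec, THEN bspec, THEN mp, OF _ lim] by blast
  then obtain n where "atoms_diam_pyramid (\<alpha> n) (\<delta> n) \<in> U"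
    using eventually_happens'[OF sequentially_bot] by blast
  then show False using notin[of n] \<alpha>V by (simp add: W_def)
  qed
  then have "\<forall>x y. (x, y) \<in> W \<longrightarrow>
      (\<exists>A B. openin V_topology A \<and> openin euclidean B \<and> x \<in> A \<and> y \<in> B \<and> A \<times> B \<subseteq> W)"
    by blast
  then have "openin param_topology W" unfolding openin_prod_topology_alt .
  then show ?thesis unfolding W_def .
qed

text \<open>If pyramids from the image return infinitely often along a weakly convergent sequence,
  their parameters subconverge to a parameter in \<open>K\<close> by compactness. Continuity and
  uniqueness of weak limits then identify \<open>P\<close> with the pyramid of that
  parameter.\<close>

lemma closedin_param_image:
  assumes K: "closedin param_topology K"
  shows "closedin weak_topology ((\<lambda>x. atoms_diam_pyramid (fst x) (snd x)) ` K)"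
proof -
  let ?\<Phi> = "\<lambda>x. atoms_diam_pyramid (fst x) (snd x)"
  have KV: "fst x \<in> V" if "x \<in> K" for x using closedin_subset[OF K] that by auto
  have sub: "?\<Phi> ` K \<subseteq> pyramids" using atoms_diam_pyramid_in_pyramids KV by blast
  have "openin weak_topology (pyramids - ?\<Phi> ` K)"
    unfolding openin_weak_topology
  proof (intro conjI allI ballI impI)
    fix Ps P assume P: "P \<in> pyramids - ?\<Phi> ` K" and *: "(\<forall>n. Ps n \<in> pyramids) \<and> weak_tendsto Ps P"
    show "\<forall>\<^sub>F n in sequentially. Ps n \<in> pyramids - ?\<Phi> ` K"
    proof (rule ccontr)
      assume "\<not> ?thesis"
      then have "\<exists>n\<ge>N. Ps n \<in> ?\<Phi> ` K" for N
        using * unfolding eventually_sequentially by blast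
      then obtain r :: "nat \<Rightarrow> nat" where r: "strict_mono r" "\<And>k. Ps (r k) \<in> ?\<Phi> ` K"
        by (rule strict_mono_choice[where Q = "\<lambda>k n. Ps n \<in> ?\<Phi> ` K"]) (rule that, blast+)
      then have "\<forall>k. \<exists>x. x \<in> K \<and> Ps (r k) = ?\<Phi> x" by blast
      then obtain x where x: "\<And>k. x k \<in> K" "\<And>k. Ps (r k) = ?\<Phi> (x k)" by metis
      obtain s \<beta> where s: "strict_mono (s :: nat \<Rightarrow> nat)" "\<beta> \<in> V" "\<And>i. (\<lambda>n. fst (x (s n)) i) \<longlonglongrightarrow> \<beta> i"
        using V_convergent_subsequence[of "\<lambda>k. fst (x k)"] KV[OF x(1)] by blast
      obtain \<delta>' q where q: "strict_mono (q :: nat \<Rightarrow> nat)" "((\<lambda>n. snd (x (s n))) \<circ> q) \<longlonglongrightarrow> \<delta>'"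
        using compact_complete_linorder[of "\<lambda>n. snd (x (s n))"] by blast
      define y where "y n = x (s (q n))" for n
      have yK: "(fst (y n), snd (y n)) \<in> K" for n using x(1) by (simp add: y_def)
      have yV: "fst (y n) \<in> V" for n using KV[OF x(1)] by (simp add: y_def)
      have y1: "(\<lambda>n. fst (y n) i) \<longlonglongrightarrow> \<beta> i" for i
        using LIMSEQ_subseq_LIMSEQ[OF s(3) q(1)] by (simp add: y_def o_def)
      have y2: "(\<lambda>n. snd (y n)) \<longlonglongrightarrow> \<delta>'" using q(2) by (simp add: y_def o_def)
      have \<beta>K: "(\<beta>, \<delta>') \<in> K"
        by (rule closedin_param_topology_limit[OF K yK s(2) y1 y2])
      have 1: "weak_tendsto (\<lambda>n. ?\<Phi> (y n)) (atoms_diam_pyramid \<beta> \<delta>')"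
        by (rule weak_tendsto_atoms_diam_pyramid[OF yV s(2) y1 y2])
      have sq: "strict_mono (\<lambda>n. r (s (q n)))"
        using strict_mono_o[OF r(1) strict_mono_o[OF s(1) q(1)]] by (simp add: o_def)
      have "weak_tendsto (\<lambda>n. Ps (r (s (q n)))) P"
        using weak_tendsto_subseq[OF _ sq] * by blast
      then have 2: "weak_tendsto (\<lambda>n. ?\<Phi> (y n)) P"
        unfolding x(2) y_def .
      have "P = atoms_diam_pyramid \<beta> \<delta>'"
        using weak_tendsto_unique[OF 1 _ 2] weak_tendsto_unique[OF 2 _ 1] P
          pyramids_subset[OF atoms_diam_pyramid_in_pyramids[OF s(2)]] pyramids_subset[of P] by blast
      then have "P = ?\<Phi> (\<beta>, \<delta>')" by simp
      then show False using P \<beta>K by blast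
    qed
  qed blast
  then show ?thesis using sub by (simp add: closedin_def)
qed

section \<open>The quotient\<close>

text \<open>The generating relation relates any two trivial parameters and is thus already symmetric
  and transitive; only the diagonal has to be added.\<close>

lemma sim_eq: "sim = {(x, y). x \<in> V \<times> UNIV \<and> y \<in> V \<times> UNIV \<and> (x = y \<or> trivial_param x \<and> trivial_param y)}"
  (is "_ = ?R")
proof
  let ?r = "{((\<alpha>, \<delta>), (\<beta>, \<delta>')). (\<alpha> = one_V \<or> \<delta> = 0) \<and> (\<beta> = one_V \<or> \<delta>' = (0 :: ennreal))}"
  have r: "(x, y) \<in> ?r \<longleftrightarrow> trivial_param x \<and> trivial_param y" for x y
    by (cases x; cases y) (simp add: trivial_param_def)
  have "refl_on (V \<times> UNIV) ?R" "sym ?R" "trans ?R" "?R \<subseteq> (V \<times> UNIV) \<times> (V \<times> UNIV)"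
    by (auto simp: refl_on_def sym_def trans_def)
  then have "equiv (V \<times> UNIV) ?R"
    by (simp add: equiv_def)
  moreover have "?r \<inter> (V \<times> UNIV) \<times> (V \<times> UNIV) \<subseteq> ?R"
    using r by blast
  ultimately show "sim \<subseteq> ?R"
    unfolding sim_def generated_equiv_def by blast
  show "?R \<subseteq> sim"
    unfolding sim_def generated_equiv_def
  proof (intro subsetI InterI)
    fix p R assume p: "p \<in> ?R" and R: "R \<in> {R. equiv (V \<times> UNIV) R \<and> ?r \<inter> (V \<times> UNIV) \<times> (V \<times> UNIV) \<subseteq> R}"
    obtain x y where xy: "p = (x, y)" by (cases p)
    show "p \<in> R"
    proof (cases "x = y")
      case True
      have "refl_on (V \<times> UNIV) R" using R by (auto simp: equiv_def)
      then show ?thesis using p xy True by (auto dest: refl_onD)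
    next
      case False
      then have "p \<in> ?r \<inter> (V \<times> UNIV) \<times> (V \<times> UNIV)" using p xy r by blast
      then show ?thesis using R by blast
    qed
  qed
qed

lemma sim_iff:
  "(x, y) \<in> sim \<longleftrightarrow> x \<in> V \<times> UNIV \<and> y \<in> V \<times> UNIV \<and> (x = y \<or> trivial_param x \<and> trivial_param y)"
  unfolding sim_eq by blast

lemma sim_class_eq:
  assumes x: "x \<in> V \<times> UNIV" and y: "y \<in> V \<times> UNIV" and xy: "x = y \<or> trivial_param x \<and> trivial_param y"
  shows "sim `` {x} = sim `` {y}"
proof -
  have "(x, z) \<in> sim \<longleftrightarrow> (y, z) \<in> sim" for z
    unfolding sim_iff using assms by metis
  then show ?thesis by blast
qed

text \<open>All members of a class have the same pyramid, so \<open>the_elem\<close> is applied to a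
  singleton.\<close>

lemma Psi_sim:
  assumes x: "x \<in> V \<times> UNIV"
  shows "Psi (sim `` {x}) = atoms_diam_pyramid (fst x) (snd x)"
proof -
  have const: "(\<lambda>(\<alpha>, \<delta>). atoms_diam_pyramid \<alpha> \<delta>) y = atoms_diam_pyramid (fst x) (snd x)"
    if "y \<in> sim `` {x}" for y
  proof -
    have "(x, y) \<in> sim" using that by blast
    then have y: "y \<in> V \<times> UNIV" "x = y \<or> trivial_param x \<and> trivial_param y" unfolding sim_iff by blast+
    have "atoms_diam_pyramid (fst x) (snd x) = atoms_diam_pyramid (fst y) (snd y)"
      using pyramid_eq_iff[of "fst x" "fst y" "snd x" "snd y"] x y by auto
    then show ?thesis by (simp add: case_prod_beta)
  qed
  have "(x, x) \<in> sim" unfolding sim_iff using x by blast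
  then have "sim `` {x} \<noteq> {}" by blast
  moreover have "(\<lambda>(\<alpha>, \<delta>). atoms_diam_pyramid \<alpha> \<delta>) ` (sim `` {x}) = (\<lambda>_. atoms_diam_pyramid (fst x) (snd x)) ` (sim `` {x})"
    by (rule image_cong[OF refl const])
  ultimately have "(\<lambda>(\<alpha>, \<delta>). atoms_diam_pyramid \<alpha> \<delta>) ` (sim `` {x}) = {atoms_diam_pyramid (fst x) (snd x)}"
    by (simp only: image_constant_conv if_False)
  then show ?thesis unfolding Psi_def by (simp only: the_elem_eq)
qed

lemma topspace_param_topology: "topspace param_topology = V \<times> UNIV"
  by simp

lemma openin_V_quotient:
  "openin V_quotient U \<longleftrightarrow> U \<subseteq> (V \<times> UNIV) // sim \<and> openin param_topology {x \<in> V \<times> UNIV. sim `` {x} \<in> U}"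
  unfolding V_quotient_def openin_quotient_topology topspace_param_topology ..

lemma topspace_V_quotient: "topspace V_quotient = (V \<times> UNIV) // sim"
proof
  show "topspace V_quotient \<subseteq> (V \<times> UNIV) // sim"
    using openin_topspace[of V_quotient] unfolding openin_V_quotient by (rule conjunct1)
  have eq: "{x \<in> V \<times> UNIV. sim `` {x} \<in> (V \<times> UNIV) // sim} = topspace param_topology"
    unfolding topspace_param_topology using quotientI[of _ "V \<times> UNIV" sim] by blast
  have "openin V_quotient ((V \<times> UNIV) // sim)"
    unfolding openin_V_quotient eq by (intro conjI order_refl openin_topspace)
  then show "(V \<times> UNIV) // sim \<subseteq> topspace V_quotient" by (rule openin_subset)
qed

lemma S_pyramids_eq: "S_pyramids = (\<lambda>x. atoms_diam_pyramid (fst x) (snd x)) ` (V \<times> UNIV)"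
proof (intro equalityI subsetI)
  fix P assume "P \<in> S_pyramids"
  then obtain \<alpha> \<delta> where "\<alpha> \<in> V" "P = atoms_diam_pyramid \<alpha> \<delta>" by (auto simp: S_pyramids_def)
  then show "P \<in> (\<lambda>x. atoms_diam_pyramid (fst x) (snd x)) ` (V \<times> UNIV)"
    by (intro image_eqI[of _ _ "(\<alpha>, \<delta>)"]) auto
next
  fix P assume "P \<in> (\<lambda>x. atoms_diam_pyramid (fst x) (snd x)) ` (V \<times> UNIV)"
  then obtain \<alpha> \<delta> where "\<alpha> \<in> V" "P = atoms_diam_pyramid \<alpha> \<delta>" by auto
  then show "P \<in> S_pyramids"
    using atoms_diam_pyramid_in_pyramids[of \<alpha> \<delta>] unfolding S_pyramids_def by blast
qed

text \<open>Turns an image under \<open>Psi\<close> into the image of a saturated set of parameters,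
  the form to which \<open>closedin_param_image\<close> applies.\<close>

lemma Psi_image:
  assumes K: "K \<subseteq> (V \<times> UNIV) // sim"
  shows "Psi ` K = (\<lambda>x. atoms_diam_pyramid (fst x) (snd x)) ` {x \<in> V \<times> UNIV. sim `` {x} \<in> K}"
proof (intro equalityI subsetI)
  fix P assume "P \<in> Psi ` K"
  then obtain c where c: "c \<in> K" "P = Psi c" by blast
  then obtain x where x: "x \<in> V \<times> UNIV" "c = sim `` {x}" using K by (blast elim: quotientE)
  then have "P = atoms_diam_pyramid (fst x) (snd x)" using c(2) Psi_sim by simp
  then show "P \<in> (\<lambda>x. atoms_diam_pyramid (fst x) (snd x)) ` {x \<in> V \<times> UNIV. sim `` {x} \<in> K}"
    using x c(1) by blast
next
  fix P assume "P \<in> (\<lambda>x. atoms_diam_pyramid (fst x) (snd x)) ` {x \<in> V \<times> UNIV. sim `` {x} \<in> K}"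
  then obtain x where x: "x \<in> V \<times> UNIV" "sim `` {x} \<in> K" "P = atoms_diam_pyramid (fst x) (snd x)" by blast
  then have "P = Psi (sim `` {x})" using Psi_sim by simp
  then show "P \<in> Psi ` K" using x(2) by blast
qed

theorem theorem6p30:
  shows "(\<forall>\<alpha>\<in>V. \<forall>\<delta>. Psi (sim `` {(\<alpha>, \<delta>)}) = atoms_diam_pyramid \<alpha> \<delta>) \<and>
    homeomorphic_map V_quotient (subtopology weak_topology S_pyramids) Psi"
proof (intro conjI ballI allI)
  show "Psi (sim `` {(\<alpha>, \<delta>)}) = atoms_diam_pyramid \<alpha> \<delta>" if "\<alpha> \<in> V" for \<alpha> \<delta>
    using Psi_sim[of "(\<alpha>, \<delta>)"] that by simp
  have all: "{x \<in> V \<times> UNIV. sim `` {x} \<in> (V \<times> UNIV) // sim} = V \<times> UNIV"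
    using quotientI[of _ "V \<times> UNIV" sim] by blast
  have image: "Psi ` ((V \<times> UNIV) // sim) = S_pyramids"
    unfolding Psi_image[OF order_refl] all S_pyramids_eq ..
  have S: "S_pyramids \<subseteq> pyramids" by (auto simp: S_pyramids_def)
  have top: "topspace (subtopology weak_topology S_pyramids) = S_pyramids"
    unfolding topspace_subtopology topspace_weak_topology using S by blast
  show "homeomorphic_map V_quotient (subtopology weak_topology S_pyramids) Psi"
  proof (rule bijective_closed_imp_homeomorphic_map)
    show "continuous_map V_quotient (subtopology weak_topology S_pyramids) Psi"
      unfolding continuous_map_def topspace_V_quotient top
    proof (intro conjI allI impI)
      show "Psi \<in> (V \<times> UNIV) // sim \<rightarrow> S_pyramids" using image by blast
      fix U assume "openin (subtopology weak_topology S_pyramids) U"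
      then obtain W where W: "openin weak_topology W" "U = W \<inter> S_pyramids"
        unfolding openin_subtopology by blast
      \<comment> \<open>By definition of the quotient topology, openness is tested on the set of
        parameters whose pyramid lies in \<open>W\<close>.\<close>
      have eq: "{x \<in> V \<times> UNIV. sim `` {x} \<in> {c \<in> (V \<times> UNIV) // sim. Psi c \<in> U}} =
          {x \<in> V \<times> UNIV. atoms_diam_pyramid (fst x) (snd x) \<in> W}"
      proof (intro Collect_cong conj_cong refl)
        fix x :: "(nat \<Rightarrow> real) \<times> ennreal" assume x: "x \<in> V \<times> UNIV"
        have "Psi (sim `` {x}) \<in> S_pyramids" using image quotientI[OF x, of sim] by blast
        then show "sim `` {x} \<in> {c \<in> (V \<times> UNIV) // sim. Psi c \<in> U} \<longleftrightarrow> atoms_diam_pyramid (fst x) (snd x) \<in> W"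
          unfolding W(2) Psi_sim[OF x, symmetric] using quotientI[OF x, of sim] by blast
      qed
      show "openin V_quotient {c \<in> (V \<times> UNIV) // sim. Psi c \<in> U}"
        unfolding openin_V_quotient eq using openin_param_vimage[OF W(1)] by blast
    qed
    \<comment> \<open>A closed set of the quotient has a closed preimage among the parameters, and
      its image under \<open>Psi\<close> is the set of pyramids of that preimage.\<close>
    show "closed_map V_quotient (subtopology weak_topology S_pyramids) Psi"
      unfolding closed_map_def
    proof (intro allI impI)
      fix K assume K: "closedin V_quotient K"
      have sub: "K \<subseteq> (V \<times> UNIV) // sim"
        using closedin_subset[OF K] by (simp only: topspace_V_quotient)
      have "openin V_quotient ((V \<times> UNIV) // sim - K)"
        using K by (simp only: closedin_def topspace_V_quotient)
      then have "openin param_topology {x \<in> V \<times> UNIV. sim `` {x} \<in> (V \<times> UNIV) // sim - K}"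
        unfolding openin_V_quotient by blast
      moreover have "{x \<in> V \<times> UNIV. sim `` {x} \<in> (V \<times> UNIV) // sim - K} =
          topspace param_topology - {x \<in> V \<times> UNIV. sim `` {x} \<in> K}"
        unfolding topspace_param_topology using quotientI[of _ "V \<times> UNIV" sim] by blast
      ultimately have "closedin param_topology {x \<in> V \<times> UNIV. sim `` {x} \<in> K}"
        unfolding closedin_def topspace_param_topology by (metis (no_types, lifting) mem_Collect_eq subsetI)
      then have "closedin weak_topology (Psi ` K)"
        unfolding Psi_image[OF sub] by (rule closedin_param_image)
      moreover have "Psi ` K \<subseteq> S_pyramids" using sub image by blast
      ultimately show "closedin (subtopology weak_topology S_pyramids) (Psi ` K)"
        by (rule closedin_subset_topspace)
    qed
    show "Psi ` topspace V_quotient = topspace (subtopology weak_topology S_pyramids)"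
      unfolding topspace_V_quotient top by (rule image)
    show "inj_on Psi (topspace V_quotient)"
      unfolding topspace_V_quotient
    proof (rule inj_onI)
      fix c d assume cd: "c \<in> (V \<times> UNIV) // sim" "d \<in> (V \<times> UNIV) // sim" "Psi c = Psi d"
      obtain x where x: "x \<in> V \<times> UNIV" "c = sim `` {x}" using cd(1) by (rule quotientE)
      obtain y where y: "y \<in> V \<times> UNIV" "d = sim `` {y}" using cd(2) by (rule quotientE)
      have "atoms_diam_pyramid (fst x) (snd x) = atoms_diam_pyramid (fst y) (snd y)"
        using cd(3) Psi_sim[OF x(1)] Psi_sim[OF y(1)] x(2) y(2) by simp
      then have "x = y \<or> trivial_param x \<and> trivial_param y"
        using pyramid_eq_iff[of "fst x" "fst y" "snd x" "snd y"] x(1) y(1) by auto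
      then show "c = d" unfolding x(2) y(2) by (rule sim_class_eq[OF x(1) y(1)])
    qed
  qed
qed

end
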